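(* Let $N\ge2$, let $\tau\ge1$ be an integer, and let $A_i\in\mathbb{R}^{n\times n}$, $E_i\in\mathbb{R}^{n\times p_i}$, $C_i\in\mathbb{R}^{q_i\times n}$, $F_i\in\mathbb{R}^{q_i\times p_i}$, $i=1,\ldots,N$. The following statements are equivalent: (a) There exist matrices $P_i\in\mathbb{S}_{\succ0}^n$, $i=1,\ldots,N$, and a scalar $\gamma>0$ such that $$\begin{bmatrix}A_i^\prime P_iA_i-P_i+C_i^\prime C_i & A_i^\prime P_iE_i+C_i^\prime F_i\\ \star & E_i^\prime P_iE_i+F_i^\prime F_i-\gamma^2I_{p_i}\end{bmatrix}\prec0$$ and $$\begin{bmatrix}-P_j & 0\\ \star & -\gamma^2I_{\tau p_i}\end{bmatrix}+G_i\begin{bmatrix}P_i & 0\\ 0 & I_{\tau q_i}\end{bmatrix}G_i^\prime\prec0,\qquad G_i:=\begin{bmatrix}(A_i^{\prime})^{\tau} & \mathcal{C}_i(\tau)^\prime\\ \mathcal{E}_i(\tau)^\prime & \mathcal{F}_i(\tau)^\prime\end{bmatrix},$$ hold for all $i,j=1,\ldots,N$, $i\ne j$, where $\mathcal{C}_i(1)=C_i$, $\mathcal{E}_i(1)=E_i$, $\mathcal{F}_i(1)=F_i$ and, when $\tau\ge2$, $$\mathcal{C}_i(\tau)=\begin{bmatrix}C_i\\ C_iA_i\\ \vdots\\ C_iA_i^{\tau-1}\end{bmatrix},\qquad \mathcal{E}_i(\tau)=\begin{bmatrix}A_i^{\tau-1}E_i & A_i^{\tau-2}E_i & \cdots & E_i\end{bmatrix},$$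 and $\mathcal{F}_i(\tau)$ is the lower triangular block Toeplitz matrix of the Markov parameters $h_i(0)=F_i$, $h_i(k)=C_iA_i^{k-1}E_i$, $k\ge1$, up to order $k=\tau-1$, i.e. the first block column of $\mathcal{F}_i(\tau)$ is the vertical stacking of $F_i,\,C_iE_i,\,C_iA_iE_i,\ldots,C_iA_i^{\tau-2}E_i$. (b) There exist matrix sequences $R_i:\{0,\ldots,\tau\}\to\mathbb{S}^n$, $R_i(0)\succ0$, $i=1,\ldots,N$, and scalars $\varepsilon>0$, $\gamma>0$ such that $$\begin{bmatrix}\Xi_{11}^i(\tau,\tau) & \Xi_{12}^i(\tau)\\ \star & \Xi_{22}^i(\tau)\end{bmatrix}\prec0,$$ $$\begin{bmatrix}\Xi_{11}^i(k+1,k) & \Xi_{12}^i(k+1)\\ \star & \Xi_{22}^i(k+1)\end{bmatrix}\preceq0,$$ $$R_i(0)-R_j(\tau)+\varepsilon I\preceq0$$ hold for all $i,j=1,\ldots,N$, $i\ne j$ and $k=0,\ldots,\tau-1$, where $$\Xi_{11}^i(\theta_1,\theta_2)=A_i^\prime R_i(\theta_1)A_i-R_i(\theta_2)+C_i^\prime C_i,\quad \Xi_{12}^i(\theta)=A_i^\prime R_i(\theta)E_i+C_i^\prime F_i,\quad \Xi_{22}^i(\theta)=E_i^\prime R_i(\theta)E_i+F_i^\prime F_i-\gamma^2I_{p_i}.$$ (c) There exist matrix sequences $S_i:\{0,\ldots,\tau\}\to\mathbb{S}^n$, $S_i(\tau)\succ0$, $i=1,\ldots,N$, and scalars $\varepsilon>0$,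 $\gamma>0$ such that $$\begin{bmatrix}\Gamma_{11}^i(\tau,\tau) & E_i & A_iS_i(\tau)C_i^\prime\\ \star & -\gamma^2I_{p_i} & F_i^\prime\\ \star & \star & -I_{q_i}+C_iS_i(\tau)C_i^\prime\end{bmatrix}\prec0,$$ $$\begin{bmatrix}\Gamma_{11}^i(k,k+1) & E_i & A_iS_i(k)C_i^\prime\\ \star & -\gamma^2I_{p_i} & F_i^\prime\\ \star & \star & -I_{q_i}+C_iS_i(k)C_i^\prime\end{bmatrix}\preceq0,$$ $$S_j(\tau)-S_i(0)+\varepsilon I\preceq0$$ hold for all $i,j=1,\ldots,N$, $i\ne j$ and $k=0,\ldots,\tau-1$, where $\Gamma_{11}^i(\theta_1,\theta_2)=A_iS_i(\theta_1)A_i^{\prime}-S_i(\theta_2)$. Moreover, when one of the equivalent statements (a), (b), (c) holds, the switched system $$x(t+1)=A_{\sigma(t)}x(t)+E_{\sigma(t)}w_{\sigma(t)}(t),\qquad z_{\sigma(t)}(t)=C_{\sigma(t)}x(t)+F_{\sigma(t)}w_{\sigma(t)}(t)$$ is asymptotically stable for all switching-time sequences $\{\phi_s\}_{s\in\mathbb{N}}$ satisfying $\tau_s\ge\tau$ for all $s$, and the $\ell_2$-gain of the transfer $w\mapsto z$ (under minimum dwell-time $\tau$) is less than $\gamma$.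
   Context: $\mathbb{S}^n$ denotes the set of real symmetric $n\times n$ matrices and $\mathbb{S}^n_{\succ0}$ the set of positive definite ones. For symmetric $A,B$, $A\succ B$ (resp. $A\succeq B$) means $A-B$ is positive definite (resp. positive semidefinite); $\prec,\preceq$ are the reversed relations. $A^\prime$ is the transpose of $A$, $I_m$ is the $m\times m$ identity matrix. In a symmetric block matrix, $\star$ stands for the block determined by symmetry. Switched system: the state is $x(t)\in\mathbb{R}^n$; $w_i(t)\in\mathbb{R}^{p_i}$ and $z_i(t)\in\mathbb{R}^{q_i}$ are the exogenous input and the controlled output of mode $i$ (dimensions may differ between modes); the switching signal is $\sigma:\mathbb{N}\to\{1,\ldots,N\}$, where $N$ is the number of subsystems. The switching instants $\{\phi_q\}_{q\in\mathbb{N}}$ are the instants at which $\sigma(t)$ changes value, with the convention $\phi_0=0$; $\sigma$ is constant on $\{\phi_q,\ldots,\phi_{q+1}-1\}$. The dwell-times are $\tau_q:=\phi_{q+1}-\phi_q$. The $\ell_2$-gain under minimum dwell-time $\tau$ is the smallest $\gamma>0$ such that $$\sum_{q\in\mathbb{N}}\sum_{k=0}^{\tau_q-1}\|z_{\sigma(\phi_q)}(\phi_q+k)\|_2^2\le\gamma^2\sum_{q\in\mathbb{N}}\sum_{k=0}^{\tau_q-1}\|w_{\sigma(\phi_q)}(\phi_q+k)\|_2^2$$ for all $\tau_q\ge\tau$ and all $\sigma(\phi_q)\in\{1,\ldots,N\}$, $q\in\mathbb{N}$, along the trajectories of the system with zero initial conditions. *)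

theory Defs
  imports
    "Jordan_Normal_Form.Matrix"
    "HOL-Library.Extended_Nonnegative_Real"
begin

definition symmetric_mats :: "nat \<Rightarrow> real mat set" where
  "symmetric_mats d = {A \<in> carrier_mat d d. transpose_mat A = A}"

definition pos_def :: "nat \<Rightarrow> real mat \<Rightarrow> bool" where
  "pos_def d A \<longleftrightarrow> A \<in> symmetric_mats d \<and>
     (\<forall>v\<in>carrier_vec d. v \<noteq> 0\<^sub>v d \<longrightarrow> 0 < v \<bullet> (A *\<^sub>v v))"

definition pos_semidef :: "nat \<Rightarrow> real mat \<Rightarrow> bool" where
  "pos_semidef d A \<longleftrightarrow> A \<in> symmetric_mats d \<and> (\<forall>v\<in>carrier_vec d. 0 \<le> v \<bullet> (A *\<^sub>v v))"

definition loewner_less :: "real mat \<Rightarrow> nat \<Rightarrow> real mat \<Rightarrow> bool"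
  (\<open>(_ \<prec>\<^bsub>_\<^esub> _)\<close> [51, 0, 51] 50) where
  "A \<prec>\<^bsub>d\<^esub> B \<longleftrightarrow> A \<in> symmetric_mats d \<and> B \<in> symmetric_mats d \<and> pos_def d (B - A)"

definition loewner_le :: "real mat \<Rightarrow> nat \<Rightarrow> real mat \<Rightarrow> bool"
  (\<open>(_ \<preceq>\<^bsub>_\<^esub> _)\<close> [51, 0, 51] 50) where
  "A \<preceq>\<^bsub>d\<^esub> B \<longleftrightarrow> A \<in> symmetric_mats d \<and> B \<in> symmetric_mats d \<and> pos_semidef d (B - A)"

text \<open>Symmetric block matrices, given by the blocks on and above the diagonal, row by row.\<close>

definition sym_block2 :: "real mat \<Rightarrow> real mat \<Rightarrow> real mat \<Rightarrow> real mat" where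
  "sym_block2 M11 M12 M22 = four_block_mat M11 M12 (transpose_mat M12) M22"

definition sym_block3 ::
  "real mat \<Rightarrow> real mat \<Rightarrow> real mat \<Rightarrow> real mat \<Rightarrow> real mat \<Rightarrow> real mat \<Rightarrow> real mat" where
  "sym_block3 M11 M12 M13 M22 M23 M33 =
     sym_block2 (sym_block2 M11 M12 M22) (M13 @\<^sub>r M23) M33"

text \<open>
  In the following, \<open>A\<close>, \<open>E\<close>, \<open>C\<close>, \<open>F\<close> are the matrices of a single mode with
  \<open>n\<close> states, \<open>p\<close> inputs and \<open>q\<close> outputs. The matrix below is the one formed by the
  blocks \<open>\<Xi>\<^sub>1\<^sub>1(\<theta>\<^sub>1,\<theta>\<^sub>2)\<close>, \<open>\<Xi>\<^sub>1\<^sub>2(\<theta>\<^sub>1)\<close>, \<open>\<Xi>\<^sub>2\<^sub>2(\<theta>\<^sub>1)\<close>, with \<open>R1 = R(\<theta>\<^sub>1)\<close> and \<open>R2 = R(\<theta>\<^sub>2)\<close>.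
\<close>

definition primal_lmi ::
  "nat \<Rightarrow> real mat \<Rightarrow> real mat \<Rightarrow> real mat \<Rightarrow> real mat \<Rightarrow> real \<Rightarrow> real mat \<Rightarrow> real mat \<Rightarrow> real mat" where
  "primal_lmi p A E C F \<gamma> R1 R2 = sym_block2
     (transpose_mat A * R1 * A - R2 + transpose_mat C * C)
     (transpose_mat A * R1 * E + transpose_mat C * F)
     (transpose_mat E * R1 * E + transpose_mat F * F - \<gamma>\<^sup>2 \<cdot>\<^sub>m 1\<^sub>m p)"

text \<open>Likewise for the blocks of the dual inequalities, with \<open>S1 = S(\<theta>\<^sub>1)\<close> and \<open>S2 = S(\<theta>\<^sub>2)\<close>.\<close>

definition dual_lmi ::
  "nat \<Rightarrow> nat \<Rightarrow> real mat \<Rightarrow> real mat \<Rightarrow> real mat \<Rightarrow> real mat \<Rightarrow> real \<Rightarrow> real mat \<Rightarrow> real mat \<Rightarrow> real mat" where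
  "dual_lmi p q A E C F \<gamma> S1 S2 = sym_block3
     (A * S1 * transpose_mat A - S2)  E                         (A * S1 * transpose_mat C)
                                      (- (\<gamma>\<^sup>2 \<cdot>\<^sub>m 1\<^sub>m p))  (transpose_mat F)
                                                                (- 1\<^sub>m q + C * S1 * transpose_mat C)"

text \<open>
  The lifted matrices over \<open>\<tau>\<close> steps. Row (column) number \<open>r\<close> of a stack of blocks
  of height (width) \<open>m\<close> lies in block \<open>r div m\<close>, at position \<open>r mod m\<close>; blocks are counted
  from \<open>0\<close>.
\<close>

definition lifted_C :: "nat \<Rightarrow> nat \<Rightarrow> real mat \<Rightarrow> real mat \<Rightarrow> nat \<Rightarrow> real mat" where
  "lifted_C n q A C \<tau> = mat (\<tau> * q) n (\<lambda>(r, c). (C * A ^\<^sub>m (r div q)) $$ (r mod q, c))"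

definition lifted_E :: "nat \<Rightarrow> nat \<Rightarrow> real mat \<Rightarrow> real mat \<Rightarrow> nat \<Rightarrow> real mat" where
  "lifted_E n p A E \<tau> =
     mat n (\<tau> * p) (\<lambda>(r, c). (A ^\<^sub>m (\<tau> - 1 - c div p) * E) $$ (r, c mod p))"

fun markov :: "real mat \<Rightarrow> real mat \<Rightarrow> real mat \<Rightarrow> real mat \<Rightarrow> nat \<Rightarrow> real mat" where
  "markov A E C F 0 = F"
| "markov A E C F (Suc k) = C * A ^\<^sub>m k * E"

definition lifted_F ::
  "nat \<Rightarrow> nat \<Rightarrow> real mat \<Rightarrow> real mat \<Rightarrow> real mat \<Rightarrow> real mat \<Rightarrow> nat \<Rightarrow> real mat" where
  "lifted_F p q A E C F \<tau> = mat (\<tau> * q) (\<tau> * p)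
     (\<lambda>(r, c). if c div p \<le> r div q
               then markov A E C F (r div q - c div p) $$ (r mod q, c mod p) else 0)"

definition lifted_G ::
  "nat \<Rightarrow> nat \<Rightarrow> nat \<Rightarrow> real mat \<Rightarrow> real mat \<Rightarrow> real mat \<Rightarrow> real mat \<Rightarrow> nat \<Rightarrow> real mat" where
  "lifted_G n p q A E C F \<tau> = four_block_mat
     (transpose_mat A ^\<^sub>m \<tau>)                   (transpose_mat (lifted_C n q A C \<tau>))
     (transpose_mat (lifted_E n p A E \<tau>))     (transpose_mat (lifted_F p q A E C F \<tau>))"

text \<open>
  The three feasibility conditions to be compared, each for a given \<open>\<gamma>\<close>; modes are numbered
  \<open>1, \<dots>, N\<close>.
\<close>

definition lifted_condition ::
  "nat \<Rightarrow> nat \<Rightarrow> nat \<Rightarrow> (nat \<Rightarrow> nat) \<Rightarrow> (nat \<Rightarrow> nat) \<Rightarrow> (nat \<Rightarrow> real mat) \<Rightarrow> (nat \<Rightarrow> real mat) \<Rightarrow>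
   (nat \<Rightarrow> real mat) \<Rightarrow> (nat \<Rightarrow> real mat) \<Rightarrow> real \<Rightarrow> bool" where
  "lifted_condition N \<tau> n p q A E C F \<gamma> \<longleftrightarrow>
     (\<exists>P :: nat \<Rightarrow> real mat.
        (\<forall>i\<in>{1..N}. pos_def n (P i)) \<and>
        (\<forall>i\<in>{1..N}. \<forall>j\<in>{1..N}. i \<noteq> j \<longrightarrow>
           primal_lmi (p i) (A i) (E i) (C i) (F i) \<gamma> (P i) (P i)
             \<prec>\<^bsub>n + p i\<^esub> 0\<^sub>m (n + p i) (n + p i) \<and>
           (let G = lifted_G n (p i) (q i) (A i) (E i) (C i) (F i) \<tau> in
            sym_block2 (- P j) (0\<^sub>m n (\<tau> * p i)) (- (\<gamma>\<^sup>2 \<cdot>\<^sub>m 1\<^sub>m (\<tau> * p i))) +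
            G * sym_block2 (P i) (0\<^sub>m n (\<tau> * q i)) (1\<^sub>m (\<tau> * q i)) * transpose_mat G
              \<prec>\<^bsub>n + \<tau> * p i\<^esub> 0\<^sub>m (n + \<tau> * p i) (n + \<tau> * p i))))"

definition primal_condition ::
  "nat \<Rightarrow> nat \<Rightarrow> nat \<Rightarrow> (nat \<Rightarrow> nat) \<Rightarrow> (nat \<Rightarrow> real mat) \<Rightarrow> (nat \<Rightarrow> real mat) \<Rightarrow>
   (nat \<Rightarrow> real mat) \<Rightarrow> (nat \<Rightarrow> real mat) \<Rightarrow> real \<Rightarrow> bool" where
  "primal_condition N \<tau> n p A E C F \<gamma> \<longleftrightarrow>
     (\<exists>(R :: nat \<Rightarrow> nat \<Rightarrow> real mat) \<epsilon>. 0 < \<epsilon> \<and>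
        (\<forall>i\<in>{1..N}. (\<forall>k\<in>{0..\<tau>}. R i k \<in> symmetric_mats n) \<and> pos_def n (R i 0)) \<and>
        (\<forall>i\<in>{1..N}. \<forall>j\<in>{1..N}. i \<noteq> j \<longrightarrow>
           primal_lmi (p i) (A i) (E i) (C i) (F i) \<gamma> (R i \<tau>) (R i \<tau>)
             \<prec>\<^bsub>n + p i\<^esub> 0\<^sub>m (n + p i) (n + p i) \<and>
           (\<forall>k\<in>{0..\<tau> - 1}.
              primal_lmi (p i) (A i) (E i) (C i) (F i) \<gamma> (R i (k + 1)) (R i k)
                \<preceq>\<^bsub>n + p i\<^esub> 0\<^sub>m (n + p i) (n + p i)) \<and>
           R i 0 - R j \<tau> + \<epsilon> \<cdot>\<^sub>m 1\<^sub>m n \<preceq>\<^bsub>n\<^esub> 0\<^sub>m n n))"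

definition dual_condition ::
  "nat \<Rightarrow> nat \<Rightarrow> nat \<Rightarrow> (nat \<Rightarrow> nat) \<Rightarrow> (nat \<Rightarrow> nat) \<Rightarrow> (nat \<Rightarrow> real mat) \<Rightarrow> (nat \<Rightarrow> real mat) \<Rightarrow>
   (nat \<Rightarrow> real mat) \<Rightarrow> (nat \<Rightarrow> real mat) \<Rightarrow> real \<Rightarrow> bool" where
  "dual_condition N \<tau> n p q A E C F \<gamma> \<longleftrightarrow>
     (\<exists>(S :: nat \<Rightarrow> nat \<Rightarrow> real mat) \<epsilon>. 0 < \<epsilon> \<and>
        (\<forall>i\<in>{1..N}. (\<forall>k\<in>{0..\<tau>}. S i k \<in> symmetric_mats n) \<and> pos_def n (S i \<tau>)) \<and>
        (\<forall>i\<in>{1..N}. \<forall>j\<in>{1..N}. i \<noteq> j \<longrightarrow>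
           dual_lmi (p i) (q i) (A i) (E i) (C i) (F i) \<gamma> (S i \<tau>) (S i \<tau>)
             \<prec>\<^bsub>n + p i + q i\<^esub> 0\<^sub>m (n + p i + q i) (n + p i + q i) \<and>
           (\<forall>k\<in>{0..\<tau> - 1}.
              dual_lmi (p i) (q i) (A i) (E i) (C i) (F i) \<gamma> (S i k) (S i (k + 1))
                \<preceq>\<^bsub>n + p i + q i\<^esub> 0\<^sub>m (n + p i + q i) (n + p i + q i)) \<and>
           S j \<tau> - S i 0 + \<epsilon> \<cdot>\<^sub>m 1\<^sub>m n \<preceq>\<^bsub>n\<^esub> 0\<^sub>m n n))"

text \<open>
  \<open>\<sigma>\<close> is a switching signal with switching instants \<open>\<phi>\<close> and all dwell-times
  \<open>\<phi> (s + 1) - \<phi> s\<close> at least \<open>\<tau>\<close>. The modes on two consecutive intervals may coincide. For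
  \<open>\<tau> \<ge> 1\<close> the signals \<open>\<sigma>\<close> admitting such a \<open>\<phi>\<close> are thus exactly those whose changes of value are
  at least \<open>\<tau>\<close> apart from each other and from time \<open>0\<close>, and signals that change value only finitely
  often are included.
\<close>

definition switching_signal :: "nat \<Rightarrow> nat \<Rightarrow> (nat \<Rightarrow> nat) \<Rightarrow> (nat \<Rightarrow> nat) \<Rightarrow> bool" where
  "switching_signal N \<tau> \<phi> \<sigma> \<longleftrightarrow>
     \<phi> 0 = 0 \<and>
     (\<forall>s. \<phi> s + \<tau> \<le> \<phi> (Suc s)) \<and>
     (\<forall>t. \<sigma> t \<in> {1..N}) \<and>
     (\<forall>s. \<forall>t\<in>{\<phi> s..<\<phi> (Suc s)}. \<sigma> t = \<sigma> (\<phi> s))"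

text \<open>The exogenous input is \<open>w i t\<close>, for mode \<open>i\<close> at time \<open>t\<close>.\<close>

primrec state ::
  "(nat \<Rightarrow> real mat) \<Rightarrow> (nat \<Rightarrow> real mat) \<Rightarrow> (nat \<Rightarrow> nat) \<Rightarrow> (nat \<Rightarrow> nat \<Rightarrow> real vec) \<Rightarrow>
   real vec \<Rightarrow> nat \<Rightarrow> real vec" where
  "state A E \<sigma> w x0 0 = x0"
| "state A E \<sigma> w x0 (Suc t) = A (\<sigma> t) *\<^sub>v state A E \<sigma> w x0 t + E (\<sigma> t) *\<^sub>v w (\<sigma> t) t"

definition controlled_output ::
  "(nat \<Rightarrow> real mat) \<Rightarrow> (nat \<Rightarrow> real mat) \<Rightarrow> (nat \<Rightarrow> real vec) \<Rightarrow> (nat \<Rightarrow> nat \<Rightarrow> real vec) \<Rightarrow>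
   nat \<Rightarrow> nat \<Rightarrow> real vec" where
  "controlled_output C F x w i t = C i *\<^sub>v x t + F i *\<^sub>v w i t"

definition norm2 :: "real vec \<Rightarrow> real" where
  "norm2 v = sqrt (v \<bullet> v)"

text \<open>Lyapunov stability and global attractivity of the origin; \<open>\<Phi> x0\<close> is the trajectory
  starting in \<open>x0\<close> at time \<open>0\<close>.\<close>

definition asymptotically_stable :: "nat \<Rightarrow> (real vec \<Rightarrow> nat \<Rightarrow> real vec) \<Rightarrow> bool" where
  "asymptotically_stable n \<Phi> \<longleftrightarrow>
     (\<forall>\<epsilon>>0. \<exists>\<delta>>0. \<forall>x0\<in>carrier_vec n. norm2 x0 < \<delta> \<longrightarrow> (\<forall>t. norm2 (\<Phi> x0 t) < \<epsilon>)) \<and>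
     (\<forall>x0\<in>carrier_vec n. (\<lambda>t. norm2 (\<Phi> x0 t)) \<longlonglongrightarrow> 0)"

text \<open>The sums are taken in \<open>[0,\<infinity>]\<close>, so the inequality is void for inputs of infinite energy.\<close>

definition l2_gain_bound ::
  "nat \<Rightarrow> nat \<Rightarrow> nat \<Rightarrow> (nat \<Rightarrow> nat) \<Rightarrow> (nat \<Rightarrow> real mat) \<Rightarrow> (nat \<Rightarrow> real mat) \<Rightarrow>
   (nat \<Rightarrow> real mat) \<Rightarrow> (nat \<Rightarrow> real mat) \<Rightarrow> real \<Rightarrow> bool" where
  "l2_gain_bound N \<tau> n p A E C F \<gamma> \<longleftrightarrow>
     (\<forall>\<phi> \<sigma> w. switching_signal N \<tau> \<phi> \<sigma> \<longrightarrow> (\<forall>i\<in>{1..N}. \<forall>t. w i t \<in> carrier_vec (p i)) \<longrightarrow>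
        (let z = controlled_output C F (state A E \<sigma> w (0\<^sub>v n)) w in
         (\<Sum>s. \<Sum>k<\<phi> (Suc s) - \<phi> s. ennreal ((norm2 (z (\<sigma> (\<phi> s)) (\<phi> s + k)))\<^sup>2))
         \<le> ennreal (\<gamma>\<^sup>2) *
            (\<Sum>s. \<Sum>k<\<phi> (Suc s) - \<phi> s. ennreal ((norm2 (w (\<sigma> (\<phi> s)) (\<phi> s + k)))\<^sup>2))))"

text \<open>
  The infimum is attained whenever it is positive and finite. It is \<open>0\<close> when every \<open>\<gamma> > 0\<close> is a
  bound (for instance when \<open>z\<close> vanishes identically), and \<open>\<infinity>\<close> when there is no bound.
\<close>

definition l2_gain ::
  "nat \<Rightarrow> nat \<Rightarrow> nat \<Rightarrow> (nat \<Rightarrow> nat) \<Rightarrow> (nat \<Rightarrow> real mat) \<Rightarrow> (nat \<Rightarrow> real mat) \<Rightarrow>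
   (nat \<Rightarrow> real mat) \<Rightarrow> (nat \<Rightarrow> real mat) \<Rightarrow> ereal" where
  "l2_gain N \<tau> n p A E C F = Inf (ereal ` {\<gamma>. 0 < \<gamma> \<and> l2_gain_bound N \<tau> n p A E C F \<gamma>})"

end

theory Submission
  imports Defs "Jordan_Normal_Form.Determinant"
begin

text \<open>
  All three conditions are statements about quadratic storage functions \<open>V\<^sub>P x = x \<bullet> P x\<close>, and they
  are equivalent for every single \<open>\<gamma>\<close>. For one mode, the primal inequality with \<open>R1\<close>, \<open>R2\<close> says that
  one step of the system dissipates: \<open>V\<^sub>R\<^sub>1 (A x + E w) + |z|\<^sup>2 - \<gamma>\<^sup>2 |w|\<^sup>2 \<le> V\<^sub>R\<^sub>2 x\<close>
  (\<open>primal_lmi_le_iff\<close>). The lifted inequality says the same of \<open>\<tau>\<close> consecutive steps of mode \<open>i\<close>,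
  starting with the storage \<open>V\<close> of another mode \<open>j\<close> (\<open>lifted_lmi_less_iff\<close>). The dual inequality, after
  maximisation over its middle variable, is dissipation of the adjoint system, which runs backwards
  in time (\<open>dual_lmi_le_iff\<close>).

  From the primal to the lifted condition one takes \<open>P\<^sub>i = R\<^sub>i(\<tau>)\<close> and adds up the \<open>\<tau>\<close> one-step
  inequalities; the gap between \<open>R\<^sub>i(0)\<close> and \<open>R\<^sub>j(\<tau>)\<close> makes the sum strict when the initial state is
  nonzero. When it is zero, strictness comes from the strict one-step inequality of \<open>P\<^sub>i\<close> alone,
  used \<open>\<tau>\<close> times (\<open>lifted_lmi_lessI\<close>).

  Conversely, \<open>R\<^sub>i(k)\<close> is computed backwards from \<open>R\<^sub>i(\<tau>) = P\<^sub>i\<close> by a Riccati recursion: each step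
  maximises over the input by completing a square, so that \<open>V\<close> of \<open>R\<^sub>i(0)\<close> is, up to the reward
  introduced next, the largest value that \<open>V\<close> of \<open>P\<^sub>i\<close> at time \<open>\<tau>\<close> plus the sum of
  \<open>|z|\<^sup>2 - \<gamma>\<^sup>2 |w|\<^sup>2\<close> can reach. The lifted inequality bounds it by \<open>V\<close> of \<open>P\<^sub>j\<close>. The recursion never
  breaks down because \<open>R\<^sub>i(k) \<le> P\<^sub>i\<close> propagates. A small running reward \<open>\<delta> |x|\<^sup>2\<close>, paid for by the
  margin in the strict inequalities, keeps every \<open>R\<^sub>i(k)\<close> positive definite, and what is left of the
  margin is the gap (\<open>riccati_chain\<close>, \<open>positive_primal_of_lifted\<close>).

  The dual condition corresponds to \<open>S\<^sub>i(k) = R\<^sub>i(k)\<^sup>-\<^sup>1\<close>. The passage in both directions rests on the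
  pairing \<open>\<xi> \<bullet> x\<^sup>+ + \<zeta> \<bullet> z = \<xi>\<^sup>- \<bullet> x + \<omega> \<bullet> w\<close> between the system and its adjoint and on the inequality
  \<open>2 (x \<bullet> y) \<le> x \<bullet> M x + y \<bullet> M\<^sup>-\<^sup>1 y\<close> (\<open>inner_le_quad_inverse\<close>). In the dual condition the intermediate
  matrices \<open>S\<^sub>i(k)\<close> need not be invertible; therefore the way back goes directly to the lifted
  condition, pairing a trajectory of length \<open>\<tau>\<close> with an adjoint one (\<open>dual_chain_less\<close>), and inverts
  only \<open>S\<^sub>i(\<tau>)\<close>.

  For stability and performance, strictness gives a common margin \<open>c > 0\<close> for all modes
  (\<open>uniform_margin\<close>). A dwell interval of length at least \<open>\<tau>\<close> is covered by one lifted inequality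
  followed by one-step inequalities, so over any number of intervals the sum of
  \<open>|z|\<^sup>2 - \<gamma>\<^sup>2 |w|\<^sup>2 + c (|x|\<^sup>2 + |w|\<^sup>2)\<close> is bounded by the initial storage (\<open>switched_dissipation\<close>). With
  \<open>w = 0\<close> the squared norms of the states are summable, with a sum bounded by a multiple of
  \<open>|x\<^sub>0|\<^sup>2\<close>; with \<open>x\<^sub>0 = 0\<close> the gain is at most \<open>sqrt (\<gamma>\<^sup>2 - d) < \<gamma>\<close> for some \<open>d > 0\<close>.
\<close>

section \<open>Quadratic forms\<close>

lemma smult_mult_mat_vec:
  "\<lbrakk>M \<in> carrier_mat m d; v \<in> carrier_vec d\<rbrakk> \<Longrightarrow> (c \<cdot>\<^sub>m M) *\<^sub>v v = c \<cdot>\<^sub>v (M *\<^sub>v (v :: real vec))"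
  by (intro eq_vecI) auto

lemma zero_mult_mat_vec:
  "v \<in> carrier_vec d \<Longrightarrow> 0\<^sub>m m d *\<^sub>v (v :: real vec) = 0\<^sub>v m"
  by (intro eq_vecI) auto

lemma mult_mat_vec_zero:
  "M \<in> carrier_mat m d \<Longrightarrow> M *\<^sub>v 0\<^sub>v d = (0\<^sub>v m :: real vec)"
  by (intro eq_vecI) auto

definition quad :: "real mat \<Rightarrow> real vec \<Rightarrow> real" where
  "quad M v = v \<bullet> (M *\<^sub>v v)"

lemma quad_add:
  "\<lbrakk>M \<in> carrier_mat d d; N \<in> carrier_mat d d; v \<in> carrier_vec d\<rbrakk> \<Longrightarrow> quad (M + N) v = quad M v + quad N v"
  unfolding quad_def by (simp add: add_mult_distrib_mat_vec[of _ d d] scalar_prod_add_distrib[of _ d])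

lemma quad_uminus:
  "\<lbrakk>M \<in> carrier_mat d d; v \<in> carrier_vec d\<rbrakk> \<Longrightarrow> quad (- M) v = - quad M v"
  unfolding quad_def by (auto simp: uminus_mult_mat_vec)

lemma quad_minus:
  assumes "M \<in> carrier_mat d d" "N \<in> carrier_mat d d" "v \<in> carrier_vec d"
  shows "quad (M - N) v = quad M v - quad N v"
  using quad_add[of M d "- N" v] quad_uminus[of N d v] assms by (simp add: add_uminus_minus_mat)

lemma quad_smult:
  "\<lbrakk>M \<in> carrier_mat d d; v \<in> carrier_vec d\<rbrakk> \<Longrightarrow> quad (c \<cdot>\<^sub>m M) v = c * quad M v"
  unfolding quad_def by (auto simp: smult_mult_mat_vec)

lemma quad_one: "v \<in> carrier_vec d \<Longrightarrow> quad (1\<^sub>m d) v = v \<bullet> v"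
  unfolding quad_def by simp

lemma quad_zero: "v \<in> carrier_vec d \<Longrightarrow> quad (0\<^sub>m d d) v = 0"
  unfolding quad_def by (simp add: zero_mult_mat_vec)

lemma quad_zero_vec: "M \<in> carrier_mat d d \<Longrightarrow> quad M (0\<^sub>v d) = 0"
  unfolding quad_def by (simp add: scalar_prod_def)

lemma quad_scale:
  "\<lbrakk>R \<in> carrier_mat d d; x \<in> carrier_vec d\<rbrakk> \<Longrightarrow> quad R (c \<cdot>\<^sub>v x) = c\<^sup>2 * quad R x"
  unfolding quad_def by (simp add: mult_mat_vec[of _ d d] power2_eq_square)

text \<open>
  The blocks of all the matrix inequalities are congruences \<open>M\<^sup>T R L\<close> and Gram products; this turns their
  forms into forms in the images \<open>M v\<close>, \<open>L u\<close>.
\<close>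

lemma bilinear_congruence:
  fixes M R L :: "real mat"
  assumes "M \<in> carrier_mat m d" "R \<in> carrier_mat m m" "L \<in> carrier_mat m e"
    "v \<in> carrier_vec d" "u \<in> carrier_vec e"
  shows "v \<bullet> ((transpose_mat M * R * L) *\<^sub>v u) = (M *\<^sub>v v) \<bullet> (R *\<^sub>v (L *\<^sub>v u))"
proof -
  have "(transpose_mat M * R * L) *\<^sub>v u = transpose_mat M *\<^sub>v (R *\<^sub>v (L *\<^sub>v u))"
    using assms by (simp add: assoc_mult_mat_vec[of _ d m _ e] assoc_mult_mat_vec[of _ m m _ e])
  then show ?thesis
    using transpose_vec_mult_scalar[of "transpose_mat M" d m "R *\<^sub>v (L *\<^sub>v u)" v] assms by simp
qed

lemma bilinear_gram:
  fixes M L :: "real mat"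
  assumes "M \<in> carrier_mat m d" "L \<in> carrier_mat m e" "v \<in> carrier_vec d" "u \<in> carrier_vec e"
  shows "v \<bullet> ((transpose_mat M * L) *\<^sub>v u) = (M *\<^sub>v v) \<bullet> (L *\<^sub>v u)"
  using bilinear_congruence[of M m d "1\<^sub>m m" L e v u] assms by simp

lemma sqnorm_plus:
  assumes "x \<in> carrier_vec d" "y \<in> carrier_vec d"
  shows "(x + y) \<bullet> (x + y) = x \<bullet> x + 2 * (x \<bullet> y) + y \<bullet> (y::real vec)"
  using assms comm_scalar_prod[of x d y]
  by (simp add: scalar_prod_add_distrib[of _ d] add_scalar_prod_distrib[of _ d])

lemma sqnorm_ge_0: "0 \<le> v \<bullet> (v::real vec)"
  unfolding scalar_prod_def by (simp add: sum_nonneg)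

lemma sqnorm_pos:
  assumes "v \<in> carrier_vec d" "v \<noteq> 0\<^sub>v d" shows "0 < v \<bullet> (v::real vec)"
proof -
  obtain i where "i < d" "v $ i \<noteq> 0" using assms by (auto simp: vec_eq_iff)
  then have "0 < v $ i * v $ i" by (auto simp: zero_less_mult_iff)
  moreover have "v $ i * v $ i \<le> v \<bullet> v"
    unfolding scalar_prod_def using assms \<open>i < d\<close> by (intro member_le_sum) auto
  ultimately show ?thesis by linarith
qed

text \<open>
  The concave function of \<open>\<omega>\<close> on the left has its maximum at \<open>y / \<gamma>\<^sup>2\<close>. It serves to eliminate the middle
  variable of the dual inequality and, read as a bound on \<open>\<omega> \<bullet> y\<close>, as Young's inequality for inputs.
\<close>

lemma inner_max:
  fixes \<gamma> :: real
  assumes "\<gamma> > 0" and \<omega>: "\<omega> \<in> carrier_vec m" and y: "y \<in> carrier_vec m"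
  shows "2 * (\<omega> \<bullet> y) - \<gamma>\<^sup>2 * (\<omega> \<bullet> \<omega>) \<le> (y \<bullet> y) / \<gamma>\<^sup>2"
proof -
  have "0 \<le> (\<gamma> \<cdot>\<^sub>v \<omega> + (- (1 / \<gamma>)) \<cdot>\<^sub>v y) \<bullet> (\<gamma> \<cdot>\<^sub>v \<omega> + (- (1 / \<gamma>)) \<cdot>\<^sub>v y)" by (rule sqnorm_ge_0)
  also have "\<dots> = \<gamma>\<^sup>2 * (\<omega> \<bullet> \<omega>) - 2 * (\<omega> \<bullet> y) + (y \<bullet> y) / \<gamma>\<^sup>2"
    using assms by (subst sqnorm_plus[of _ m]) (auto simp: power2_eq_square)
  finally show ?thesis by simp
qed

lemma inner_max_attained:
  fixes \<gamma> :: real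
  assumes "\<gamma> > 0" and y: "y \<in> carrier_vec m" and \<omega>: "\<omega> = (1 / \<gamma>\<^sup>2) \<cdot>\<^sub>v y"
  shows "2 * (\<omega> \<bullet> y) - \<gamma>\<^sup>2 * (\<omega> \<bullet> \<omega>) = (y \<bullet> y) / \<gamma>\<^sup>2"
  using assms by (simp add: field_simps power2_eq_square)

lemma sqnorm_plus_le:
  fixes x y :: "real vec"
  assumes "x \<in> carrier_vec d" "y \<in> carrier_vec d"
  shows "(x + y) \<bullet> (x + y) \<le> 2 * (x \<bullet> x) + 2 * (y \<bullet> y)"
  using inner_max[of 1 x d y] assms by (simp add: sqnorm_plus[OF assms])

section \<open>Symmetric block matrices and the Loewner order\<close>

lemma symmetric_carrier: "R \<in> symmetric_mats d \<Longrightarrow> R \<in> carrier_mat d d"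
  by (simp add: symmetric_mats_def)

lemma symmetric_swap:
  assumes "R \<in> symmetric_mats d" "x \<in> carrier_vec d" "y \<in> carrier_vec d"
  shows "x \<bullet> (R *\<^sub>v y) = y \<bullet> (R *\<^sub>v x)"
  using assms transpose_vec_mult_scalar[of R d d y x] comm_scalar_prod[of y d "R *\<^sub>v x"]
    comm_scalar_prod[of "R *\<^sub>v x" d y]
  unfolding symmetric_mats_def by auto

lemma quad_plus:
  assumes "R \<in> symmetric_mats d" "x \<in> carrier_vec d" "y \<in> carrier_vec d"
  shows "quad R (x + y) = quad R x + 2 * (x \<bullet> (R *\<^sub>v y)) + quad R y"
proof -
  have R: "R \<in> carrier_mat d d" using assms by (simp add: symmetric_mats_def)
  show ?thesis
    unfolding quad_def using R assms symmetric_swap[OF assms(1,3,2)]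
    by (simp add: mult_add_distrib_mat_vec[of _ d d] scalar_prod_add_distrib[of _ d]
        add_scalar_prod_distrib[of _ d])
qed

lemma quad_sym_block2:
  assumes "M11 \<in> carrier_mat d d" "M12 \<in> carrier_mat d e" "M22 \<in> carrier_mat e e"
    and "x \<in> carrier_vec d" "w \<in> carrier_vec e"
  shows "quad (sym_block2 M11 M12 M22) (x @\<^sub>v w) = quad M11 x + 2 * (x \<bullet> (M12 *\<^sub>v w)) + quad M22 w"
proof -
  have "w \<bullet> (transpose_mat M12 *\<^sub>v x) = x \<bullet> (M12 *\<^sub>v w)"
    using assms transpose_vec_mult_scalar[of M12 d e w x] comm_scalar_prod[of w e "transpose_mat M12 *\<^sub>v x"]
    by auto
  then show ?thesis
    unfolding quad_def sym_block2_def using assms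
    by (simp add: four_block_mat_mult_vec[of _ d d _ e _ e] scalar_prod_append[of _ d _ e]
        scalar_prod_add_distrib[of _ d] scalar_prod_add_distrib[of _ e])
qed

lemma append_vec_eq_zero_iff:
  assumes "x \<in> carrier_vec n" "w \<in> carrier_vec m"
  shows "x @\<^sub>v w = 0\<^sub>v (n + m) \<longleftrightarrow> x = 0\<^sub>v n \<and> w = 0\<^sub>v m"
proof -
  have "0\<^sub>v (n + m) = 0\<^sub>v n @\<^sub>v (0\<^sub>v m :: 'a :: zero vec)" by (intro eq_vecI) auto
  then show ?thesis using append_vec_eq[OF assms(1) zero_carrier_vec] by metis
qed

lemma symmetric_sym_block2:
  assumes "M11 \<in> symmetric_mats d" "M12 \<in> carrier_mat d e" "M22 \<in> symmetric_mats e"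
  shows "sym_block2 M11 M12 M22 \<in> symmetric_mats (d + e)"
  using assms unfolding symmetric_mats_def sym_block2_def
  by (auto simp: transpose_four_block_mat[of _ d d _ e _ e])

lemma symmetric_add: "\<lbrakk>M \<in> symmetric_mats d; N \<in> symmetric_mats d\<rbrakk> \<Longrightarrow> M + N \<in> symmetric_mats d"
  by (auto simp: symmetric_mats_def transpose_add[of _ d d])

lemma transpose_smult_real: "transpose_mat (c \<cdot>\<^sub>m M) = c \<cdot>\<^sub>m transpose_mat (M :: real mat)"
  by (intro eq_matI) auto

lemma symmetric_uminus: "M \<in> symmetric_mats d \<Longrightarrow> - M \<in> symmetric_mats d"
  by (auto simp: symmetric_mats_def transpose_uminus)

lemma symmetric_minus: "\<lbrakk>M \<in> symmetric_mats d; N \<in> symmetric_mats d\<rbrakk> \<Longrightarrow> M - N \<in> symmetric_mats d"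
  by (auto simp: symmetric_mats_def transpose_minus[of _ d d])

lemma symmetric_smult: "M \<in> symmetric_mats d \<Longrightarrow> c \<cdot>\<^sub>m M \<in> symmetric_mats d"
  by (auto simp: symmetric_mats_def transpose_smult_real)

lemma symmetric_one: "1\<^sub>m d \<in> symmetric_mats d"
  by (auto simp: symmetric_mats_def)

lemma symmetric_zero: "0\<^sub>m d d \<in> symmetric_mats d"
  by (auto simp: symmetric_mats_def)

lemma symmetric_congruence:
  assumes "R \<in> symmetric_mats m" "M \<in> carrier_mat m d"
  shows "transpose_mat M * R * M \<in> symmetric_mats d"
proof -
  have R: "R \<in> carrier_mat m m" "transpose_mat R = R" using assms by (auto simp: symmetric_mats_def)
  have MR: "transpose_mat M * R \<in> carrier_mat d m" using assms R by auto
  have "transpose_mat (transpose_mat M * R * M) = transpose_mat M * (R * M)"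
    unfolding transpose_mult[OF MR assms(2)] using assms R
    by (subst transpose_mult[of "transpose_mat M" d m R m]) auto
  then show ?thesis using assms R
    by (auto simp: symmetric_mats_def assoc_mult_mat[of _ d m _ m _ d])
qed

lemma symmetric_gram:
  assumes "M \<in> carrier_mat m d"
  shows "transpose_mat M * M \<in> symmetric_mats d"
  using symmetric_congruence[OF symmetric_one assms] assms by simp

lemmas symmetric_intros = symmetric_add symmetric_uminus symmetric_minus symmetric_smult symmetric_one
  symmetric_zero symmetric_congruence symmetric_gram symmetric_sym_block2

lemma loewner_less_zero_iff:
  assumes "M \<in> symmetric_mats d"
  shows "M \<prec>\<^bsub>d\<^esub> 0\<^sub>m d d \<longleftrightarrow> (\<forall>v\<in>carrier_vec d. v \<noteq> 0\<^sub>v d \<longrightarrow> quad M v < 0)"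
proof -
  have M: "M \<in> carrier_mat d d" using assms by (rule symmetric_carrier)
  then show ?thesis
    unfolding loewner_less_def pos_def_def quad_def[symmetric]
    using assms quad_minus[of "0\<^sub>m d d" d M] quad_zero[of _ d]
    by (auto intro!: symmetric_intros)
qed

lemma loewner_le_zero_iff:
  assumes "M \<in> symmetric_mats d"
  shows "M \<preceq>\<^bsub>d\<^esub> 0\<^sub>m d d \<longleftrightarrow> (\<forall>v\<in>carrier_vec d. quad M v \<le> 0)"
proof -
  have M: "M \<in> carrier_mat d d" using assms by (rule symmetric_carrier)
  then show ?thesis
    unfolding loewner_le_def pos_semidef_def quad_def[symmetric]
    using assms quad_minus[of "0\<^sub>m d d" d M] quad_zero[of _ d]
    by (auto intro!: symmetric_intros)
qed

lemma loewner_gap_iff: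
  assumes "X \<in> symmetric_mats d" "Y \<in> symmetric_mats d"
  shows "X - Y + \<epsilon> \<cdot>\<^sub>m 1\<^sub>m d \<preceq>\<^bsub>d\<^esub> 0\<^sub>m d d \<longleftrightarrow> (\<forall>v\<in>carrier_vec d. quad X v + \<epsilon> * (v \<bullet> v) \<le> quad Y v)"
proof -
  have s: "X - Y + \<epsilon> \<cdot>\<^sub>m 1\<^sub>m d \<in> symmetric_mats d"
    by (intro symmetric_add symmetric_minus symmetric_smult symmetric_one assms)
  have "quad (X - Y + \<epsilon> \<cdot>\<^sub>m 1\<^sub>m d) v = quad X v - quad Y v + \<epsilon> * (v \<bullet> v)" if "v \<in> carrier_vec d" for v
    using that assms[THEN symmetric_carrier]
    by (simp add: quad_add[of _ d] quad_minus[of _ d] quad_smult[of _ d] quad_one minus_carrier_mat)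
  then show ?thesis unfolding loewner_le_zero_iff[OF s] by force
qed

section \<open>Positive definite matrices\<close>

lemma pos_def_symmetric: "pos_def d M \<Longrightarrow> M \<in> symmetric_mats d"
  by (simp add: pos_def_def)

lemma pos_def_carrier: "pos_def d M \<Longrightarrow> M \<in> carrier_mat d d"
  by (simp add: pos_def_def symmetric_mats_def)

lemma pos_defI:
  "\<lbrakk>M \<in> symmetric_mats d; \<And>v. \<lbrakk>v \<in> carrier_vec d; v \<noteq> 0\<^sub>v d\<rbrakk> \<Longrightarrow> 0 < quad M v\<rbrakk> \<Longrightarrow> pos_def d M"
  by (simp add: pos_def_def quad_def)

lemma pos_def_quad_pos: "\<lbrakk>pos_def d M; v \<in> carrier_vec d; v \<noteq> 0\<^sub>v d\<rbrakk> \<Longrightarrow> 0 < quad M v"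
  by (simp add: pos_def_def quad_def)

lemma pos_def_quad_nonneg: "\<lbrakk>pos_def d M; v \<in> carrier_vec d\<rbrakk> \<Longrightarrow> 0 \<le> quad M v"
  using pos_def_quad_pos[of d M v] quad_zero_vec[OF pos_def_carrier, of d M] by fastforce

text \<open>
  A positive definite matrix has trivial kernel, hence an inverse; the form of the inverse at \<open>v\<close> is the
  form of the matrix at the preimage of \<open>v\<close>.
\<close>

lemma pos_def_inverse:
  assumes "pos_def d M"
  obtains W where "pos_def d W" "M * W = 1\<^sub>m d"
proof -
  have M: "M \<in> carrier_mat d d" and sM: "transpose_mat M = M"
    using assms by (auto simp: pos_def_def symmetric_mats_def)
  have "det M \<noteq> 0"
    unfolding det_0_iff_vec_prod_zero[OF M] using assms by (force simp: pos_def_def)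
  from det_non_zero_imp_unit[OF M this, of "()"]
  obtain W where W: "W \<in> carrier_mat d d" "M * W = 1\<^sub>m d" "W * M = 1\<^sub>m d"
    unfolding Units_def ring_mat_def by auto
  have "transpose_mat W = transpose_mat W * (M * W)" using W by simp
  also have "\<dots> = transpose_mat (M * W) * W"
    unfolding transpose_mult[OF M W(1)] sM using W(1) M
    by (intro assoc_mult_mat[symmetric]) auto
  also have "\<dots> = W" using W by simp
  finally have sW: "W \<in> symmetric_mats d" using W by (simp add: symmetric_mats_def)
  moreover have "0 < v \<bullet> (W *\<^sub>v v)" if v: "v \<in> carrier_vec d" "v \<noteq> 0\<^sub>v d" for v
  proof -
    have eq: "M *\<^sub>v (W *\<^sub>v v) = v"
      using v W M by (simp flip: assoc_mult_mat_vec[of _ d d _ d])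
    then have "W *\<^sub>v v \<noteq> 0\<^sub>v d" using v M mult_mat_vec_zero[OF M] by auto
    then have "0 < (W *\<^sub>v v) \<bullet> (M *\<^sub>v (W *\<^sub>v v))"
      using assms W v by (simp add: pos_def_def)
    then show ?thesis unfolding eq using W v by (simp add: comm_scalar_prod[of v d])
  qed
  ultimately show thesis using that W by (auto simp: pos_def_def)
qed

definition pd_inverse :: "nat \<Rightarrow> real mat \<Rightarrow> real mat" where
  "pd_inverse d M = (SOME W. pos_def d W \<and> M * W = 1\<^sub>m d)"

lemma pd_inverse:
  assumes "pos_def d M"
  shows "pos_def d (pd_inverse d M)" "M * pd_inverse d M = 1\<^sub>m d"
proof -
  obtain W where "pos_def d W \<and> M * W = 1\<^sub>m d"
    by (rule pos_def_inverse[OF assms]) (rule that, intro conjI)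
  then have *: "pos_def d (pd_inverse d M) \<and> M * pd_inverse d M = 1\<^sub>m d"
    unfolding pd_inverse_def by (rule someI)
  from * show "pos_def d (pd_inverse d M)" by (rule conjunct1)
  from * show "M * pd_inverse d M = 1\<^sub>m d" by (rule conjunct2)
qed

lemma quad_inverse_image:
  assumes "M \<in> carrier_mat d d" "W \<in> carrier_mat d d" "M * W = 1\<^sub>m d" "y \<in> carrier_vec d"
  shows "quad M (W *\<^sub>v y) = quad W y"
proof -
  have eq: "M *\<^sub>v (W *\<^sub>v y) = y"
    using assms by (simp flip: assoc_mult_mat_vec[of _ d d _ d])
  show "quad M (W *\<^sub>v y) = quad W y"
    unfolding quad_def eq using assms by (simp add: comm_scalar_prod[of y d])
qed

text \<open>
  The Fenchel--Young inequality for the conjugate forms of \<open>M\<close> and \<open>W = M\<^sup>-\<^sup>1\<close>: expand the form of \<open>M\<close> at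
  \<open>x - W y\<close>, which is nonnegative. It replaces Schur complements in every duality argument below.
\<close>

lemma inner_le_quad_inverse:
  assumes "pos_def d M" "W \<in> symmetric_mats d" "M * W = 1\<^sub>m d"
    "x \<in> carrier_vec d" "y \<in> carrier_vec d"
  shows "2 * (x \<bullet> y) \<le> quad M x + quad W y"
proof -
  have M: "M \<in> carrier_mat d d" "M \<in> symmetric_mats d" using assms pos_def_carrier pos_def_symmetric by auto
  have W: "W \<in> carrier_mat d d" using assms symmetric_carrier by auto
  let ?u = "(-1) \<cdot>\<^sub>v (W *\<^sub>v y)"
  have u: "?u \<in> carrier_vec d" using W assms by auto
  have eq: "M *\<^sub>v (W *\<^sub>v y) = y"
    using assms M W by (simp flip: assoc_mult_mat_vec[of _ d d _ d])
  have "0 \<le> quad M (x + ?u)" using assms u by (intro pos_def_quad_nonneg) auto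
  also have "\<dots> = quad M x + 2 * (x \<bullet> (M *\<^sub>v ?u)) + quad M ?u"
    using assms u M by (intro quad_plus) auto
  also have "M *\<^sub>v ?u = (-1) \<cdot>\<^sub>v y"
    using W assms M eq by (subst mult_mat_vec[of _ d d]) auto
  also have "quad M ?u = quad M (W *\<^sub>v y)"
    using W assms M by (subst quad_scale[of _ d]) auto
  also have "\<dots> = quad W y"
    unfolding quad_def eq using W assms by (simp add: comm_scalar_prod[of y d])
  finally show ?thesis using assms by simp
qed

text \<open>
  Apply the Fenchel--Young inequality for \<open>X\<close> at the point \<open>Y\<^sup>-\<^sup>1 v\<close>, where the one for \<open>Y\<close> is an equality.
\<close>

lemma pos_def_inverse_antitone:
  assumes X: "pos_def d X" and Y: "pos_def d Y"
    and X': "X' \<in> symmetric_mats d" "X * X' = 1\<^sub>m d" and Y': "Y' \<in> symmetric_mats d" "Y * Y' = 1\<^sub>m d"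
    and less: "\<And>v. \<lbrakk>v \<in> carrier_vec d; v \<noteq> 0\<^sub>v d\<rbrakk> \<Longrightarrow> quad X v < quad Y v"
    and v: "v \<in> carrier_vec d" "v \<noteq> 0\<^sub>v d"
  shows "quad Y' v < quad X' v"
proof -
  define u where "u = Y' *\<^sub>v v"
  note c = X'(1)[THEN symmetric_carrier] Y'(1)[THEN symmetric_carrier]
  have u: "u \<in> carrier_vec d" using c v by (simp add: u_def)
  have "u \<noteq> 0\<^sub>v d"
  proof
    assume "u = 0\<^sub>v d"
    then have "Y *\<^sub>v (Y' *\<^sub>v v) = 0\<^sub>v d" using mult_mat_vec_zero[OF pos_def_carrier[OF Y]] by (simp add: u_def)
    then show False
      using v Y'(2) assoc_mult_mat_vec[OF pos_def_carrier[OF Y] c(2) v(1)] by simp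
  qed
  have "2 * (u \<bullet> v) \<le> quad X u + quad X' v" by (rule inner_le_quad_inverse[OF X X' u v(1)])
  moreover have "u \<bullet> v = quad Y' v"
    unfolding u_def quad_def using c v by (intro comm_scalar_prod[of _ d]) auto
  moreover have "quad Y u = quad Y' v"
    unfolding u_def by (rule quad_inverse_image[OF pos_def_carrier[OF Y] c(2) Y'(2) v(1)])
  ultimately show ?thesis using less[OF u \<open>u \<noteq> 0\<^sub>v d\<close>] by linarith
qed

lemma quad_bounded:
  assumes "M \<in> carrier_mat d d"
  shows "\<exists>K>0. \<forall>v\<in>carrier_vec d. quad M v \<le> K * (v \<bullet> v)"
proof (intro exI conjI ballI)
  let ?K = "(\<Sum>i<d. \<Sum>j<d. \<bar>M $$ (i, j)\<bar>) + 1"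
  have K0: "0 \<le> (\<Sum>i<d. \<Sum>j<d. \<bar>M $$ (i, j)\<bar>)" by (intro sum_nonneg) auto
  then show "0 < ?K" by linarith
  fix v :: "real vec" assume v: "v \<in> carrier_vec d"
  have coord: "\<bar>v $ i * v $ j\<bar> \<le> v \<bullet> v" if "i < d" "j < d" for i j
  proof -
    have le: "(v $ k)\<^sup>2 \<le> v \<bullet> v" if "k < d" for k
      unfolding scalar_prod_def using v that
      by (auto simp: power2_eq_square intro!: member_le_sum[of k "{0..<d}" "\<lambda>i. v $ i * v $ i"])
    have "\<bar>v $ i * v $ j\<bar> \<le> ((v $ i)\<^sup>2 + (v $ j)\<^sup>2) / 2"
      using sum_squares_bound[of "\<bar>v $ i\<bar>" "\<bar>v $ j\<bar>"] by (simp add: abs_mult)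
    also have "\<dots> \<le> v \<bullet> v" using le[OF that(1)] le[OF that(2)] by simp
    finally show ?thesis .
  qed
  have "quad M v = (\<Sum>i<d. \<Sum>j<d. M $$ (i, j) * (v $ i * v $ j))"
    using assms v unfolding quad_def scalar_prod_def
    by (auto simp: atLeast0LessThan sum_distrib_left scalar_prod_def algebra_simps intro!: sum.cong)
  also have "\<dots> \<le> (\<Sum>i<d. \<Sum>j<d. \<bar>M $$ (i, j)\<bar> * (v \<bullet> v))"
  proof (intro sum_mono)
    fix i j assume "i \<in> {..<d}" "j \<in> {..<d}"
    then have "\<bar>M $$ (i, j)\<bar> * \<bar>v $ i * v $ j\<bar> \<le> \<bar>M $$ (i, j)\<bar> * (v \<bullet> v)"
      by (intro mult_left_mono coord) auto
    then show "M $$ (i, j) * (v $ i * v $ j) \<le> \<bar>M $$ (i, j)\<bar> * (v \<bullet> v)"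
      by (metis abs_ge_self abs_mult order_trans)
  qed
  also have "\<dots> \<le> ?K * (v \<bullet> v)"
    using sqnorm_ge_0[of v] by (simp add: sum_distrib_right distrib_right)
  finally show "quad M v \<le> ?K * (v \<bullet> v)" .
qed

lemma sqnorm_mult_bounded:
  fixes M :: "real mat"
  assumes "M \<in> carrier_mat m d"
  shows "\<exists>K>0. \<forall>v\<in>carrier_vec d. (M *\<^sub>v v) \<bullet> (M *\<^sub>v v) \<le> K * (v \<bullet> v)"
proof -
  have "transpose_mat M * M \<in> carrier_mat d d" using symmetric_gram[OF assms] by (rule symmetric_carrier)
  from quad_bounded[OF this] show ?thesis
    using bilinear_gram[OF assms assms] by (simp add: quad_def)
qed

text \<open>
  An algebraic substitute for compactness of the unit sphere: with \<open>K\<close> a bound for the form of the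
  inverse, the Fenchel--Young inequality at \<open>v\<close> and \<open>v / K\<close> leaves the margin \<open>1 / K\<close>.
\<close>

lemma pos_def_margin:
  assumes "pos_def d M"
  shows "\<exists>c>0. \<forall>v\<in>carrier_vec d. c * (v \<bullet> v) \<le> quad M v"
proof -
  obtain W where W: "pos_def d W" "M * W = 1\<^sub>m d" using pos_def_inverse[OF assms] by metis
  obtain K where K: "K > 0" "\<And>v. v \<in> carrier_vec d \<Longrightarrow> quad W v \<le> K * (v \<bullet> v)"
    using quad_bounded[OF pos_def_carrier[OF W(1)]] by auto
  show ?thesis
  proof (intro exI[of _ "1 / K"] conjI ballI)
    show "0 < 1 / K" using K by simp
    fix v :: "real vec" assume v: "v \<in> carrier_vec d"
    have "2 * (v \<bullet> ((1 / K) \<cdot>\<^sub>v v)) \<le> quad M v + quad W ((1 / K) \<cdot>\<^sub>v v)"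
      using v by (intro inner_le_quad_inverse[OF assms pos_def_symmetric[OF W(1)] W(2)]) auto
    moreover have "quad W ((1 / K) \<cdot>\<^sub>v v) = (1 / K)\<^sup>2 * quad W v"
      using quad_scale[OF pos_def_carrier[OF W(1)] v] .
    moreover have "(1 / K)\<^sup>2 * quad W v \<le> (1 / K)\<^sup>2 * (K * (v \<bullet> v))"
      using K v by (intro mult_left_mono) auto
    moreover have "(1 / K)\<^sup>2 * (K * (v \<bullet> v)) = (1 / K) * (v \<bullet> v)"
      using K by (simp add: power2_eq_square)
    ultimately show "1 / K * (v \<bullet> v) \<le> quad M v" using v by simp
  qed
qed

lemma neg_def_margin:
  assumes "M \<in> symmetric_mats d" "\<And>v. \<lbrakk>v \<in> carrier_vec d; v \<noteq> 0\<^sub>v d\<rbrakk> \<Longrightarrow> quad M v < 0"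
  shows "\<exists>c>0. \<forall>v\<in>carrier_vec d. quad M v \<le> - c * (v \<bullet> v)"
proof -
  have "pos_def d (- M)"
    using assms symmetric_carrier[OF assms(1)] by (intro pos_defI symmetric_intros) (auto simp: quad_uminus)
  from pos_def_margin[OF this] show ?thesis
    using symmetric_carrier[OF assms(1)] by (fastforce simp: quad_uminus)
qed

text \<open>
  Maximisation of a quadratic form over one group of variables, on which it is negative definite. The
  maximal value \<open>R\<close> is the Schur complement of \<open>M22\<close> and the maximiser is linear in \<open>x\<close>. This is one step of
  the Riccati recursion.
\<close>

lemma complete_square:
  assumes M11: "M11 \<in> symmetric_mats d" and M12: "M12 \<in> carrier_mat d e"
    and M22: "M22 \<in> symmetric_mats e"
    and neg: "\<And>w. \<lbrakk>w \<in> carrier_vec e; w \<noteq> 0\<^sub>v e\<rbrakk> \<Longrightarrow> quad M22 w < 0"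
  obtains R K where "R \<in> symmetric_mats d" "K \<in> carrier_mat e d"
    "\<And>x w. \<lbrakk>x \<in> carrier_vec d; w \<in> carrier_vec e\<rbrakk> \<Longrightarrow>
       quad (sym_block2 M11 M12 M22) (x @\<^sub>v w) \<le> quad R x"
    "\<And>x. x \<in> carrier_vec d \<Longrightarrow> quad (sym_block2 M11 M12 M22) (x @\<^sub>v (K *\<^sub>v x)) = quad R x"
proof -
  have c22: "M22 \<in> carrier_mat e e" and c11: "M11 \<in> carrier_mat d d"
    using M22 M11 symmetric_carrier by auto
  define D where "D = - M22"
  have D: "pos_def e D"
    unfolding D_def using M22 neg c22 by (intro pos_defI symmetric_intros) (auto simp: quad_uminus)
  obtain W where W: "pos_def e W" "D * W = 1\<^sub>m e" using pos_def_inverse[OF D] by metis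
  have cW: "W \<in> carrier_mat e e" and cD: "D \<in> carrier_mat e e" using W D pos_def_carrier by auto
  define K where "K = W * transpose_mat M12"
  define R where "R = M11 + transpose_mat (transpose_mat M12) * W * transpose_mat M12"
  have K: "K \<in> carrier_mat e d" unfolding K_def using cW M12 by auto
  have sR: "R \<in> symmetric_mats d"
    unfolding R_def using M11 M12 pos_def_symmetric[OF W(1)]
    by (intro symmetric_add symmetric_congruence) auto
  have qR: "quad R x = quad M11 x + quad W (transpose_mat M12 *\<^sub>v x)" if "x \<in> carrier_vec d" for x
    using that c11 cW M12 bilinear_congruence[of "transpose_mat M12" e d W "transpose_mat M12" d x x]
    unfolding R_def by (subst quad_add[of _ d]) (auto simp: quad_def)
  have qM: "quad (sym_block2 M11 M12 M22) (x @\<^sub>v w)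
      = quad M11 x + 2 * (w \<bullet> (transpose_mat M12 *\<^sub>v x)) - quad D w"
    if "x \<in> carrier_vec d" "w \<in> carrier_vec e" for x w
    using that M12 c11 c22 transpose_vec_mult_scalar[of M12 d e w x]
      comm_scalar_prod[of w e "transpose_mat M12 *\<^sub>v x"]
    by (auto simp: quad_sym_block2[of _ d _ e] D_def quad_uminus)
  show thesis
  proof (rule that[OF sR K])
    fix x w :: "real vec" assume x: "x \<in> carrier_vec d" and w: "w \<in> carrier_vec e"
    show "quad (sym_block2 M11 M12 M22) (x @\<^sub>v w) \<le> quad R x"
      using inner_le_quad_inverse[OF D pos_def_symmetric[OF W(1)] W(2) w, of "transpose_mat M12 *\<^sub>v x"]
        x w M12 by (simp add: qR qM)
  next
    fix x :: "real vec" assume x: "x \<in> carrier_vec d"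
    have y: "transpose_mat M12 *\<^sub>v x \<in> carrier_vec e" using x M12 by auto
    have Kx: "K *\<^sub>v x = W *\<^sub>v (transpose_mat M12 *\<^sub>v x)"
      unfolding K_def using x cW M12 by (intro assoc_mult_mat_vec) auto
    have "(W *\<^sub>v (transpose_mat M12 *\<^sub>v x)) \<bullet> (transpose_mat M12 *\<^sub>v x) = quad W (transpose_mat M12 *\<^sub>v x)"
      unfolding quad_def using cW y by (intro comm_scalar_prod[of _ e]) auto
    then show "quad (sym_block2 M11 M12 M22) (x @\<^sub>v (K *\<^sub>v x)) = quad R x"
      using x K cW y quad_inverse_image[OF cD cW W(2) y] qM[OF x, of "K *\<^sub>v x"] qR[OF x]
      unfolding Kx by auto
  qed
qed

section \<open>Stacked vectors and powers of matrices\<close>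

lemma pow_mat_commute:
  assumes "A \<in> carrier_mat n n"
  shows "A * A ^\<^sub>m k = A ^\<^sub>m k * A"
proof (induction k)
  case 0
  then show ?case using assms by simp
next
  case (Suc k)
  have "A * A ^\<^sub>m Suc k = (A * A ^\<^sub>m k) * A"
    using assms by (simp add: assoc_mult_mat[of _ n n _ n _ n])
  then show ?case using Suc by simp
qed

lemma transpose_pow_mat:
  fixes A :: "real mat"
  assumes "A \<in> carrier_mat n n"
  shows "transpose_mat A ^\<^sub>m k = transpose_mat (A ^\<^sub>m k)"
proof (induction k)
  case 0
  then show ?case using assms by simp
next
  case (Suc k)
  have "transpose_mat (A ^\<^sub>m Suc k) = transpose_mat (A * A ^\<^sub>m k)"
    using pow_mat_commute[OF assms] by simp
  also have "\<dots> = transpose_mat (A ^\<^sub>m k) * transpose_mat A"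
    using assms by (intro transpose_mult[of _ n n]) auto
  finally show ?case using Suc by simp
qed

lemma sum_div_mod_blocks:
  fixes f :: "nat \<Rightarrow> nat \<Rightarrow> 'a :: comm_monoid_add"
  shows "(\<Sum>c<T * m. f (c div m) (c mod m)) = (\<Sum>k<T. \<Sum>l<m. f k l)"
proof -
  have "(\<Sum>c\<in>{k * m..<k * m + m}. f (c div m) (c mod m)) = (\<Sum>l<m. f k l)" for k
    using sum.shift_bounds_nat_ivl[of "\<lambda>c. f (c div m) (c mod m)" 0 "k * m" m]
    by (simp add: atLeast0LessThan add.commute)
  then show ?thesis
    using sum.nat_group[of "\<lambda>c. f (c div m) (c mod m)" m T] by simp
qed

definition stack :: "nat \<Rightarrow> nat \<Rightarrow> (nat \<Rightarrow> real vec) \<Rightarrow> real vec" where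
  "stack m T z = vec (T * m) (\<lambda>r. z (r div m) $ (r mod m))"

lemma stack_carrier [simp]: "stack m T z \<in> carrier_vec (T * m)"
  by (simp add: stack_def)

lemma stack_blocks:
  assumes "v \<in> carrier_vec (T * m)"
  shows "stack m T (\<lambda>k. vec m (\<lambda>l. v $ (k * m + l))) = v"
proof (intro eq_vecI)
  fix r assume "r < dim_vec v"
  then have r: "r < T * m" using assms by simp
  then have "0 < m" by (cases m) auto
  then show "stack m T (\<lambda>k. vec m (\<lambda>l. v $ (k * m + l))) $ r = v $ r"
    using r by (simp add: stack_def)
qed (use assms in \<open>simp add: stack_def\<close>)

lemma stack_sqnorm:
  assumes "\<And>k. k < T \<Longrightarrow> z k \<in> carrier_vec m"
  shows "stack m T z \<bullet> stack m T z = (\<Sum>k<T. z k \<bullet> z k)"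
proof -
  have "stack m T z \<bullet> stack m T z = (\<Sum>c<T * m. z (c div m) $ (c mod m) * z (c div m) $ (c mod m))"
    by (simp add: stack_def scalar_prod_def atLeast0LessThan)
  also have "\<dots> = (\<Sum>k<T. \<Sum>l<m. z k $ l * z k $ l)"
    by (rule sum_div_mod_blocks)
  also have "\<dots> = (\<Sum>k<T. z k \<bullet> z k)"
  proof (intro sum.cong refl)
    fix k assume "k \<in> {..<T}"
    then show "(\<Sum>l<m. z k $ l * z k $ l) = z k \<bullet> z k"
      using assms[of k] by (auto simp: scalar_prod_def atLeast0LessThan)
  qed
  finally show ?thesis .
qed

lemma stack_eq_zero_iff:
  assumes "\<And>k. k < T \<Longrightarrow> w k \<in> carrier_vec m"
  shows "stack m T w = 0\<^sub>v (T * m) \<longleftrightarrow> (\<forall>k<T. w k = 0\<^sub>v m)"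
proof
  assume "stack m T w = 0\<^sub>v (T * m)"
  then have "(\<Sum>k<T. w k \<bullet> w k) = 0" using stack_sqnorm[of T w m] assms by simp
  then have "\<forall>k<T. w k \<bullet> w k = 0" by (subst (asm) sum_nonneg_eq_0_iff) (auto simp: sqnorm_ge_0)
  then show "\<forall>k<T. w k = 0\<^sub>v m" using sqnorm_pos assms by force
next
  assume w: "\<forall>k<T. w k = 0\<^sub>v m"
  show "stack m T w = 0\<^sub>v (T * m)"
  proof (intro eq_vecI)
    fix r assume "r < dim_vec (0\<^sub>v (T * m) :: real vec)"
    then have "r < T * m" by simp
    then have "r div m < T" "r mod m < m"
      by (auto simp: less_mult_imp_div_less intro!: mod_less_divisor intro: gr0I)
    then show "stack m T w $ r = 0\<^sub>v (T * m) $ r" using w \<open>r < T * m\<close> by (simp add: stack_def)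
  qed (simp add: stack_def)
qed

text \<open>
  A row of a lifted matrix, given entrywise by blocks \<open>M k\<close>, acts on a stack as the sum of the actions of its
  blocks.
\<close>

lemma mult_stack:
  assumes M: "\<And>k. k < T \<Longrightarrow> M k \<in> carrier_mat d m" and w: "\<And>k. k < T \<Longrightarrow> w k \<in> carrier_vec m"
    and r: "r < d"
    and row: "v \<in> carrier_vec (T * m)" "\<And>c. c < T * m \<Longrightarrow> v $ c = M (c div m) $$ (r, c mod m)"
  shows "v \<bullet> stack m T w = (\<Sum>k<T. (M k *\<^sub>v w k) $ r)"
proof -
  have "v \<bullet> stack m T w = (\<Sum>c<T * m. M (c div m) $$ (r, c mod m) * w (c div m) $ (c mod m))"
    using row by (auto simp: stack_def scalar_prod_def atLeast0LessThan intro!: sum.cong)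
  also have "\<dots> = (\<Sum>k<T. \<Sum>l<m. M k $$ (r, l) * w k $ l)"
    by (rule sum_div_mod_blocks)
  also have "\<dots> = (\<Sum>k<T. (M k *\<^sub>v w k) $ r)"
  proof (intro sum.cong refl)
    fix k assume k: "k \<in> {..<T}"
    show "(\<Sum>l<m. M k $$ (r, l) * w k $ l) = (M k *\<^sub>v w k) $ r"
      using M[of k] w[of k] r k by (auto simp: scalar_prod_def atLeast0LessThan)
  qed
  finally show ?thesis .
qed

section \<open>One step of a single mode\<close>

locale lti_system =
  fixes n p q :: nat and A E C F :: "real mat"
  assumes A [simp]: "A \<in> carrier_mat n n" and E [simp]: "E \<in> carrier_mat n p"
    and C [simp]: "C \<in> carrier_mat q n" and F [simp]: "F \<in> carrier_mat q p"
begin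

definition step :: "real vec \<Rightarrow> real vec \<Rightarrow> real vec" where
  "step x w = A *\<^sub>v x + E *\<^sub>v w"

definition out :: "real vec \<Rightarrow> real vec \<Rightarrow> real vec" where
  "out x w = C *\<^sub>v x + F *\<^sub>v w"

definition excess :: "real \<Rightarrow> real vec \<Rightarrow> real vec \<Rightarrow> real" where
  "excess \<gamma> x w = out x w \<bullet> out x w - \<gamma>\<^sup>2 * (w \<bullet> w)"

definition dissipative :: "real \<Rightarrow> real mat \<Rightarrow> real mat \<Rightarrow> bool" where
  "dissipative \<gamma> R1 R2 \<longleftrightarrow> (\<forall>x\<in>carrier_vec n. \<forall>w\<in>carrier_vec p.
     quad R1 (step x w) + excess \<gamma> x w \<le> quad R2 x)"

lemma step_carrier [simp]:
  "\<lbrakk>x \<in> carrier_vec n; w \<in> carrier_vec p\<rbrakk> \<Longrightarrow> step x w \<in> carrier_vec n"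
  by (auto simp: step_def intro!: add_carrier_vec mult_mat_vec_carrier[OF A] mult_mat_vec_carrier[OF E])

lemma out_carrier [simp]:
  "\<lbrakk>x \<in> carrier_vec n; w \<in> carrier_vec p\<rbrakk> \<Longrightarrow> out x w \<in> carrier_vec q"
  by (auto simp: out_def intro!: add_carrier_vec mult_mat_vec_carrier[OF C] mult_mat_vec_carrier[OF F])

lemma matrix_vec_carriers [simp]:
  "x \<in> carrier_vec n \<Longrightarrow> A *\<^sub>v x \<in> carrier_vec n"
  "w \<in> carrier_vec p \<Longrightarrow> E *\<^sub>v w \<in> carrier_vec n"
  "x \<in> carrier_vec n \<Longrightarrow> C *\<^sub>v x \<in> carrier_vec q"
  "w \<in> carrier_vec p \<Longrightarrow> F *\<^sub>v w \<in> carrier_vec q"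
  by (fact mult_mat_vec_carrier[OF A] mult_mat_vec_carrier[OF E]
      mult_mat_vec_carrier[OF C] mult_mat_vec_carrier[OF F])+

lemma primal_lmi_symmetric:
  assumes "R1 \<in> symmetric_mats n" "R2 \<in> symmetric_mats n"
  shows "primal_lmi p A E C F \<gamma> R1 R2 \<in> symmetric_mats (n + p)"
proof -
  have "R1 \<in> carrier_mat n n" using assms symmetric_carrier by auto
  then have "transpose_mat A * R1 * E + transpose_mat C * F \<in> carrier_mat n p"
    by (intro add_carrier_mat mult_carrier_mat[of _ n q] transpose_carrier_mat[THEN iffD2]) auto
  then show ?thesis
    unfolding primal_lmi_def using assms by (intro symmetric_intros) (auto intro: A E C F)
qed

lemma quad_primal_lmi:
  assumes R: "R1 \<in> symmetric_mats n" "R2 \<in> symmetric_mats n"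
    and x: "x \<in> carrier_vec n" and w: "w \<in> carrier_vec p"
  shows "quad (primal_lmi p A E C F \<gamma> R1 R2) (x @\<^sub>v w)
    = quad R1 (step x w) + excess \<gamma> x w - quad R2 x"
proof -
  have c: "R1 \<in> carrier_mat n n" "R2 \<in> carrier_mat n n" using R symmetric_carrier by auto
  have At: "transpose_mat A \<in> carrier_mat n n" and Ct: "transpose_mat C \<in> carrier_mat n q"
    and Et: "transpose_mat E \<in> carrier_mat p n" and Ft: "transpose_mat F \<in> carrier_mat p q"
    using A C E F by auto
  note cm = mult_carrier_mat[OF At c(1)] mult_carrier_mat[OF Et c(1)]
  have [simp]: "transpose_mat A * R1 * A \<in> carrier_mat n n" "transpose_mat C * C \<in> carrier_mat n n"
    "transpose_mat A * R1 * E \<in> carrier_mat n p" "transpose_mat C * F \<in> carrier_mat n p"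
    "transpose_mat E * R1 * E \<in> carrier_mat p p" "transpose_mat F * F \<in> carrier_mat p p"
    by (rule mult_carrier_mat[OF cm(1) A] mult_carrier_mat[OF cm(1) E] mult_carrier_mat[OF cm(2) E]
        mult_carrier_mat[OF Ct C] mult_carrier_mat[OF Ct F] mult_carrier_mat[OF Ft F])+
  have e11: "quad (transpose_mat A * R1 * A - R2 + transpose_mat C * C) x
    = quad R1 (A *\<^sub>v x) - quad R2 x + (C *\<^sub>v x) \<bullet> (C *\<^sub>v x)"
    using x c bilinear_congruence[OF A c(1) A x x] bilinear_gram[OF C C x x]
    by (simp add: quad_add[of _ n] quad_minus[of _ n] minus_carrier_mat) (simp add: quad_def)
  have e12: "x \<bullet> ((transpose_mat A * R1 * E + transpose_mat C * F) *\<^sub>v w)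
    = (A *\<^sub>v x) \<bullet> (R1 *\<^sub>v (E *\<^sub>v w)) + (C *\<^sub>v x) \<bullet> (F *\<^sub>v w)"
    using x w bilinear_congruence[OF A c(1) E x w] bilinear_gram[OF C F x w]
    by (simp add: add_mult_distrib_mat_vec[of _ n p] scalar_prod_add_distrib[of _ n]
        mult_mat_vec_carrier[of _ n p])
  have e22: "quad (transpose_mat E * R1 * E + transpose_mat F * F - \<gamma>\<^sup>2 \<cdot>\<^sub>m 1\<^sub>m p) w
    = quad R1 (E *\<^sub>v w) + (F *\<^sub>v w) \<bullet> (F *\<^sub>v w) - \<gamma>\<^sup>2 * (w \<bullet> w)"
    using w c bilinear_congruence[OF E c(1) E w w] bilinear_gram[OF F F w w]
    by (simp add: quad_add[of _ p] quad_minus[of _ p] quad_smult[of _ p] quad_one) (simp add: quad_def)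
  show ?thesis
    unfolding primal_lmi_def excess_def step_def out_def
    using x w c R
    by (subst quad_sym_block2[of _ n _ p])
      (simp_all add: e11 e12 e22 quad_plus[of _ n] sqnorm_plus[of _ q] minus_carrier_mat add_carrier_mat)
qed

lemma primal_lmi_less_iff:
  assumes "R1 \<in> symmetric_mats n" "R2 \<in> symmetric_mats n"
  shows "primal_lmi p A E C F \<gamma> R1 R2 \<prec>\<^bsub>n + p\<^esub> 0\<^sub>m (n + p) (n + p) \<longleftrightarrow>
    (\<forall>x\<in>carrier_vec n. \<forall>w\<in>carrier_vec p. x \<noteq> 0\<^sub>v n \<or> w \<noteq> 0\<^sub>v p \<longrightarrow>
       quad R1 (step x w) + excess \<gamma> x w < quad R2 x)"
  unfolding loewner_less_zero_iff[OF primal_lmi_symmetric[OF assms]] all_vec_append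
  using assms by (auto simp: quad_primal_lmi append_vec_eq_zero_iff)

lemma primal_lmi_le_iff:
  assumes "R1 \<in> symmetric_mats n" "R2 \<in> symmetric_mats n"
  shows "primal_lmi p A E C F \<gamma> R1 R2 \<preceq>\<^bsub>n + p\<^esub> 0\<^sub>m (n + p) (n + p) \<longleftrightarrow> dissipative \<gamma> R1 R2"
  unfolding dissipative_def loewner_le_zero_iff[OF primal_lmi_symmetric[OF assms]] all_vec_append
  using assms by (auto simp: quad_primal_lmi)

text \<open>
  The strict one-step inequality of a single storage function, known as the bounded real inequality,
  holds with a quadratic margin in state and input.
\<close>

lemma bounded_real_margin:
  assumes P: "P \<in> symmetric_mats n"
    and strict: "primal_lmi p A E C F \<gamma> P P \<prec>\<^bsub>n + p\<^esub> 0\<^sub>m (n + p) (n + p)"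
  shows "\<exists>c>0. \<forall>x\<in>carrier_vec n. \<forall>w\<in>carrier_vec p.
    quad P (step x w) + excess \<gamma> x w + c * (x \<bullet> x + w \<bullet> w) \<le> quad P x"
proof -
  obtain c where "c > 0" and c: "\<forall>v\<in>carrier_vec (n + p). quad (primal_lmi p A E C F \<gamma> P P) v \<le> - c * (v \<bullet> v)"
    using neg_def_margin[OF primal_lmi_symmetric[OF P P]] strict
    unfolding loewner_less_zero_iff[OF primal_lmi_symmetric[OF P P]] by blast
  have "quad P (step x w) + excess \<gamma> x w + c * (x \<bullet> x + w \<bullet> w) \<le> quad P x"
    if "x \<in> carrier_vec n" "w \<in> carrier_vec p" for x w
    using c[rule_format, of "x @\<^sub>v w"] that
    by (simp add: quad_primal_lmi[OF P P] scalar_prod_append[of _ n _ p])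
  then show ?thesis using \<open>c > 0\<close> by auto
qed

end

section \<open>Trajectories and the lifted inequality\<close>

context lti_system
begin

text \<open>
  Only the first \<open>T\<close> steps are constrained, so that pieces of longer runs, and runs of the switched system
  during which one mode is active, are trajectories as they stand.
\<close>

definition trajectory :: "nat \<Rightarrow> (nat \<Rightarrow> real vec) \<Rightarrow> (nat \<Rightarrow> real vec) \<Rightarrow> bool" where
  "trajectory T x w \<longleftrightarrow> (\<forall>k\<le>T. x k \<in> carrier_vec n) \<and>
     (\<forall>k<T. w k \<in> carrier_vec p \<and> x (Suc k) = step (x k) (w k))"

lemma trajectoryD:
  "trajectory T x w \<Longrightarrow> k \<le> T \<Longrightarrow> x k \<in> carrier_vec n"
  "trajectory T x w \<Longrightarrow> k < T \<Longrightarrow> w k \<in> carrier_vec p"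
  "trajectory T x w \<Longrightarrow> k < T \<Longrightarrow> x (Suc k) = step (x k) (w k)"
  by (auto simp: trajectory_def)

lemma trajectory_shift: "trajectory (Suc T) x w \<Longrightarrow> trajectory T (\<lambda>k. x (Suc k)) (\<lambda>k. w (Suc k))"
  by (auto simp: trajectory_def)

lemma trajectory_prefix: "\<lbrakk>trajectory T x w; k \<le> T\<rbrakk> \<Longrightarrow> trajectory k x w"
  by (auto simp: trajectory_def)

lemma trajectory_exists:
  assumes "x0 \<in> carrier_vec n" "\<And>k. k < T \<Longrightarrow> w k \<in> carrier_vec p"
  obtains x where "trajectory T x w" "x 0 = x0"
proof
  let ?x = "rec_nat x0 (\<lambda>k x. step x (w k))"
  have "?x k \<in> carrier_vec n" if "k \<le> T" for k
    using that by (induction k) (use assms in auto)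
  then show "trajectory T ?x w" using assms by (auto simp: trajectory_def)
qed simp

text \<open>
  Variation of constants, proved by splitting off the first step. The factor \<open>L\<close> is there because the
  formula is needed for \<open>L = 1\<close> (the state) and for \<open>L = C\<close> (the output), and componentwise because the lifted
  matrices are given by their entries.
\<close>

lemma trajectory_image:
  assumes "trajectory k x w" "L \<in> carrier_mat m n" "r < m"
  shows "(L *\<^sub>v x k) $ r =
    ((L * A ^\<^sub>m k) *\<^sub>v x 0) $ r + (\<Sum>j<k. ((L * A ^\<^sub>m (k - 1 - j) * E) *\<^sub>v w j) $ r)"
  using assms(1)
proof (induction k arbitrary: x w)
  case 0
  have "L * A ^\<^sub>m 0 = L" using assms(2) carrier_matD[OF A] by simp
  then show ?case by simp
next
  case (Suc k)
  have x0: "x 0 \<in> carrier_vec n" and w0: "w 0 \<in> carrier_vec p" and x1: "x (Suc 0) = step (x 0) (w 0)"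
    using Suc.prems by (auto simp: trajectory_def)
  have LA: "L * A ^\<^sub>m k \<in> carrier_mat m n"
    using assms(2) by (rule mult_carrier_mat) simp
  have "(L * A ^\<^sub>m k) *\<^sub>v step (x 0) (w 0) = (L * A ^\<^sub>m k) *\<^sub>v (A *\<^sub>v x 0) + (L * A ^\<^sub>m k) *\<^sub>v (E *\<^sub>v w 0)"
    unfolding step_def using x0 w0 by (intro mult_add_distrib_mat_vec[OF LA]) auto
  also have "(L * A ^\<^sub>m k) *\<^sub>v (A *\<^sub>v x 0) = (L * A ^\<^sub>m Suc k) *\<^sub>v x 0"
    using x0 assoc_mult_mat_vec[OF LA A x0] assoc_mult_mat[OF assms(2) pow_carrier_mat[OF A] A] by simp
  also have "(L * A ^\<^sub>m k) *\<^sub>v (E *\<^sub>v w 0) = (L * A ^\<^sub>m k * E) *\<^sub>v w 0"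
    using w0 assoc_mult_mat_vec[OF LA E w0] by simp
  finally have "((L * A ^\<^sub>m k) *\<^sub>v x (Suc 0)) $ r
    = ((L * A ^\<^sub>m Suc k) *\<^sub>v x 0) $ r + ((L * A ^\<^sub>m k * E) *\<^sub>v w 0) $ r"
    using x1 assms(2,3) by simp
  with Suc.IH[OF trajectory_shift[OF Suc.prems]] show ?case
    by (subst sum.lessThan_Suc_shift) (simp add: algebra_simps)
qed

lemma markov_carrier: "markov A E C F k \<in> carrier_mat q p"
  by (cases k) (auto intro!: mult_carrier_mat[of _ q n] mult_carrier_mat[of _ n n])

lemma trajectory_out:
  assumes "trajectory T x w" "k < T" "r < q"
  shows "out (x k) (w k) $ r =
    ((C * A ^\<^sub>m k) *\<^sub>v x 0) $ r + (\<Sum>j<Suc k. (markov A E C F (k - j) *\<^sub>v w j) $ r)"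
proof -
  have w: "w k \<in> carrier_vec p" using assms by (auto simp: trajectory_def)
  have "(\<Sum>j<k. ((C * A ^\<^sub>m (k - 1 - j) * E) *\<^sub>v w j) $ r) = (\<Sum>j<k. (markov A E C F (k - j) *\<^sub>v w j) $ r)"
  proof (intro sum.cong refl)
    fix j assume "j \<in> {..<k}"
    then have "k - j = Suc (k - 1 - j)" by auto
    then show "((C * A ^\<^sub>m (k - 1 - j) * E) *\<^sub>v w j) $ r = (markov A E C F (k - j) *\<^sub>v w j) $ r" by simp
  qed
  moreover have "out (x k) (w k) $ r = (C *\<^sub>v x k) $ r + (F *\<^sub>v w k) $ r"
    unfolding out_def using assms(3) matrix_vec_carriers(4)[OF w] carrier_matD[OF F] by (intro index_add_vec) simp
  ultimately show ?thesis
    using trajectory_image[OF trajectory_prefix[OF assms(1)] C assms(3), of k] assms(2) by simp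
qed

lemma lifted_carriers:
  "A ^\<^sub>m T \<in> carrier_mat n n" "lifted_E n p A E T \<in> carrier_mat n (T * p)"
  "lifted_C n q A C T \<in> carrier_mat (T * q) n" "lifted_F p q A E C F T \<in> carrier_mat (T * q) (T * p)"
  by (auto simp: lifted_E_def lifted_C_def lifted_F_def)

lemma transpose_lifted_G:
  "transpose_mat (lifted_G n p q A E C F T)
    = four_block_mat (A ^\<^sub>m T) (lifted_E n p A E T) (lifted_C n q A C T) (lifted_F p q A E C F T)"
  unfolding lifted_G_def transpose_pow_mat[OF A]
  by (subst transpose_four_block_mat) (use lifted_carriers[of T] in \<open>auto simp del: pow_carrier_mat\<close>)

lemma lifted_state:
  assumes t: "trajectory T x w"
  shows "A ^\<^sub>m T *\<^sub>v x 0 + lifted_E n p A E T *\<^sub>v stack p T w = x T"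
proof (intro eq_vecI)
  have xT: "x T \<in> carrier_vec n" using t by (simp add: trajectory_def)
  then show "dim_vec (A ^\<^sub>m T *\<^sub>v x 0 + lifted_E n p A E T *\<^sub>v stack p T w) = dim_vec (x T)"
    by (simp add: lifted_E_def)
  fix r assume "r < dim_vec (x T)"
  then have r: "r < n" using xT by simp
  have AE: "A ^\<^sub>m (T - 1 - k) * E \<in> carrier_mat n p" for k
    by (rule mult_carrier_mat[OF pow_carrier_mat[OF A] E])
  have "row (lifted_E n p A E T) r \<bullet> stack p T w = (\<Sum>k<T. ((A ^\<^sub>m (T - 1 - k) * E) *\<^sub>v w k) $ r)"
    using t r by (intro mult_stack[OF AE]) (auto simp: trajectory_def lifted_E_def)
  moreover have "1\<^sub>m n *\<^sub>v x T = x T" "1\<^sub>m n * A ^\<^sub>m k = A ^\<^sub>m k" for k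
    using xT left_mult_one_mat[OF pow_carrier_mat[OF A, of k]] by auto
  ultimately show "(A ^\<^sub>m T *\<^sub>v x 0 + lifted_E n p A E T *\<^sub>v stack p T w) $ r = x T $ r"
    using trajectory_image[OF t one_carrier_mat r] r by (simp add: lifted_E_def)
qed

lemma lifted_out:
  assumes t: "trajectory T x w"
  shows "lifted_C n q A C T *\<^sub>v x 0 + lifted_F p q A E C F T *\<^sub>v stack p T w
    = stack q T (\<lambda>k. out (x k) (w k))"
proof (intro eq_vecI)
  show "dim_vec (lifted_C n q A C T *\<^sub>v x 0 + lifted_F p q A E C F T *\<^sub>v stack p T w)
    = dim_vec (stack q T (\<lambda>k. out (x k) (w k)))"
    by (simp add: lifted_F_def stack_def)
  fix r assume "r < dim_vec (stack q T (\<lambda>k. out (x k) (w k)))"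
  then have r: "r < T * q" by (simp add: stack_def)
  then have q: "0 < q" by (cases q) auto
  define k where "k = r div q"
  define l where "l = r mod q"
  have k: "k < T" and l: "l < q" using r q by (auto simp: k_def l_def less_mult_imp_div_less)
  have CA: "C * A ^\<^sub>m k \<in> carrier_mat q n" by (rule mult_carrier_mat[OF C pow_carrier_mat[OF A]])
  have x0: "x 0 \<in> carrier_vec n" using t by (simp add: trajectory_def)
  have rowC: "row (lifted_C n q A C T) r \<bullet> x 0 = ((C * A ^\<^sub>m k) *\<^sub>v x 0) $ l"
  proof -
    have "row (lifted_C n q A C T) r = row (C * A ^\<^sub>m k) l"
      using r l carrier_matD[OF CA] by (intro eq_vecI) (auto simp del: index_mult_mat pow_mat_dim simp: lifted_C_def k_def l_def)
    then show ?thesis using l carrier_matD[OF CA] by (simp del: index_mult_mat pow_mat_dim)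
  qed
  have pm: "0 < p" if "c < T * p" for c using that by (cases p) auto
  have "row (lifted_F p q A E C F T) r \<bullet> stack p T w
    = (\<Sum>j<T. ((if j \<le> k then markov A E C F (k - j) else 0\<^sub>m q p) *\<^sub>v w j) $ l)"
    using t r l less_mult_imp_div_less[of _ T p]
    by (intro mult_stack[where d = q and m = p])
      (auto simp: trajectory_def lifted_F_def k_def l_def markov_carrier pm)
  moreover have "\<dots> = (\<Sum>j<Suc k. (markov A E C F (k - j) *\<^sub>v w j) $ l)"
  proof (intro sum.mono_neutral_cong_right)
    show "\<forall>j\<in>{..<T} - {..<Suc k}. ((if j \<le> k then markov A E C F (k - j) else 0\<^sub>m q p) *\<^sub>v w j) $ l = 0"
      using t l by (auto simp: trajectory_def zero_mult_mat_vec)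
  qed (use k in auto)
  ultimately show "(lifted_C n q A C T *\<^sub>v x 0 + lifted_F p q A E C F T *\<^sub>v stack p T w) $ r
    = stack q T (\<lambda>k. out (x k) (w k)) $ r"
    using trajectory_out[OF t k l] rowC r by (simp add: lifted_C_def lifted_F_def stack_def k_def[symmetric] l_def[symmetric])
qed

definition lifted_lmi :: "nat \<Rightarrow> real \<Rightarrow> real mat \<Rightarrow> real mat \<Rightarrow> real mat" where
  "lifted_lmi T \<gamma> P Q = (let G = lifted_G n p q A E C F T in
     sym_block2 (- Q) (0\<^sub>m n (T * p)) (- (\<gamma>\<^sup>2 \<cdot>\<^sub>m 1\<^sub>m (T * p))) +
     G * sym_block2 P (0\<^sub>m n (T * q)) (1\<^sub>m (T * q)) * transpose_mat G)"

lemma lifted_lmi_symmetric: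
  assumes "P \<in> symmetric_mats n" "Q \<in> symmetric_mats n"
  shows "lifted_lmi T \<gamma> P Q \<in> symmetric_mats (n + T * p)"
proof -
  let ?H = "transpose_mat (lifted_G n p q A E C F T)"
  have H: "?H \<in> carrier_mat (n + T * q) (n + T * p)"
    unfolding transpose_lifted_G using lifted_carriers by (intro four_block_carrier_mat) auto
  have "transpose_mat ?H * sym_block2 P (0\<^sub>m n (T * q)) (1\<^sub>m (T * q)) * ?H \<in> symmetric_mats (n + T * p)"
    by (rule symmetric_congruence[OF symmetric_sym_block2[OF assms(1) zero_carrier_mat symmetric_one] H])
  then show ?thesis
    unfolding lifted_lmi_def Let_def using assms by (intro symmetric_intros) auto
qed

text \<open>
  The transpose of the lifted matrix maps the initial state and the stacked inputs to the final state and the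
  stacked outputs.
\<close>

lemma quad_lifted_lmi:
  assumes PQ: "P \<in> symmetric_mats n" "Q \<in> symmetric_mats n" and t: "trajectory T x w"
  shows "quad (lifted_lmi T \<gamma> P Q) (x 0 @\<^sub>v stack p T w)
    = quad P (x T) + (\<Sum>k<T. excess \<gamma> (x k) (w k)) - quad Q (x 0)"
proof -
  let ?H = "transpose_mat (lifted_G n p q A E C F T)"
  let ?z = "stack q T (\<lambda>k. out (x k) (w k))"
  let ?D = "sym_block2 P (0\<^sub>m n (T * q)) (1\<^sub>m (T * q))"
  let ?N = "sym_block2 (- Q) (0\<^sub>m n (T * p)) (- (\<gamma>\<^sup>2 \<cdot>\<^sub>m 1\<^sub>m (T * p)))"
  have x: "x 0 \<in> carrier_vec n" "x T \<in> carrier_vec n" using t by (auto simp: trajectory_def)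
  have c: "P \<in> carrier_mat n n" "Q \<in> carrier_mat n n" using PQ symmetric_carrier by auto
  have H: "?H \<in> carrier_mat (n + T * q) (n + T * p)"
    unfolding transpose_lifted_G using lifted_carriers by (intro four_block_carrier_mat) auto
  have D: "?D \<in> symmetric_mats (n + T * q)" "?N \<in> symmetric_mats (n + T * p)"
    using PQ by (auto intro!: symmetric_intros)
  note cD = D[THEN symmetric_carrier]
  have Hx: "?H *\<^sub>v (x 0 @\<^sub>v stack p T w) = x T @\<^sub>v ?z"
    unfolding transpose_lifted_G using x
    by (subst four_block_mat_mult_vec[OF lifted_carriers(1,2,3,4)]) (auto simp: lifted_state[OF t] lifted_out[OF t])
  have v: "x 0 @\<^sub>v stack p T w \<in> carrier_vec (n + T * p)" using x by auto
  have "quad (lifted_lmi T \<gamma> P Q) (x 0 @\<^sub>v stack p T w)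
    = quad ?N (x 0 @\<^sub>v stack p T w) + quad ?D (x T @\<^sub>v ?z)"
    using v bilinear_congruence[OF H cD(1) H v v] symmetric_congruence[OF D(1) H, THEN symmetric_carrier] cD(2)
    unfolding lifted_lmi_def Let_def by (subst quad_add[of _ "n + T * p"]) (auto simp: quad_def[of _ "_ @\<^sub>v _"] Hx)
  also have "quad ?D (x T @\<^sub>v ?z) = quad P (x T) + ?z \<bullet> ?z"
    using x c by (subst quad_sym_block2[of _ n _ "T * q"]) (auto simp: zero_mult_mat_vec quad_one[of _ "T * q"])
  also have "quad ?N (x 0 @\<^sub>v stack p T w) = - quad Q (x 0) - \<gamma>\<^sup>2 * (stack p T w \<bullet> stack p T w)"
    using x c by (subst quad_sym_block2[of _ n _ "T * p"])
      (auto simp: zero_mult_mat_vec quad_one[of _ "T * p"] quad_uminus[of _ n] quad_uminus[of _ "T * p"] quad_smult[of _ "T * p"])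
  also have "?z \<bullet> ?z = (\<Sum>k<T. out (x k) (w k) \<bullet> out (x k) (w k))"
    using t by (intro stack_sqnorm) (auto simp: trajectory_def)
  also have "stack p T w \<bullet> stack p T w = (\<Sum>k<T. w k \<bullet> w k)"
    using t by (intro stack_sqnorm) (auto simp: trajectory_def)
  finally show ?thesis by (simp add: excess_def sum_subtractf sum_distrib_left)
qed

lemma ball_stacked_trajectory:
  "(\<forall>v\<in>carrier_vec (n + T * p). Q v) \<longleftrightarrow>
   (\<forall>x w. trajectory T x w \<longrightarrow> Q (x 0 @\<^sub>v stack p T w))"
proof safe
  fix x w assume "\<forall>v\<in>carrier_vec (n + T * p). Q v" "trajectory T x w"
  then show "Q (x 0 @\<^sub>v stack p T w)" by (auto simp: trajectory_def)
next
  fix v :: "real vec" assume *: "\<forall>x w. trajectory T x w \<longrightarrow> Q (x 0 @\<^sub>v stack p T w)"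
    and v: "v \<in> carrier_vec (n + T * p)"
  let ?w = "\<lambda>k. vec p (\<lambda>l. vec_last v (T * p) $ (k * p + l))"
  obtain x where "trajectory T x ?w" "x 0 = vec_first v n"
    by (rule trajectory_exists[of "vec_first v n" T ?w]) auto
  with * have "Q (vec_first v n @\<^sub>v stack p T ?w)" by metis
  then show "Q v" using stack_blocks[of "vec_last v (T * p)" T p] v by simp
qed

lemma lifted_lmi_less_iff:
  assumes "P \<in> symmetric_mats n" "Q \<in> symmetric_mats n"
  shows "lifted_lmi T \<gamma> P Q \<prec>\<^bsub>n + T * p\<^esub> 0\<^sub>m (n + T * p) (n + T * p) \<longleftrightarrow>
    (\<forall>x w. trajectory T x w \<longrightarrow> x 0 \<noteq> 0\<^sub>v n \<or> (\<exists>k<T. w k \<noteq> 0\<^sub>v p) \<longrightarrow>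
       quad P (x T) + (\<Sum>k<T. excess \<gamma> (x k) (w k)) < quad Q (x 0))"
proof -
  have "x 0 @\<^sub>v stack p T w = 0\<^sub>v (n + T * p) \<longleftrightarrow> x 0 = 0\<^sub>v n \<and> (\<forall>k<T. w k = 0\<^sub>v p)"
    if "trajectory T x w" for x w
    using that by (subst append_vec_eq_zero_iff) (auto simp: trajectory_def stack_eq_zero_iff)
  then show ?thesis
    unfolding loewner_less_zero_iff[OF lifted_lmi_symmetric[OF assms]] ball_stacked_trajectory
    using assms by (auto simp: quad_lifted_lmi)
qed

end

lemma telescope_le:
  fixes a :: "nat \<Rightarrow> real"
  assumes "\<And>k. k < T \<Longrightarrow> a (Suc k) + r k \<le> a k"
  shows "a T + (\<Sum>k<T. r k) \<le> a 0"
  using assms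
proof (induction T)
  case (Suc T)
  have "a T + (\<Sum>k<T. r k) \<le> a 0" by (rule Suc.IH) (simp add: Suc.prems)
  then show ?case using Suc.prems[of T] by simp
qed simp

context lti_system
begin

lemma dissipative_chain:
  assumes "\<And>k. k < T \<Longrightarrow> dissipative \<gamma> (R (Suc k)) (R k)" "trajectory T x w"
  shows "quad (R T) (x T) + (\<Sum>k<T. excess \<gamma> (x k) (w k)) \<le> quad (R 0) (x 0)"
  using assms by (intro telescope_le[of T "\<lambda>k. quad (R k) (x k)"]) (auto simp: dissipative_def trajectory_def)

text \<open>
  It suffices to consider nonzero initial states: from the origin, the strict one-step inequality of \<open>P\<close>
  accumulates along the trajectory, and any nonzero input makes the sum strictly negative.
\<close>

lemma lifted_lmi_lessI:
  assumes P: "P \<in> symmetric_mats n" "Q \<in> symmetric_mats n"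
    and strict: "primal_lmi p A E C F \<gamma> P P \<prec>\<^bsub>n + p\<^esub> 0\<^sub>m (n + p) (n + p)"
    and nonzero: "\<And>x w. \<lbrakk>trajectory T x w; x 0 \<noteq> 0\<^sub>v n\<rbrakk> \<Longrightarrow>
      quad P (x T) + (\<Sum>k<T. excess \<gamma> (x k) (w k)) < quad Q (x 0)"
  shows "lifted_lmi T \<gamma> P Q \<prec>\<^bsub>n + T * p\<^esub> 0\<^sub>m (n + T * p) (n + T * p)"
  unfolding lifted_lmi_less_iff[OF P]
proof (intro allI impI)
  fix x w assume t: "trajectory T x w" and nz: "x 0 \<noteq> 0\<^sub>v n \<or> (\<exists>k<T. w k \<noteq> 0\<^sub>v p)"
  show "quad P (x T) + (\<Sum>k<T. excess \<gamma> (x k) (w k)) < quad Q (x 0)"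
  proof (cases "x 0 = 0\<^sub>v n")
    case True
    then obtain k where k: "k < T" "w k \<noteq> 0\<^sub>v p" using nz by auto
    obtain c where "c > 0" and c: "\<And>x w. \<lbrakk>x \<in> carrier_vec n; w \<in> carrier_vec p\<rbrakk> \<Longrightarrow>
        quad P (step x w) + excess \<gamma> x w + c * (x \<bullet> x + w \<bullet> w) \<le> quad P x"
      using bounded_real_margin[OF P(1) strict] by blast
    have "quad P (x T) + (\<Sum>k<T. excess \<gamma> (x k) (w k) + c * (x k \<bullet> x k + w k \<bullet> w k)) \<le> quad P (x 0)"
    proof (rule telescope_le[of T "\<lambda>k. quad P (x k)"])
      fix k assume "k < T"
      then show "quad P (x (Suc k)) + (excess \<gamma> (x k) (w k) + c * (x k \<bullet> x k + w k \<bullet> w k)) \<le> quad P (x k)"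
        using c[of "x k" "w k"] trajectoryD[OF t] by (simp add: add.assoc)
    qed
    moreover have "0 < (\<Sum>k<T. c * (x k \<bullet> x k + w k \<bullet> w k))"
    proof (rule sum_pos2[of _ k])
      have "0 < w k \<bullet> w k" using sqnorm_pos[OF trajectoryD(2)[OF t k(1)] k(2)] .
      then show "0 < c * (x k \<bullet> x k + w k \<bullet> w k)" using \<open>c > 0\<close> sqnorm_ge_0[of "x k"] by simp
      show "0 \<le> c * (x i \<bullet> x i + w i \<bullet> w i)" for i
        using \<open>c > 0\<close> sqnorm_ge_0[of "x i"] sqnorm_ge_0[of "w i"] by simp
    qed (use k in auto)
    ultimately show ?thesis
      using True quad_zero_vec[OF symmetric_carrier[OF P(1)]] quad_zero_vec[OF symmetric_carrier[OF P(2)]]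
      by (simp add: sum.distrib)
  qed (use nonzero[OF t] in simp)
qed

lemma step_bounded:
  "\<exists>L\<ge>1. \<forall>x\<in>carrier_vec n. \<forall>w\<in>carrier_vec p. step x w \<bullet> step x w \<le> L * (x \<bullet> x + w \<bullet> w)"
proof -
  obtain a where a: "a > 0" "\<forall>v\<in>carrier_vec n. (A *\<^sub>v v) \<bullet> (A *\<^sub>v v) \<le> a * (v \<bullet> v)"
    using sqnorm_mult_bounded[OF A] by blast
  obtain e where e: "e > 0" "\<forall>v\<in>carrier_vec p. (E *\<^sub>v v) \<bullet> (E *\<^sub>v v) \<le> e * (v \<bullet> v)"
    using sqnorm_mult_bounded[OF E] by blast
  have "step x w \<bullet> step x w \<le> (1 + 2 * a + 2 * e) * (x \<bullet> x + w \<bullet> w)"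
    if x: "x \<in> carrier_vec n" and w: "w \<in> carrier_vec p" for x w
  proof -
    have "step x w \<bullet> step x w \<le> 2 * ((A *\<^sub>v x) \<bullet> (A *\<^sub>v x)) + 2 * ((E *\<^sub>v w) \<bullet> (E *\<^sub>v w))"
      unfolding step_def using x w by (intro sqnorm_plus_le[of _ n]) auto
    also have "\<dots> \<le> 2 * (a * (x \<bullet> x)) + 2 * (e * (w \<bullet> w))"
      using a(2)[rule_format, OF x] e(2)[rule_format, OF w] by linarith
    also have "\<dots> \<le> (1 + 2 * a + 2 * e) * (x \<bullet> x + w \<bullet> w)"
      using a(1) e(1) sqnorm_ge_0[of x] sqnorm_ge_0[of w] by (simp add: algebra_simps)
    finally show ?thesis .
  qed
  then show ?thesis using a(1) e(1) by (intro exI[of _ "1 + 2 * a + 2 * e"]) auto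
qed

lemma trajectory_energy_bounded:
  "\<exists>K>0. \<forall>x w. trajectory T x w \<longrightarrow>
     (\<Sum>k<T. x k \<bullet> x k + w k \<bullet> w k) \<le> K * (x 0 \<bullet> x 0 + (\<Sum>k<T. w k \<bullet> w k))"
proof -
  obtain L where L: "L \<ge> 1" "\<And>x w. \<lbrakk>x \<in> carrier_vec n; w \<in> carrier_vec p\<rbrakk> \<Longrightarrow>
      step x w \<bullet> step x w \<le> L * (x \<bullet> x + w \<bullet> w)"
    using step_bounded by blast
  have "(\<Sum>k<T. x k \<bullet> x k + w k \<bullet> w k) \<le> (real T * L ^ T + 1) * (x 0 \<bullet> x 0 + (\<Sum>k<T. w k \<bullet> w k))"
    if t: "trajectory T x w" for x w
  proof -
    let ?e = "\<lambda>k. x 0 \<bullet> x 0 + (\<Sum>j<k. w j \<bullet> w j)"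
    have e0: "0 \<le> ?e k" for k by (intro add_nonneg_nonneg sum_nonneg sqnorm_ge_0)
    have growth: "x k \<bullet> x k \<le> L ^ k * ?e k" if "k \<le> T" for k
      using that
    proof (induction k)
      case (Suc k)
      have "x (Suc k) \<bullet> x (Suc k) \<le> L * (x k \<bullet> x k + w k \<bullet> w k)"
        using L(2)[of "x k" "w k"] trajectoryD[OF t, of k] Suc.prems by simp
      also have "\<dots> \<le> L * (L ^ k * ?e k + L ^ k * (w k \<bullet> w k))"
        using L(1) Suc sqnorm_ge_0[of "w k"] mult_right_mono[of 1 "L ^ k" "w k \<bullet> w k"]
        by (intro mult_left_mono add_mono) auto
      also have "\<dots> = L ^ Suc k * ?e (Suc k)" by (simp add: algebra_simps)
      finally show ?case .
    qed simp
    have "x k \<bullet> x k \<le> L ^ T * ?e T" if "k < T" for k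
    proof -
      have "x k \<bullet> x k \<le> L ^ k * ?e k" using growth that by simp
      also have "\<dots> \<le> L ^ T * ?e T"
        using that L(1) e0 sum_mono2[of "{..<T}" "{..<k}" "\<lambda>j. w j \<bullet> w j"] sqnorm_ge_0
        by (intro mult_mono power_increasing) auto
      finally show ?thesis .
    qed
    then have "(\<Sum>k<T. x k \<bullet> x k) \<le> (\<Sum>k<T. L ^ T * ?e T)" by (intro sum_mono) auto
    moreover have "(\<Sum>k<T. w k \<bullet> w k) \<le> ?e T" using sqnorm_ge_0[of "x 0"] by simp
    ultimately show ?thesis by (simp add: sum.distrib algebra_simps)
  qed
  moreover have "0 < real T * L ^ T + 1" using L(1) by (simp add: add_nonneg_pos)
  ultimately show ?thesis by blast
qed

text \<open>
  The margin first obtained is in the initial state and the inputs; boundedness of trajectories on a finite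
  horizon extends it to all the states on the way.
\<close>

lemma lifted_margin:
  assumes P: "P \<in> symmetric_mats n" "Q \<in> symmetric_mats n"
    and strict: "lifted_lmi T \<gamma> P Q \<prec>\<^bsub>n + T * p\<^esub> 0\<^sub>m (n + T * p) (n + T * p)"
  shows "\<exists>c>0. \<forall>x w. trajectory T x w \<longrightarrow>
    quad P (x T) + (\<Sum>k<T. excess \<gamma> (x k) (w k) + c * (x k \<bullet> x k + w k \<bullet> w k)) \<le> quad Q (x 0)"
proof -
  obtain c where "c > 0" and c: "\<forall>v\<in>carrier_vec (n + T * p). quad (lifted_lmi T \<gamma> P Q) v \<le> - c * (v \<bullet> v)"
    using neg_def_margin[OF lifted_lmi_symmetric[OF P, of T \<gamma>]] strict
    unfolding loewner_less_zero_iff[OF lifted_lmi_symmetric[OF P, of T \<gamma>]] by blast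
  obtain K where "K > 0" and K: "\<forall>x w. trajectory T x w \<longrightarrow>
      (\<Sum>k<T. x k \<bullet> x k + w k \<bullet> w k) \<le> K * (x 0 \<bullet> x 0 + (\<Sum>k<T. w k \<bullet> w k))"
    using trajectory_energy_bounded by blast
  have "quad P (x T) + (\<Sum>k<T. excess \<gamma> (x k) (w k) + c / K * (x k \<bullet> x k + w k \<bullet> w k)) \<le> quad Q (x 0)"
    if t: "trajectory T x w" for x w
  proof -
    have "quad P (x T) + (\<Sum>k<T. excess \<gamma> (x k) (w k)) - quad Q (x 0)
        \<le> - c * (x 0 \<bullet> x 0 + stack p T w \<bullet> stack p T w)"
      using c[rule_format, of "x 0 @\<^sub>v stack p T w"] trajectoryD[OF t, of 0]
      by (simp add: quad_lifted_lmi[OF P t] scalar_prod_append[of _ n _ "T * p"])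
    also have "stack p T w \<bullet> stack p T w = (\<Sum>k<T. w k \<bullet> w k)"
      using trajectoryD[OF t] by (intro stack_sqnorm) auto
    finally have "quad P (x T) + (\<Sum>k<T. excess \<gamma> (x k) (w k)) + c * (x 0 \<bullet> x 0 + (\<Sum>k<T. w k \<bullet> w k)) \<le> quad Q (x 0)"
      by simp
    moreover have "c / K * (\<Sum>k<T. x k \<bullet> x k + w k \<bullet> w k) \<le> c / K * (K * (x 0 \<bullet> x 0 + (\<Sum>k<T. w k \<bullet> w k)))"
      using K t \<open>c > 0\<close> \<open>K > 0\<close> by (intro mult_left_mono) auto
    moreover have "c / K * (K * (x 0 \<bullet> x 0 + (\<Sum>k<T. w k \<bullet> w k))) = c * (x 0 \<bullet> x 0 + (\<Sum>k<T. w k \<bullet> w k))"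
      using \<open>K > 0\<close> by simp
    ultimately show ?thesis by (simp only: sum.distrib[of "\<lambda>k. excess \<gamma> (x k) (w k)"] sum_distrib_left[symmetric])
  qed
  then show ?thesis using \<open>c > 0\<close> \<open>K > 0\<close> by (intro exI[of _ "c / K"]) auto
qed

end

section \<open>The adjoint system and the dual inequality\<close>

context lti_system
begin

definition dual_step :: "real vec \<Rightarrow> real vec \<Rightarrow> real vec" where
  "dual_step \<xi> \<zeta> = transpose_mat A *\<^sub>v \<xi> + transpose_mat C *\<^sub>v \<zeta>"

definition dual_out :: "real vec \<Rightarrow> real vec \<Rightarrow> real vec" where
  "dual_out \<xi> \<zeta> = transpose_mat E *\<^sub>v \<xi> + transpose_mat F *\<^sub>v \<zeta>"

definition dual_dissipative :: "real \<Rightarrow> real mat \<Rightarrow> real mat \<Rightarrow> bool" where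
  "dual_dissipative \<gamma> S1 S2 \<longleftrightarrow> (\<forall>\<xi>\<in>carrier_vec n. \<forall>\<zeta>\<in>carrier_vec q.
     quad S1 (dual_step \<xi> \<zeta>) + (dual_out \<xi> \<zeta> \<bullet> dual_out \<xi> \<zeta>) / \<gamma>\<^sup>2 \<le> quad S2 \<xi> + \<zeta> \<bullet> \<zeta>)"

lemma transpose_carriers [simp]: "transpose_mat A \<in> carrier_mat n n" "transpose_mat C \<in> carrier_mat n q"
  "transpose_mat E \<in> carrier_mat p n" "transpose_mat F \<in> carrier_mat p q"
  by (simp_all only: transpose_carrier_mat A C E F)

lemma transpose_vec_carriers [simp]:
  "x \<in> carrier_vec n \<Longrightarrow> transpose_mat A *\<^sub>v x \<in> carrier_vec n"
  "z \<in> carrier_vec q \<Longrightarrow> transpose_mat C *\<^sub>v z \<in> carrier_vec n"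
  "x \<in> carrier_vec n \<Longrightarrow> transpose_mat E *\<^sub>v x \<in> carrier_vec p"
  "z \<in> carrier_vec q \<Longrightarrow> transpose_mat F *\<^sub>v z \<in> carrier_vec p"
  using transpose_carriers mult_mat_vec_carrier by blast+

lemma dual_carriers [simp]:
  assumes "\<xi> \<in> carrier_vec n" "\<zeta> \<in> carrier_vec q"
  shows "dual_step \<xi> \<zeta> \<in> carrier_vec n" "dual_out \<xi> \<zeta> \<in> carrier_vec p"
  using assms by (simp_all add: dual_step_def dual_out_def)

lemma adjoint_pairing:
  assumes "x \<in> carrier_vec n" "w \<in> carrier_vec p" "\<xi> \<in> carrier_vec n" "\<zeta> \<in> carrier_vec q"
  shows "\<xi> \<bullet> step x w + \<zeta> \<bullet> out x w = dual_step \<xi> \<zeta> \<bullet> x + dual_out \<xi> \<zeta> \<bullet> w"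
  using assms transpose_vec_mult_scalar[OF A assms(1,3)] transpose_vec_mult_scalar[OF E assms(2,3)]
    transpose_vec_mult_scalar[OF C assms(1,4)] transpose_vec_mult_scalar[OF F assms(2,4)]
  unfolding step_def out_def dual_step_def dual_out_def
  by (simp add: scalar_prod_add_distrib[of _ n] scalar_prod_add_distrib[of _ q]
      add_scalar_prod_distrib[of _ n] add_scalar_prod_distrib[of _ p])

lemma dual_lmi_symmetric:
  assumes "S1 \<in> symmetric_mats n" "S2 \<in> symmetric_mats n"
  shows "dual_lmi p q A E C F \<gamma> S1 S2 \<in> symmetric_mats (n + p + q)"
proof -
  have S1: "S1 \<in> carrier_mat n n" using assms symmetric_carrier by auto
  have "A * S1 * transpose_mat C \<in> carrier_mat n q"
    by (rule mult_carrier_mat[OF mult_carrier_mat[OF A S1] transpose_carriers(2)])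
  moreover have "transpose_mat (transpose_mat A) * S1 * transpose_mat A \<in> symmetric_mats n"
    by (rule symmetric_congruence[OF assms(1) transpose_carriers(1)])
  moreover have "transpose_mat (transpose_mat C) * S1 * transpose_mat C \<in> symmetric_mats q"
    by (rule symmetric_congruence[OF assms(1) transpose_carriers(2)])
  ultimately show ?thesis
    unfolding dual_lmi_def sym_block3_def using assms
    by (intro symmetric_sym_block2 carrier_append_rows symmetric_minus symmetric_add symmetric_uminus
        symmetric_smult symmetric_one) (auto simp only: transpose_transpose E transpose_carriers)
qed

lemma quad_dual_lmi:
  assumes S: "S1 \<in> symmetric_mats n" "S2 \<in> symmetric_mats n"
    and \<xi>: "\<xi> \<in> carrier_vec n" and \<omega>: "\<omega> \<in> carrier_vec p" and \<zeta>: "\<zeta> \<in> carrier_vec q"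
  shows "quad (dual_lmi p q A E C F \<gamma> S1 S2) ((\<xi> @\<^sub>v \<omega>) @\<^sub>v \<zeta>)
    = quad S1 (dual_step \<xi> \<zeta>) - quad S2 \<xi> - \<zeta> \<bullet> \<zeta> + 2 * (\<omega> \<bullet> dual_out \<xi> \<zeta>) - \<gamma>\<^sup>2 * (\<omega> \<bullet> \<omega>)"
proof -
  have c: "S1 \<in> carrier_mat n n" "S2 \<in> carrier_mat n n" using S symmetric_carrier by auto
  have m [simp]: "A * S1 * transpose_mat A \<in> carrier_mat n n" "A * S1 * transpose_mat C \<in> carrier_mat n q"
    "C * S1 * transpose_mat C \<in> carrier_mat q q"
    by (rule mult_carrier_mat[OF mult_carrier_mat[OF A c(1)] transpose_carriers(1)]
        mult_carrier_mat[OF mult_carrier_mat[OF A c(1)] transpose_carriers(2)]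
        mult_carrier_mat[OF mult_carrier_mat[OF C c(1)] transpose_carriers(2)])+
  have e11: "quad (A * S1 * transpose_mat A - S2) \<xi> = quad S1 (transpose_mat A *\<^sub>v \<xi>) - quad S2 \<xi>"
    using \<xi> c bilinear_congruence[OF transpose_carriers(1) c(1) transpose_carriers(1) \<xi> \<xi>]
    by (simp add: quad_minus[of _ n]) (simp add: quad_def)
  have e33: "quad (- 1\<^sub>m q + C * S1 * transpose_mat C) \<zeta> = - (\<zeta> \<bullet> \<zeta>) + quad S1 (transpose_mat C *\<^sub>v \<zeta>)"
    using \<zeta> c bilinear_congruence[OF transpose_carriers(2) c(1) transpose_carriers(2) \<zeta> \<zeta>]
    by (simp add: quad_add[of _ q] quad_uminus[of _ q] quad_one) (simp add: quad_def)
  have e13: "\<xi> \<bullet> ((A * S1 * transpose_mat C) *\<^sub>v \<zeta>)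
    = (transpose_mat A *\<^sub>v \<xi>) \<bullet> (S1 *\<^sub>v (transpose_mat C *\<^sub>v \<zeta>))"
    using bilinear_congruence[OF transpose_carriers(1) c(1) transpose_carriers(2) \<xi> \<zeta>] by simp
  have e2: "\<omega> \<bullet> (transpose_mat F *\<^sub>v \<zeta>) + \<xi> \<bullet> (E *\<^sub>v \<omega>) = \<omega> \<bullet> dual_out \<xi> \<zeta>"
    using \<xi> \<omega> \<zeta> transpose_vec_mult_scalar[OF E \<omega> \<xi>] comm_scalar_prod[of \<omega> p "transpose_mat E *\<^sub>v \<xi>"]
    by (simp add: dual_out_def scalar_prod_add_distrib[of _ p])
  have e22: "quad (- (\<gamma>\<^sup>2 \<cdot>\<^sub>m 1\<^sub>m p)) \<omega> = - \<gamma>\<^sup>2 * (\<omega> \<bullet> \<omega>)"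
    using \<omega> by (simp add: quad_uminus[of _ p] quad_smult[of _ p] quad_one)
  have B: "sym_block2 (A * S1 * transpose_mat A - S2) E (- (\<gamma>\<^sup>2 \<cdot>\<^sub>m 1\<^sub>m p)) \<in> carrier_mat (n + p) (n + p)"
    unfolding sym_block2_def using c by (intro four_block_carrier_mat) auto
  have "quad (dual_lmi p q A E C F \<gamma> S1 S2) ((\<xi> @\<^sub>v \<omega>) @\<^sub>v \<zeta>)
    = quad (sym_block2 (A * S1 * transpose_mat A - S2) E (- (\<gamma>\<^sup>2 \<cdot>\<^sub>m 1\<^sub>m p))) (\<xi> @\<^sub>v \<omega>)
      + 2 * ((\<xi> @\<^sub>v \<omega>) \<bullet> (((A * S1 * transpose_mat C) @\<^sub>r transpose_mat F) *\<^sub>v \<zeta>))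
      + quad (- 1\<^sub>m q + C * S1 * transpose_mat C) \<zeta>"
    unfolding dual_lmi_def sym_block3_def using B \<xi> \<omega> \<zeta>
    by (intro quad_sym_block2[of _ "n + p" _ q]) auto
  also have "((A * S1 * transpose_mat C) @\<^sub>r transpose_mat F) *\<^sub>v \<zeta>
      = ((A * S1 * transpose_mat C) *\<^sub>v \<zeta>) @\<^sub>v (transpose_mat F *\<^sub>v \<zeta>)"
    by (rule mat_mult_append[OF m(2) transpose_carriers(4) \<zeta>])
  also have "(\<xi> @\<^sub>v \<omega>) \<bullet> \<dots> = \<xi> \<bullet> ((A * S1 * transpose_mat C) *\<^sub>v \<zeta>) + \<omega> \<bullet> (transpose_mat F *\<^sub>v \<zeta>)"
    using \<xi> \<omega> \<zeta> mult_mat_vec_carrier[OF m(2) \<zeta>] by (intro scalar_prod_append) auto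
  also have "quad (sym_block2 (A * S1 * transpose_mat A - S2) E (- (\<gamma>\<^sup>2 \<cdot>\<^sub>m 1\<^sub>m p))) (\<xi> @\<^sub>v \<omega>)
      = quad (A * S1 * transpose_mat A - S2) \<xi> + 2 * (\<xi> \<bullet> (E *\<^sub>v \<omega>)) + quad (- (\<gamma>\<^sup>2 \<cdot>\<^sub>m 1\<^sub>m p)) \<omega>"
    using \<xi> \<omega> c by (intro quad_sym_block2) auto
  finally show ?thesis
    unfolding e11 e13 e22 e33 dual_step_def e2[symmetric] using S \<xi> \<zeta> by (simp add: quad_plus[of _ n])
qed

lemma dual_lmi_less_iff:
  assumes "\<gamma> > 0" "S1 \<in> symmetric_mats n" "S2 \<in> symmetric_mats n"
  shows "dual_lmi p q A E C F \<gamma> S1 S2 \<prec>\<^bsub>n + p + q\<^esub> 0\<^sub>m (n + p + q) (n + p + q) \<longleftrightarrow>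
    (\<forall>\<xi>\<in>carrier_vec n. \<forall>\<zeta>\<in>carrier_vec q. \<xi> \<noteq> 0\<^sub>v n \<or> \<zeta> \<noteq> 0\<^sub>v q \<longrightarrow>
       quad S1 (dual_step \<xi> \<zeta>) + (dual_out \<xi> \<zeta> \<bullet> dual_out \<xi> \<zeta>) / \<gamma>\<^sup>2 < quad S2 \<xi> + \<zeta> \<bullet> \<zeta>)"
    (is "?L \<longleftrightarrow> ?R")
proof -
  let ?q = "\<lambda>\<xi> \<omega> \<zeta>. quad S1 (dual_step \<xi> \<zeta>) - quad S2 \<xi> - \<zeta> \<bullet> \<zeta> + 2 * (\<omega> \<bullet> dual_out \<xi> \<zeta>) - \<gamma>\<^sup>2 * (\<omega> \<bullet> \<omega>)"
  have L: "?L \<longleftrightarrow> (\<forall>\<xi>\<in>carrier_vec n. \<forall>\<omega>\<in>carrier_vec p. \<forall>\<zeta>\<in>carrier_vec q.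
      \<xi> \<noteq> 0\<^sub>v n \<or> \<omega> \<noteq> 0\<^sub>v p \<or> \<zeta> \<noteq> 0\<^sub>v q \<longrightarrow> ?q \<xi> \<omega> \<zeta> < 0)"
    unfolding loewner_less_zero_iff[OF dual_lmi_symmetric[OF assms(2,3)]] all_vec_append
    using assms by (auto simp: quad_dual_lmi append_vec_eq_zero_iff)
  show ?thesis
    unfolding L
  proof (intro iffI ballI impI)
    fix \<xi> \<zeta> :: "real vec"
    assume *: "\<forall>\<xi>\<in>carrier_vec n. \<forall>\<omega>\<in>carrier_vec p. \<forall>\<zeta>\<in>carrier_vec q.
      \<xi> \<noteq> 0\<^sub>v n \<or> \<omega> \<noteq> 0\<^sub>v p \<or> \<zeta> \<noteq> 0\<^sub>v q \<longrightarrow> ?q \<xi> \<omega> \<zeta> < 0"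
      and v: "\<xi> \<in> carrier_vec n" "\<zeta> \<in> carrier_vec q" "\<xi> \<noteq> 0\<^sub>v n \<or> \<zeta> \<noteq> 0\<^sub>v q"
    let ?y = "dual_out \<xi> \<zeta>"
    have y: "?y \<in> carrier_vec p" using v by simp
    define \<omega> where "\<omega> = (1 / \<gamma>\<^sup>2) \<cdot>\<^sub>v ?y"
    have "?q \<xi> \<omega> \<zeta> < 0" using *[rule_format, of \<xi> \<omega> \<zeta>] v y by (auto simp: \<omega>_def)
    moreover note inner_max_attained[OF assms(1) y \<omega>_def]
    ultimately show "quad S1 (dual_step \<xi> \<zeta>) + (?y \<bullet> ?y) / \<gamma>\<^sup>2 < quad S2 \<xi> + \<zeta> \<bullet> \<zeta>" by linarith
  next
    fix \<xi> \<omega> \<zeta> :: "real vec"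
    assume R: ?R and v: "\<xi> \<in> carrier_vec n" "\<omega> \<in> carrier_vec p" "\<zeta> \<in> carrier_vec q"
      "\<xi> \<noteq> 0\<^sub>v n \<or> \<omega> \<noteq> 0\<^sub>v p \<or> \<zeta> \<noteq> 0\<^sub>v q"
    show "?q \<xi> \<omega> \<zeta> < 0"
    proof (cases "\<xi> = 0\<^sub>v n \<and> \<zeta> = 0\<^sub>v q")
      case True
      then have "\<omega> \<noteq> 0\<^sub>v p" "dual_step \<xi> \<zeta> = 0\<^sub>v n" "dual_out \<xi> \<zeta> = 0\<^sub>v p"
        using v mult_mat_vec_zero[OF transpose_carriers(1)] mult_mat_vec_zero[OF transpose_carriers(2)]
          mult_mat_vec_zero[OF transpose_carriers(3)] mult_mat_vec_zero[OF transpose_carriers(4)]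
        by (auto simp: dual_step_def dual_out_def)
      moreover have "0 < \<gamma>\<^sup>2 * (\<omega> \<bullet> \<omega>)" using sqnorm_pos[OF v(2)] \<open>\<omega> \<noteq> 0\<^sub>v p\<close> assms(1) by simp
      ultimately show ?thesis
        using True v quad_zero_vec[OF symmetric_carrier[OF assms(2)]] quad_zero_vec[OF symmetric_carrier[OF assms(3)]]
        by simp
    next
      case False
      then have "quad S1 (dual_step \<xi> \<zeta>) + (dual_out \<xi> \<zeta> \<bullet> dual_out \<xi> \<zeta>) / \<gamma>\<^sup>2 < quad S2 \<xi> + \<zeta> \<bullet> \<zeta>"
        using R v by auto
      then show ?thesis
        using inner_max[OF assms(1) v(2), of "dual_out \<xi> \<zeta>"] v by simp
    qed
  qed
qed

lemma dual_lmi_le_iff: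
  assumes "\<gamma> > 0" "S1 \<in> symmetric_mats n" "S2 \<in> symmetric_mats n"
  shows "dual_lmi p q A E C F \<gamma> S1 S2 \<preceq>\<^bsub>n + p + q\<^esub> 0\<^sub>m (n + p + q) (n + p + q) \<longleftrightarrow> dual_dissipative \<gamma> S1 S2"
    (is "?L \<longleftrightarrow> ?R")
proof -
  let ?q = "\<lambda>\<xi> \<omega> \<zeta>. quad S1 (dual_step \<xi> \<zeta>) - quad S2 \<xi> - \<zeta> \<bullet> \<zeta> + 2 * (\<omega> \<bullet> dual_out \<xi> \<zeta>) - \<gamma>\<^sup>2 * (\<omega> \<bullet> \<omega>)"
  have L: "?L \<longleftrightarrow> (\<forall>\<xi>\<in>carrier_vec n. \<forall>\<omega>\<in>carrier_vec p. \<forall>\<zeta>\<in>carrier_vec q. ?q \<xi> \<omega> \<zeta> \<le> 0)"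
    unfolding loewner_le_zero_iff[OF dual_lmi_symmetric[OF assms(2,3)]] all_vec_append
    using assms by (auto simp: quad_dual_lmi)
  show ?thesis
    unfolding L dual_dissipative_def
  proof (intro iffI ballI impI)
    fix \<xi> \<zeta> :: "real vec"
    assume *: "\<forall>\<xi>\<in>carrier_vec n. \<forall>\<omega>\<in>carrier_vec p. \<forall>\<zeta>\<in>carrier_vec q. ?q \<xi> \<omega> \<zeta> \<le> 0"
      and v: "\<xi> \<in> carrier_vec n" "\<zeta> \<in> carrier_vec q"
    let ?y = "dual_out \<xi> \<zeta>"
    have y: "?y \<in> carrier_vec p" using v by simp
    define \<omega> where "\<omega> = (1 / \<gamma>\<^sup>2) \<cdot>\<^sub>v ?y"
    have "?q \<xi> \<omega> \<zeta> \<le> 0" using *[rule_format, of \<xi> \<omega> \<zeta>] v y by (auto simp: \<omega>_def)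
    moreover note inner_max_attained[OF assms(1) y \<omega>_def]
    ultimately show "quad S1 (dual_step \<xi> \<zeta>) + (?y \<bullet> ?y) / \<gamma>\<^sup>2 \<le> quad S2 \<xi> + \<zeta> \<bullet> \<zeta>" by linarith
  next
    fix \<xi> \<omega> \<zeta> :: "real vec"
    assume R: "\<forall>\<xi>\<in>carrier_vec n. \<forall>\<zeta>\<in>carrier_vec q.
        quad S1 (dual_step \<xi> \<zeta>) + (dual_out \<xi> \<zeta> \<bullet> dual_out \<xi> \<zeta>) / \<gamma>\<^sup>2 \<le> quad S2 \<xi> + \<zeta> \<bullet> \<zeta>"
      and v: "\<xi> \<in> carrier_vec n" "\<omega> \<in> carrier_vec p" "\<zeta> \<in> carrier_vec q"
    then have "quad S1 (dual_step \<xi> \<zeta>) + (dual_out \<xi> \<zeta> \<bullet> dual_out \<xi> \<zeta>) / \<gamma>\<^sup>2 \<le> quad S2 \<xi> + \<zeta> \<bullet> \<zeta>"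
      by auto
    then show "?q \<xi> \<omega> \<zeta> \<le> 0"
      using inner_max[OF assms(1) v(2), of "dual_out \<xi> \<zeta>"] v by simp
  qed
qed

text \<open>
  Let \<open>\<eta>\<close>, \<open>\<omega>\<close> be the next state and the output of the adjoint system at \<open>(\<xi>, \<zeta>)\<close>, and \<open>J\<close> the left-hand side of
  the dual inequality. The system is driven from \<open>x = S2 \<eta>\<close> with \<open>w = \<omega> / \<gamma>\<^sup>2\<close>, for which the pairing equals \<open>J\<close> and
  the primal right-hand side \<open>x \<bullet> R2 x + \<gamma>\<^sup>2 |w|\<^sup>2\<close> equals \<open>J\<close> as well. Fenchel--Young on the other side of
  the pairing and primal dissipation then give \<open>2 J \<le> \<xi> \<bullet> S1 \<xi> + |\<zeta>|\<^sup>2 + J\<close>.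
\<close>

lemma dual_of_primal:
  assumes "\<gamma> > 0" and R1: "pos_def n R1" and R2: "pos_def n R2"
    and S1: "pos_def n S1" "R1 * S1 = 1\<^sub>m n" and S2: "pos_def n S2" "R2 * S2 = 1\<^sub>m n"
    and diss: "dissipative \<gamma> R1 R2"
    and \<xi>: "\<xi> \<in> carrier_vec n" and \<zeta>: "\<zeta> \<in> carrier_vec q"
  shows "quad S2 (dual_step \<xi> \<zeta>) + (dual_out \<xi> \<zeta> \<bullet> dual_out \<xi> \<zeta>) / \<gamma>\<^sup>2 \<le> quad S1 \<xi> + \<zeta> \<bullet> \<zeta>"
    and "\<lbrakk>\<xi> \<noteq> 0\<^sub>v n \<or> \<zeta> \<noteq> 0\<^sub>v q; \<And>x w. \<lbrakk>x \<in> carrier_vec n; w \<in> carrier_vec p; x \<noteq> 0\<^sub>v n \<or> w \<noteq> 0\<^sub>v p\<rbrakk> \<Longrightarrow>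
        quad R1 (step x w) + excess \<gamma> x w < quad R2 x\<rbrakk> \<Longrightarrow>
      quad S2 (dual_step \<xi> \<zeta>) + (dual_out \<xi> \<zeta> \<bullet> dual_out \<xi> \<zeta>) / \<gamma>\<^sup>2 < quad S1 \<xi> + \<zeta> \<bullet> \<zeta>"
proof -
  define \<eta> where "\<eta> = dual_step \<xi> \<zeta>"
  define \<omega> where "\<omega> = dual_out \<xi> \<zeta>"
  define x where "x = S2 *\<^sub>v \<eta>"
  define w where "w = (1 / \<gamma>\<^sup>2) \<cdot>\<^sub>v \<omega>"
  have c: "\<eta> \<in> carrier_vec n" "\<omega> \<in> carrier_vec p" using \<xi> \<zeta> by (auto simp: \<eta>_def \<omega>_def)
  then have c': "x \<in> carrier_vec n" "w \<in> carrier_vec p"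
    using pos_def_carrier[OF S2(1)] by (auto simp: x_def w_def)
  define J where "J = quad S2 \<eta> + (\<omega> \<bullet> \<omega>) / \<gamma>\<^sup>2"
  have \<eta>x: "\<eta> \<bullet> x = quad S2 \<eta>" by (simp add: x_def quad_def)
  have \<omega>w: "\<omega> \<bullet> w = (\<omega> \<bullet> \<omega>) / \<gamma>\<^sup>2" using c by (simp add: w_def)
  have ww: "\<gamma>\<^sup>2 * (w \<bullet> w) = (\<omega> \<bullet> \<omega>) / \<gamma>\<^sup>2"
    using c \<open>\<gamma> > 0\<close> by (simp add: w_def field_simps power2_eq_square)
  have R2x: "quad R2 x = quad S2 \<eta>"
    unfolding x_def by (rule quad_inverse_image[OF pos_def_carrier[OF R2] pos_def_carrier[OF S2(1)] S2(2) c(1)])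
  have RJ: "quad R2 x + \<gamma>\<^sup>2 * (w \<bullet> w) = J" by (simp add: R2x ww J_def)
  have "\<xi> \<bullet> step x w + \<zeta> \<bullet> out x w = J"
    using adjoint_pairing[OF c' \<xi> \<zeta>] by (simp add: \<eta>_def[symmetric] \<omega>_def[symmetric] \<eta>x \<omega>w J_def)
  moreover have "2 * (\<xi> \<bullet> step x w) \<le> quad S1 \<xi> + quad R1 (step x w)"
    using inner_le_quad_inverse[OF R1 pos_def_symmetric[OF S1(1)] S1(2) step_carrier[OF c'] \<xi>]
      comm_scalar_prod[OF \<xi> step_carrier[OF c']] by simp
  moreover have "2 * (\<zeta> \<bullet> out x w) \<le> \<zeta> \<bullet> \<zeta> + out x w \<bullet> out x w"
    using inner_max[of 1, OF _ \<zeta> out_carrier[OF c']] by simp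
  ultimately have key: "2 * J \<le> (quad S1 \<xi> + \<zeta> \<bullet> \<zeta>) + (quad R1 (step x w) + excess \<gamma> x w) + \<gamma>\<^sup>2 * (w \<bullet> w)"
    by (simp add: excess_def)
  have "quad R1 (step x w) + excess \<gamma> x w \<le> quad R2 x"
    using diss c' by (auto simp: dissipative_def)
  then show "quad S2 (dual_step \<xi> \<zeta>) + (dual_out \<xi> \<zeta> \<bullet> dual_out \<xi> \<zeta>) / \<gamma>\<^sup>2 \<le> quad S1 \<xi> + \<zeta> \<bullet> \<zeta>"
    using key RJ unfolding \<eta>_def[symmetric] \<omega>_def[symmetric] J_def[symmetric] by linarith
  show "quad S2 (dual_step \<xi> \<zeta>) + (dual_out \<xi> \<zeta> \<bullet> dual_out \<xi> \<zeta>) / \<gamma>\<^sup>2 < quad S1 \<xi> + \<zeta> \<bullet> \<zeta>"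
    if nz: "\<xi> \<noteq> 0\<^sub>v n \<or> \<zeta> \<noteq> 0\<^sub>v q"
    and strict: "\<And>x w. \<lbrakk>x \<in> carrier_vec n; w \<in> carrier_vec p; x \<noteq> 0\<^sub>v n \<or> w \<noteq> 0\<^sub>v p\<rbrakk> \<Longrightarrow>
        quad R1 (step x w) + excess \<gamma> x w < quad R2 x"
  proof (cases "x = 0\<^sub>v n \<and> w = 0\<^sub>v p")
    case True
    then have "J = 0" using \<eta>x \<omega>w c by (simp add: J_def)
    moreover have "0 < quad S1 \<xi> + \<zeta> \<bullet> \<zeta>"
      using nz pos_def_quad_pos[OF S1(1) \<xi>] pos_def_quad_nonneg[OF S1(1) \<xi>] sqnorm_pos[OF \<zeta>] sqnorm_ge_0[of \<zeta>]
      by (auto intro: add_pos_nonneg add_nonneg_pos)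
    ultimately show ?thesis unfolding \<eta>_def[symmetric] \<omega>_def[symmetric] J_def by simp
  next
    case False
    then show ?thesis
      using strict[OF c'] key RJ unfolding \<eta>_def[symmetric] \<omega>_def[symmetric] J_def[symmetric] by auto
  qed
qed

text \<open>
  The same argument with the roles of the system and its adjoint exchanged: the adjoint system is driven
  by \<open>P y\<close> and \<open>z\<close>.
\<close>

lemma primal_of_dual_less:
  assumes "\<gamma> > 0" and P: "pos_def n P" and S: "pos_def n S" "S * P = 1\<^sub>m n"
    and strict: "dual_lmi p q A E C F \<gamma> S S \<prec>\<^bsub>n + p + q\<^esub> 0\<^sub>m (n + p + q) (n + p + q)"
  shows "primal_lmi p A E C F \<gamma> P P \<prec>\<^bsub>n + p\<^esub> 0\<^sub>m (n + p) (n + p)"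
  unfolding primal_lmi_less_iff[OF pos_def_symmetric[OF P] pos_def_symmetric[OF P]]
proof (intro ballI impI)
  fix x w :: "real vec"
  assume x: "x \<in> carrier_vec n" and w: "w \<in> carrier_vec p" and nz: "x \<noteq> 0\<^sub>v n \<or> w \<noteq> 0\<^sub>v p"
  define y where "y = step x w"
  define z where "z = out x w"
  define \<eta> where "\<eta> = P *\<^sub>v y"
  define \<xi> where "\<xi> = dual_step \<eta> z"
  define \<omega> where "\<omega> = dual_out \<eta> z"
  have c: "y \<in> carrier_vec n" "z \<in> carrier_vec q" "\<eta> \<in> carrier_vec n"
    using x w pos_def_carrier[OF P] by (auto simp: y_def z_def \<eta>_def)
  then have c': "\<xi> \<in> carrier_vec n" "\<omega> \<in> carrier_vec p" by (auto simp: \<xi>_def \<omega>_def)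
  have \<eta>y: "\<eta> \<bullet> y = quad P y"
    unfolding \<eta>_def quad_def using c pos_def_carrier[OF P] by (intro comm_scalar_prod[of _ n]) auto
  have pos: "0 < quad P x + \<gamma>\<^sup>2 * (w \<bullet> w)"
    using nz pos_def_quad_pos[OF P x] pos_def_quad_nonneg[OF P x] sqnorm_pos[OF w] sqnorm_ge_0[of w] \<open>\<gamma> > 0\<close>
    by (auto intro: add_pos_nonneg add_nonneg_pos)
  have "quad P y + z \<bullet> z < quad P x + \<gamma>\<^sup>2 * (w \<bullet> w)"
  proof (cases "\<eta> = 0\<^sub>v n \<and> z = 0\<^sub>v q")
    case True
    then show ?thesis using \<eta>y pos c by auto
  next
    case False
    then have "quad S \<xi> + (\<omega> \<bullet> \<omega>) / \<gamma>\<^sup>2 < quad S \<eta> + z \<bullet> z"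
      using strict c unfolding dual_lmi_less_iff[OF assms(1) pos_def_symmetric[OF S(1)] pos_def_symmetric[OF S(1)]]
      by (auto simp: \<xi>_def \<omega>_def)
    moreover have "quad S \<eta> = quad P y"
      unfolding \<eta>_def by (rule quad_inverse_image[OF pos_def_carrier[OF S(1)] pos_def_carrier[OF P] S(2) c(1)])
    moreover have "2 * (\<xi> \<bullet> x) \<le> quad S \<xi> + quad P x"
      by (rule inner_le_quad_inverse[OF S(1) pos_def_symmetric[OF P] S(2) c'(1) x])
    moreover have "2 * (\<omega> \<bullet> w) \<le> (\<omega> \<bullet> \<omega>) / \<gamma>\<^sup>2 + \<gamma>\<^sup>2 * (w \<bullet> w)"
      using inner_max[OF \<open>\<gamma> > 0\<close> w c'(2)] comm_scalar_prod[OF w c'(2)] by simp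
    moreover have "\<eta> \<bullet> y + z \<bullet> z = \<xi> \<bullet> x + \<omega> \<bullet> w"
      using adjoint_pairing[OF x w c(3) c(2)] by (simp add: \<xi>_def \<omega>_def y_def z_def)
    ultimately show ?thesis using \<eta>y by linarith
  qed
  then show "quad P (step x w) + excess \<gamma> x w < quad P x" by (simp add: y_def z_def excess_def)
qed

text \<open>
  The argument on \<open>T\<close> steps. The adjoint trajectory starts at time \<open>T\<close> from \<open>P x(T)\<close>, runs backwards with
  input \<open>z\<close>, and the pairing telescopes. Besides \<open>S T\<close>, whose inverse is \<open>P\<close>, no \<open>S k\<close> is inverted: at time \<open>0\<close>
  the smaller \<open>Q'\<close> takes the place of \<open>S 0\<close>. With \<open>J\<close> the storage at time \<open>T\<close> plus the output energy and \<open>W\<close> the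
  input energy, one gets \<open>2 J < J + V\<^sub>Q (x 0) + \<gamma>\<^sup>2 W\<close>.
\<close>

lemma dual_chain_less:
  assumes "\<gamma> > 0"
    and P: "pos_def n P" and S0: "S 0 \<in> symmetric_mats n" and inv: "S T * P = 1\<^sub>m n" "S T \<in> carrier_mat n n"
    and Q: "pos_def n Q" and Q': "pos_def n Q'" "Q' * Q = 1\<^sub>m n"
    and less: "\<And>\<xi>. \<lbrakk>\<xi> \<in> carrier_vec n; \<xi> \<noteq> 0\<^sub>v n\<rbrakk> \<Longrightarrow> quad Q' \<xi> < quad (S 0) \<xi>"
    and chain: "\<And>k. k < T \<Longrightarrow> dual_dissipative \<gamma> (S k) (S (Suc k))"
    and t: "trajectory T x w" and x0: "x 0 \<noteq> 0\<^sub>v n"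
  shows "quad P (x T) + (\<Sum>k<T. excess \<gamma> (x k) (w k)) < quad Q (x 0)"
proof -
  define z where "z k = out (x k) (w k)" for k
  (* f m is the adjoint state m steps before time T *)
  define f where "f = rec_nat (P *\<^sub>v x T) (\<lambda>m \<xi>. dual_step \<xi> (z (T - Suc m)))"
  define \<xi> where "\<xi> k = f (T - k)" for k
  define \<omega> where "\<omega> k = dual_out (\<xi> (Suc k)) (z k)" for k
  define J where "J = quad P (x T) + (\<Sum>k<T. z k \<bullet> z k)"
  have z: "z k \<in> carrier_vec q" if "k < T" for k
    unfolding z_def using that trajectoryD[OF t] by (intro out_carrier) auto
  have xT: "x T \<in> carrier_vec n" and x0': "x 0 \<in> carrier_vec n" using trajectoryD[OF t] by auto
  have \<xi>_T: "\<xi> T = P *\<^sub>v x T" by (simp add: \<xi>_def f_def)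
  have \<xi>_step: "\<xi> k = dual_step (\<xi> (Suc k)) (z k)" if "k < T" for k
  proof -
    have "T - k = Suc (T - Suc k)" "T - Suc (T - Suc k) = k" using that by auto
    then show ?thesis by (simp add: \<xi>_def f_def)
  qed
  have \<xi>_carrier: "\<xi> k \<in> carrier_vec n" if "k \<le> T" for k
    using that
  proof (induction rule: inc_induct)
    case base
    then show ?case using \<xi>_T mult_mat_vec_carrier[OF pos_def_carrier[OF P] xT] by simp
  next
    case (step k)
    then show ?case using \<xi>_step[of k] z[of k] by simp
  qed
  have \<omega>: "\<omega> k \<in> carrier_vec p" if "k < T" for k
    unfolding \<omega>_def using that \<xi>_carrier[of "Suc k"] z[of k] by simp
  have pairing: "\<xi> (Suc k) \<bullet> x (Suc k) + z k \<bullet> z k = \<xi> k \<bullet> x k + \<omega> k \<bullet> w k" if k: "k < T" for k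
    using adjoint_pairing[of "x k" "w k" "\<xi> (Suc k)" "z k"] trajectoryD[OF t] k \<xi>_carrier[of "Suc k"] z[OF k]
    by (simp add: \<xi>_step[OF k, symmetric] \<omega>_def) (simp add: z_def)
  have "\<xi> T \<bullet> x T + (\<Sum>k<T. z k \<bullet> z k - \<omega> k \<bullet> w k) \<le> \<xi> 0 \<bullet> x 0"
  proof (rule telescope_le[of T "\<lambda>k. \<xi> k \<bullet> x k"])
    fix k assume "k < T"
    from pairing[OF this] show "\<xi> (Suc k) \<bullet> x (Suc k) + (z k \<bullet> z k - \<omega> k \<bullet> w k) \<le> \<xi> k \<bullet> x k" by simp
  qed
  moreover have "\<xi> T \<bullet> x T = quad P (x T)"
    unfolding \<xi>_T quad_def using xT pos_def_carrier[OF P] by (intro comm_scalar_prod[of _ n]) auto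
  ultimately have J: "J \<le> \<xi> 0 \<bullet> x 0 + (\<Sum>k<T. \<omega> k \<bullet> w k)" by (simp add: J_def sum_subtractf)
  have "- quad (S T) (\<xi> T) + (\<Sum>k<T. (\<omega> k \<bullet> \<omega> k) / \<gamma>\<^sup>2 - z k \<bullet> z k) \<le> - quad (S 0) (\<xi> 0)"
  proof (intro telescope_le[of T "\<lambda>k. - quad (S k) (\<xi> k)"])
    fix k assume k: "k < T"
    then have "quad (S k) (dual_step (\<xi> (Suc k)) (z k)) + (\<omega> k \<bullet> \<omega> k) / \<gamma>\<^sup>2 \<le> quad (S (Suc k)) (\<xi> (Suc k)) + z k \<bullet> z k"
      using chain[OF k] \<xi>_carrier[of "Suc k"] z[OF k] unfolding dual_dissipative_def \<omega>_def by auto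
    then show "- quad (S (Suc k)) (\<xi> (Suc k)) + (\<omega> k \<bullet> \<omega> k / \<gamma>\<^sup>2 - z k \<bullet> z k) \<le> - quad (S k) (\<xi> k)"
      using \<xi>_step[OF k] by simp
  qed
  moreover have "quad (S T) (\<xi> T) = quad P (x T)"
    unfolding \<xi>_T by (rule quad_inverse_image[OF inv(2) pos_def_carrier[OF P] inv(1) xT])
  ultimately have dual: "quad (S 0) (\<xi> 0) + (\<Sum>k<T. (\<omega> k \<bullet> \<omega> k) / \<gamma>\<^sup>2) \<le> J"
    by (simp add: J_def sum_subtractf)
  have "2 * (\<xi> 0 \<bullet> x 0) < quad (S 0) (\<xi> 0) + quad Q (x 0)"
  proof (cases "\<xi> 0 = 0\<^sub>v n")
    case True
    then show ?thesis
      using pos_def_quad_pos[OF Q x0' x0] quad_zero_vec[OF symmetric_carrier[OF S0]] x0' by simp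
  next
    case False
    then have "quad Q' (\<xi> 0) < quad (S 0) (\<xi> 0)" using less \<xi>_carrier by simp
    then show ?thesis
      using inner_le_quad_inverse[OF Q'(1) pos_def_symmetric[OF Q] Q'(2) \<xi>_carrier[of 0] x0'] by simp
  qed
  moreover have "2 * (\<Sum>k<T. \<omega> k \<bullet> w k) \<le> (\<Sum>k<T. (\<omega> k \<bullet> \<omega> k) / \<gamma>\<^sup>2 + \<gamma>\<^sup>2 * (w k \<bullet> w k))"
    unfolding sum_distrib_left
  proof (intro sum_mono)
    fix k assume k: "k \<in> {..<T}"
    then have "w k \<in> carrier_vec p" "\<omega> k \<in> carrier_vec p" using \<omega> trajectoryD[OF t] by auto
    then show "2 * (\<omega> k \<bullet> w k) \<le> (\<omega> k \<bullet> \<omega> k) / \<gamma>\<^sup>2 + \<gamma>\<^sup>2 * (w k \<bullet> w k)"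
      using inner_max[OF \<open>\<gamma> > 0\<close>, of "w k" p "\<omega> k"] comm_scalar_prod[of "w k" p "\<omega> k"] by simp
  qed
  ultimately have "J < quad Q (x 0) + (\<Sum>k<T. \<gamma>\<^sup>2 * (w k \<bullet> w k))"
    using J dual by (simp add: sum.distrib)
  then show ?thesis by (simp add: J_def excess_def z_def sum_subtractf)
qed

end

section \<open>The Riccati recursion\<close>

context lti_system
begin

text \<open>
  The storage \<open>R\<close> is the maximum over the input of the value after one step, increased by the reward \<open>\<delta> |x|\<^sup>2\<close>.
  The bound \<open>R1 \<le> P\<close> makes the form concave in the input, because it is so for \<open>P\<close>, and it is inherited by \<open>R\<close>,
  because \<open>P\<close> dissipates with a margin that pays for the reward. The reward makes \<open>R\<close> positive definite.
\<close>

lemma riccati_step: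
  assumes "\<delta> > 0" and P: "pos_def n P"
    and margin: "\<And>x w. \<lbrakk>x \<in> carrier_vec n; w \<in> carrier_vec p\<rbrakk> \<Longrightarrow>
      quad P (step x w) + excess \<gamma> x w + \<delta> * (x \<bullet> x + w \<bullet> w) \<le> quad P x"
    and R1: "pos_def n R1" "\<And>x. x \<in> carrier_vec n \<Longrightarrow> quad R1 x \<le> quad P x"
  obtains R K where "pos_def n R" "\<And>x. x \<in> carrier_vec n \<Longrightarrow> quad R x \<le> quad P x" "K \<in> carrier_mat p n"
    "\<And>x w. \<lbrakk>x \<in> carrier_vec n; w \<in> carrier_vec p\<rbrakk> \<Longrightarrow>
       quad R1 (step x w) + excess \<gamma> x w + \<delta> * (x \<bullet> x) \<le> quad R x"
    "\<And>x. x \<in> carrier_vec n \<Longrightarrow>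
       quad R x = quad R1 (step x (K *\<^sub>v x)) + excess \<gamma> x (K *\<^sub>v x) + \<delta> * (x \<bullet> x)"
proof -
  (* with R2 = - \<delta> I the primal matrix has exactly the form to be maximised over the input *)
  let ?D = "- (\<delta> \<cdot>\<^sub>m 1\<^sub>m n)"
  let ?M = "primal_lmi p A E C F \<gamma> R1 ?D"
  let ?M22 = "transpose_mat E * R1 * E + transpose_mat F * F - \<gamma>\<^sup>2 \<cdot>\<^sub>m 1\<^sub>m p"
  have sR1: "R1 \<in> symmetric_mats n" and sD: "?D \<in> symmetric_mats n"
    using pos_def_symmetric[OF R1(1)] by (auto intro!: symmetric_uminus symmetric_smult symmetric_one)
  have M: "quad ?M (x @\<^sub>v w) = quad R1 (step x w) + excess \<gamma> x w + \<delta> * (x \<bullet> x)"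
    if "x \<in> carrier_vec n" "w \<in> carrier_vec p" for x w
    using that by (simp add: quad_primal_lmi[OF sR1 sD] quad_uminus[of _ n] quad_smult[of _ n] quad_one)
  have s11: "transpose_mat A * R1 * A - ?D + transpose_mat C * C \<in> symmetric_mats n"
    by (rule symmetric_add[OF symmetric_minus[OF symmetric_congruence[OF sR1 A] sD] symmetric_gram[OF C]])
  have s22: "?M22 \<in> symmetric_mats p"
    by (rule symmetric_minus[OF symmetric_add[OF symmetric_congruence[OF sR1 E] symmetric_gram[OF F]]
          symmetric_smult[OF symmetric_one]])
  have c12: "transpose_mat A * R1 * E + transpose_mat C * F \<in> carrier_mat n p"
    by (rule add_carrier_mat[OF mult_carrier_mat[OF transpose_carriers(2) F]])
  have neg: "quad ?M22 w < 0" if w: "w \<in> carrier_vec p" "w \<noteq> 0\<^sub>v p" for w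
  proof -
    have "quad ?M (0\<^sub>v n @\<^sub>v w) = quad ?M22 w"
      unfolding primal_lmi_def using w mult_mat_vec_carrier[OF c12 w(1)] quad_zero_vec[OF symmetric_carrier[OF s11]]
      by (subst quad_sym_block2[OF symmetric_carrier[OF s11] c12 symmetric_carrier[OF s22]]) auto
    moreover have "quad ?M (0\<^sub>v n @\<^sub>v w) = quad R1 (step (0\<^sub>v n) w) + excess \<gamma> (0\<^sub>v n) w"
      using w by (subst M) auto
    moreover have "quad R1 (step (0\<^sub>v n) w) \<le> quad P (step (0\<^sub>v n) w)"
      using w by (intro R1(2)) auto
    moreover have "quad P (step (0\<^sub>v n) w) + excess \<gamma> (0\<^sub>v n) w + \<delta> * (w \<bullet> w) \<le> 0"
      using margin[of "0\<^sub>v n" w] w quad_zero_vec[OF pos_def_carrier[OF P]] by simp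
    moreover have "0 < \<delta> * (w \<bullet> w)" using \<open>\<delta> > 0\<close> sqnorm_pos[OF w] by simp
    ultimately show ?thesis by linarith
  qed
  obtain R K where RK: "R \<in> symmetric_mats n" "K \<in> carrier_mat p n"
    "\<And>x w. \<lbrakk>x \<in> carrier_vec n; w \<in> carrier_vec p\<rbrakk> \<Longrightarrow> quad ?M (x @\<^sub>v w) \<le> quad R x"
    "\<And>x. x \<in> carrier_vec n \<Longrightarrow> quad ?M (x @\<^sub>v (K *\<^sub>v x)) = quad R x"
    using complete_square[OF s11 c12 s22 neg] unfolding primal_lmi_def by blast
  have Kx: "K *\<^sub>v x \<in> carrier_vec p" if "x \<in> carrier_vec n" for x
    using that mult_mat_vec_carrier[OF RK(2)] by blast
  have upper: "quad R1 (step x w) + excess \<gamma> x w + \<delta> * (x \<bullet> x) \<le> quad R x"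
    if "x \<in> carrier_vec n" "w \<in> carrier_vec p" for x w
    using RK(3)[OF that] M[OF that] by simp
  have attained: "quad R x = quad R1 (step x (K *\<^sub>v x)) + excess \<gamma> x (K *\<^sub>v x) + \<delta> * (x \<bullet> x)"
    if "x \<in> carrier_vec n" for x
    using RK(4)[OF that] M[OF that Kx[OF that]] by simp
  have "pos_def n R"
  proof (rule pos_defI[OF RK(1)])
    fix x :: "real vec" assume x: "x \<in> carrier_vec n" "x \<noteq> 0\<^sub>v n"
    have "0 \<le> quad R1 (step x (0\<^sub>v p))" using x by (intro pos_def_quad_nonneg[OF R1(1)]) auto
    moreover have "0 \<le> excess \<gamma> x (0\<^sub>v p)" using sqnorm_ge_0 by (simp add: excess_def)
    moreover have "0 < \<delta> * (x \<bullet> x)" using \<open>\<delta> > 0\<close> sqnorm_pos[OF x] by simp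
    ultimately show "0 < quad R x" using upper[OF x(1), of "0\<^sub>v p"] by simp
  qed
  moreover have "quad R x \<le> quad P x" if x: "x \<in> carrier_vec n" for x
  proof -
    have "quad R1 (step x (K *\<^sub>v x)) \<le> quad P (step x (K *\<^sub>v x))" using x Kx by (intro R1(2)) auto
    moreover have "0 \<le> \<delta> * ((K *\<^sub>v x) \<bullet> (K *\<^sub>v x))" using \<open>\<delta> > 0\<close> sqnorm_ge_0 by simp
    ultimately show ?thesis
      using attained[OF x] margin[OF x Kx[OF x]] by (simp add: distrib_left)
  qed
  ultimately show thesis using that RK(2) upper attained by blast
qed

text \<open>
  By induction on the horizon, prepending a step. The last clause records that the value of \<open>R 0\<close> is attained
  by the trajectory under the optimal feedback; this is what allows a lifted inequality to bound it.
\<close>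

lemma riccati_chain:
  assumes "\<delta> > 0" and P: "pos_def n P"
    and margin: "\<And>x w. \<lbrakk>x \<in> carrier_vec n; w \<in> carrier_vec p\<rbrakk> \<Longrightarrow>
      quad P (step x w) + excess \<gamma> x w + \<delta> * (x \<bullet> x + w \<bullet> w) \<le> quad P x"
  shows "\<exists>R. R T = P \<and> (\<forall>k\<le>T. pos_def n (R k)) \<and> (\<forall>k<T. dissipative \<gamma> (R (Suc k)) (R k)) \<and>
    (\<forall>x0\<in>carrier_vec n. quad (R 0) x0 \<le> quad P x0 \<and>
      (\<exists>x w. trajectory T x w \<and> x 0 = x0 \<and>
        quad (R 0) x0 = quad P (x T) + (\<Sum>k<T. excess \<gamma> (x k) (w k) + \<delta> * (x k \<bullet> x k))))"
proof (induction T)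
  case 0
  have "\<exists>x w. trajectory 0 x w \<and> x 0 = x0" if "x0 \<in> carrier_vec n" for x0
    using that by (intro exI[of _ "\<lambda>_. x0"]) (auto simp: trajectory_def)
  then show ?case using P by (intro exI[of _ "\<lambda>_. P"]) fastforce
next
  case (Suc T)
  then obtain R where R: "R T = P" "\<forall>k\<le>T. pos_def n (R k)" "\<forall>k<T. dissipative \<gamma> (R (Suc k)) (R k)"
    and R0: "\<And>x0. x0 \<in> carrier_vec n \<Longrightarrow> quad (R 0) x0 \<le> quad P x0"
    and opt: "\<And>x0. x0 \<in> carrier_vec n \<Longrightarrow> \<exists>x w. trajectory T x w \<and> x 0 = x0 \<and>
        quad (R 0) x0 = quad P (x T) + (\<Sum>k<T. excess \<gamma> (x k) (w k) + \<delta> * (x k \<bullet> x k))"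
    by blast
  have pR0: "pos_def n (R 0)" using R(2) by simp
  obtain S K where S: "pos_def n S" "\<And>x. x \<in> carrier_vec n \<Longrightarrow> quad S x \<le> quad P x" and K: "K \<in> carrier_mat p n"
    and upper: "\<And>x w. \<lbrakk>x \<in> carrier_vec n; w \<in> carrier_vec p\<rbrakk> \<Longrightarrow>
       quad (R 0) (step x w) + excess \<gamma> x w + \<delta> * (x \<bullet> x) \<le> quad S x"
    and attained: "\<And>x. x \<in> carrier_vec n \<Longrightarrow>
       quad S x = quad (R 0) (step x (K *\<^sub>v x)) + excess \<gamma> x (K *\<^sub>v x) + \<delta> * (x \<bullet> x)"
    by (rule riccati_step[OF assms(1) P margin pR0 R0]) blast+
  define R' where "R' = case_nat S R"
  have "dissipative \<gamma> (R 0) S"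
    unfolding dissipative_def
  proof (intro ballI)
    fix x w :: "real vec" assume "x \<in> carrier_vec n" "w \<in> carrier_vec p"
    moreover have "0 \<le> \<delta> * (x \<bullet> x)" using \<open>\<delta> > 0\<close> sqnorm_ge_0[of x] by simp
    ultimately show "quad (R 0) (step x w) + excess \<gamma> x w \<le> quad S x" using upper[of x w] by linarith
  qed
  then have "\<forall>k<Suc T. dissipative \<gamma> (R' (Suc k)) (R' k)"
    using R(3) by (auto simp: R'_def split: nat.split)
  moreover have "\<forall>k\<le>Suc T. pos_def n (R' k)" using R(2) S(1) by (auto simp: R'_def split: nat.split)
  moreover have "\<exists>x w. trajectory (Suc T) x w \<and> x 0 = x0 \<and>
      quad S x0 = quad P (x (Suc T)) + (\<Sum>k<Suc T. excess \<gamma> (x k) (w k) + \<delta> * (x k \<bullet> x k))"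
    if x0: "x0 \<in> carrier_vec n" for x0
  proof -
    have Kx: "K *\<^sub>v x0 \<in> carrier_vec p" by (rule mult_mat_vec_carrier[OF K x0])
    obtain x w where t: "trajectory T x w" "x 0 = step x0 (K *\<^sub>v x0)"
      and val: "quad (R 0) (x 0) = quad P (x T) + (\<Sum>k<T. excess \<gamma> (x k) (w k) + \<delta> * (x k \<bullet> x k))"
      using opt[OF step_carrier[OF x0 Kx]] by metis
    have "trajectory (Suc T) (case_nat x0 x) (case_nat (K *\<^sub>v x0) w)"
      using t x0 Kx by (auto simp: trajectory_def split: nat.split)
    moreover have "quad S x0 = quad P (x T) +
        (\<Sum>k<Suc T. excess \<gamma> (case_nat x0 x k) (case_nat (K *\<^sub>v x0) w k) + \<delta> * (case_nat x0 x k \<bullet> case_nat x0 x k))"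
      using attained[OF x0] val t(2) by (subst sum.lessThan_Suc_shift) simp
    ultimately show ?thesis by (intro exI[of _ "case_nat x0 x"] exI[of _ "case_nat (K *\<^sub>v x0) w"]) simp
  qed
  moreover have "R' (Suc T) = P" "R' 0 = S" using R(1) by (auto simp: R'_def)
  ultimately show ?case using S(2) by (intro exI[of _ R']) auto
qed

end

section \<open>The switched system: equivalence of the three conditions\<close>

text \<open>
  Finitely many positive constants, each of which may be decreased, can be replaced by their minimum.
\<close>

lemma uniform_constant:
  fixes Q :: "'a \<Rightarrow> real \<Rightarrow> bool"
  assumes "finite S" "\<And>s. s \<in> S \<Longrightarrow> \<exists>c>0. Q s c"
    and mono: "\<And>s c c'. \<lbrakk>s \<in> S; Q s c; 0 < c'; c' \<le> c\<rbrakk> \<Longrightarrow> Q s c'"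
  shows "\<exists>c>0. \<forall>s\<in>S. Q s c"
proof -
  obtain f where f: "\<forall>s\<in>S. 0 < f s \<and> Q s (f s)" using assms(2) by metis
  define c where "c = Min (insert 1 (f ` S))"
  have "0 < c" using \<open>finite S\<close> f by (auto simp: c_def)
  moreover have "c \<le> f s" if "s \<in> S" for s using that \<open>finite S\<close> by (auto simp: c_def)
  ultimately show ?thesis using f mono by blast
qed

lemma ball_atMost_iff: "(\<forall>k\<in>{0..T::nat}. Q k) \<longleftrightarrow> (\<forall>k\<le>T. Q k)"
  by auto

locale switched_system =
  fixes N \<tau> n :: nat and p q :: "nat \<Rightarrow> nat" and A E C F :: "nat \<Rightarrow> real mat"
  assumes N: "N \<ge> 2" and \<tau>: "\<tau> \<ge> 1"
    and modes: "i \<in> {1..N} \<Longrightarrow> lti_system n (p i) (q i) (A i) (E i) (C i) (F i)"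
begin

abbreviation "step i \<equiv> lti_system.step (A i) (E i)"

abbreviation "excess \<gamma> i \<equiv> lti_system.excess (C i) (F i) \<gamma>"

abbreviation "trajectory i \<equiv> lti_system.trajectory n (p i) (A i) (E i)"

abbreviation "dissipative \<gamma> i \<equiv> lti_system.dissipative n (p i) (A i) (E i) (C i) (F i) \<gamma>"

abbreviation "lifted_lmi \<gamma> i \<equiv> lti_system.lifted_lmi n (p i) (q i) (A i) (E i) (C i) (F i) \<tau> \<gamma>"

abbreviation bounded_real :: "real \<Rightarrow> nat \<Rightarrow> real mat \<Rightarrow> bool" where
  "bounded_real \<gamma> i P \<equiv>
     primal_lmi (p i) (A i) (E i) (C i) (F i) \<gamma> P P \<prec>\<^bsub>n + p i\<^esub> 0\<^sub>m (n + p i) (n + p i)"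

text \<open>
  The conditions are stated for pairs of distinct modes; this makes them say something about each mode.
\<close>

lemma other_mode:
  assumes "i \<in> {1..N}"
  obtains j where "j \<in> {1..N}" "i \<noteq> j"
proof (cases "i = 1")
  case True
  then show ?thesis using that[of 2] N by auto
next
  case False
  then show ?thesis using that[of 1] N by auto
qed

lemma lifted_condition_iff:
  "lifted_condition N \<tau> n p q A E C F \<gamma> \<longleftrightarrow>
    (\<exists>P. (\<forall>i\<in>{1..N}. pos_def n (P i) \<and> bounded_real \<gamma> i (P i)) \<and>
      (\<forall>i\<in>{1..N}. \<forall>j\<in>{1..N}. i \<noteq> j \<longrightarrow>
        lifted_lmi \<gamma> i (P i) (P j) \<prec>\<^bsub>n + \<tau> * p i\<^esub> 0\<^sub>m (n + \<tau> * p i) (n + \<tau> * p i)))"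
proof -
  have l: "(let G = lifted_G n (p i) (q i) (A i) (E i) (C i) (F i) \<tau> in
       sym_block2 (- Q) (0\<^sub>m n (\<tau> * p i)) (- (\<gamma>\<^sup>2 \<cdot>\<^sub>m 1\<^sub>m (\<tau> * p i))) +
       G * sym_block2 P (0\<^sub>m n (\<tau> * q i)) (1\<^sub>m (\<tau> * q i)) * transpose_mat G
         \<prec>\<^bsub>n + \<tau> * p i\<^esub> 0\<^sub>m (n + \<tau> * p i) (n + \<tau> * p i))
    \<longleftrightarrow> lifted_lmi \<gamma> i P Q \<prec>\<^bsub>n + \<tau> * p i\<^esub> 0\<^sub>m (n + \<tau> * p i) (n + \<tau> * p i)"
    if "i \<in> {1..N}" for i P Q
    unfolding lti_system.lifted_lmi_def[OF modes[OF that]] Let_def ..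
  show ?thesis
    unfolding lifted_condition_def
  proof (intro iff_exI)
    fix P
    show "((\<forall>i\<in>{1..N}. pos_def n (P i)) \<and>
        (\<forall>i\<in>{1..N}. \<forall>j\<in>{1..N}. i \<noteq> j \<longrightarrow>
           bounded_real \<gamma> i (P i) \<and>
           (let G = lifted_G n (p i) (q i) (A i) (E i) (C i) (F i) \<tau> in
            sym_block2 (- P j) (0\<^sub>m n (\<tau> * p i)) (- (\<gamma>\<^sup>2 \<cdot>\<^sub>m 1\<^sub>m (\<tau> * p i))) +
            G * sym_block2 (P i) (0\<^sub>m n (\<tau> * q i)) (1\<^sub>m (\<tau> * q i)) * transpose_mat G
              \<prec>\<^bsub>n + \<tau> * p i\<^esub> 0\<^sub>m (n + \<tau> * p i) (n + \<tau> * p i)))) \<longleftrightarrow>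
      (\<forall>i\<in>{1..N}. pos_def n (P i) \<and> bounded_real \<gamma> i (P i)) \<and>
      (\<forall>i\<in>{1..N}. \<forall>j\<in>{1..N}. i \<noteq> j \<longrightarrow>
        lifted_lmi \<gamma> i (P i) (P j) \<prec>\<^bsub>n + \<tau> * p i\<^esub> 0\<^sub>m (n + \<tau> * p i) (n + \<tau> * p i))" (is "?L \<longleftrightarrow> ?R")
    proof
      assume L: ?L
      have "bounded_real \<gamma> i (P i)" if "i \<in> {1..N}" for i
        using other_mode[OF that] L that by metis
      then show ?R using L l by (auto simp del: atLeastAtMost_iff)
    qed (use l in \<open>auto simp del: atLeastAtMost_iff\<close>)
  qed
qed

text \<open>
  Positive definiteness of \<open>P\<^sub>i = R\<^sub>i(\<tau>)\<close> comes from \<open>R\<^sub>j(0)\<close>, for some \<open>j \<noteq> i\<close>, which lies below it.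
\<close>

lemma primal_imp_lifted:
  assumes "primal_condition N \<tau> n p A E C F \<gamma>"
  shows "lifted_condition N \<tau> n p q A E C F \<gamma>"
proof -
  obtain R \<epsilon> where "0 < \<epsilon>"
    and R: "\<forall>i\<in>{1..N}. (\<forall>k\<in>{0..\<tau>}. R i k \<in> symmetric_mats n) \<and> pos_def n (R i 0)"
    and lmis: "\<forall>i\<in>{1..N}. \<forall>j\<in>{1..N}. i \<noteq> j \<longrightarrow> bounded_real \<gamma> i (R i \<tau>) \<and>
       (\<forall>k\<in>{0..\<tau> - 1}. primal_lmi (p i) (A i) (E i) (C i) (F i) \<gamma> (R i (k + 1)) (R i k)
          \<preceq>\<^bsub>n + p i\<^esub> 0\<^sub>m (n + p i) (n + p i)) \<and>
       R i 0 - R j \<tau> + \<epsilon> \<cdot>\<^sub>m 1\<^sub>m n \<preceq>\<^bsub>n\<^esub> 0\<^sub>m n n"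
    using assms unfolding primal_condition_def by blast
  have sym: "R i k \<in> symmetric_mats n" if "i \<in> {1..N}" "k \<le> \<tau>" for i k
    using R that by simp
  have pos0: "pos_def n (R i 0)" if "i \<in> {1..N}" for i using R that by blast
  note lmis = lmis[rule_format]
  have gap: "quad (R i 0) v + \<epsilon> * (v \<bullet> v) \<le> quad (R j \<tau>) v"
    if "i \<in> {1..N}" "j \<in> {1..N}" "i \<noteq> j" "v \<in> carrier_vec n" for i j v
    using lmis[OF that(1-3)] loewner_gap_iff[OF sym[OF that(1)] sym[OF that(2)], of 0 \<tau> \<epsilon>] that(4) by auto
  have pos: "pos_def n (R i \<tau>)" if i: "i \<in> {1..N}" for i
  proof (rule pos_defI)
    fix v :: "real vec" assume v: "v \<in> carrier_vec n" "v \<noteq> 0\<^sub>v n"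
    obtain j where j: "j \<in> {1..N}" "i \<noteq> j" using other_mode[OF i] .
    have "0 < quad (R j 0) v" by (rule pos_def_quad_pos[OF pos0[OF j(1)] v])
    moreover have "0 \<le> \<epsilon> * (v \<bullet> v)" using \<open>0 < \<epsilon>\<close> sqnorm_ge_0 by simp
    ultimately show "0 < quad (R i \<tau>) v" using gap[OF j(1) i j(2)[symmetric] v(1)] by linarith
  qed (use sym i in simp)
  have brl: "bounded_real \<gamma> i (R i \<tau>)" if "i \<in> {1..N}" for i
    using other_mode[OF that] lmis that by metis
  have "lifted_lmi \<gamma> i (R i \<tau>) (R j \<tau>) \<prec>\<^bsub>n + \<tau> * p i\<^esub> 0\<^sub>m (n + \<tau> * p i) (n + \<tau> * p i)"
    if i: "i \<in> {1..N}" and j: "j \<in> {1..N}" and ij: "i \<noteq> j" for i j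
  proof -
    interpret M: lti_system n "p i" "q i" "A i" "E i" "C i" "F i" using modes[OF i] .
    have diss: "M.dissipative \<gamma> (R i (Suc k)) (R i k)" if "k < \<tau>" for k
      using lmis[OF i j ij] that M.primal_lmi_le_iff[OF sym[OF i] sym[OF i], of "Suc k" k \<gamma>]
      by (auto simp: M.dissipative_def)
    show ?thesis
    proof (rule M.lifted_lmi_lessI[OF pos_def_symmetric[OF pos[OF i]] pos_def_symmetric[OF pos[OF j]] brl[OF i]])
      fix x w assume t: "M.trajectory \<tau> x w" and "x 0 \<noteq> 0\<^sub>v n"
      have x0: "x 0 \<in> carrier_vec n" using M.trajectoryD(1)[OF t] by simp
      have "0 < \<epsilon> * (x 0 \<bullet> x 0)" using sqnorm_pos[OF x0 \<open>x 0 \<noteq> 0\<^sub>v n\<close>] \<open>0 < \<epsilon>\<close> by simp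
      then show "quad (R i \<tau>) (x \<tau>) + (\<Sum>k<\<tau>. M.excess \<gamma> (x k) (w k)) < quad (R j \<tau>) (x 0)"
        using M.dissipative_chain[of \<tau> \<gamma> "R i", OF diss t] gap[OF i j ij x0] by linarith
    qed
  qed
  then show ?thesis
    unfolding lifted_condition_iff using pos brl by (intro exI[of _ "\<lambda>i. R i \<tau>"]) blast
qed

lemma uniform_margin:
  assumes P: "\<forall>i\<in>{1..N}. pos_def n (P i) \<and> bounded_real \<gamma> i (P i)"
    and L: "\<forall>i\<in>{1..N}. \<forall>j\<in>{1..N}. i \<noteq> j \<longrightarrow>
      lifted_lmi \<gamma> i (P i) (P j) \<prec>\<^bsub>n + \<tau> * p i\<^esub> 0\<^sub>m (n + \<tau> * p i) (n + \<tau> * p i)"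
  shows "\<exists>c>0.
    (\<forall>i\<in>{1..N}. \<forall>x\<in>carrier_vec n. \<forall>w\<in>carrier_vec (p i).
      quad (P i) (step i x w) + excess \<gamma> i x w + c * (x \<bullet> x + w \<bullet> w) \<le> quad (P i) x) \<and>
    (\<forall>i\<in>{1..N}. \<forall>j\<in>{1..N}. i \<noteq> j \<longrightarrow> (\<forall>x w. trajectory i \<tau> x w \<longrightarrow>
      quad (P i) (x \<tau>) + (\<Sum>k<\<tau>. excess \<gamma> i (x k) (w k) + c * (x k \<bullet> x k + w k \<bullet> w k)) \<le> quad (P j) (x 0)))"
proof -
  note pos = conjunct1[OF P[rule_format]] and brl = conjunct2[OF P[rule_format]] and lifted = L[rule_format]
  let ?B = "\<lambda>i c. \<forall>x\<in>carrier_vec n. \<forall>w\<in>carrier_vec (p i).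
    quad (P i) (step i x w) + excess \<gamma> i x w + c * (x \<bullet> x + w \<bullet> w) \<le> quad (P i) x"
  let ?L = "\<lambda>(i, j) c. \<forall>x w. trajectory i \<tau> x w \<longrightarrow>
    quad (P i) (x \<tau>) + (\<Sum>k<\<tau>. excess \<gamma> i (x k) (w k) + c * (x k \<bullet> x k + w k \<bullet> w k)) \<le> quad (P j) (x 0)"
  have mono: "c' * (x \<bullet> x + w \<bullet> w) \<le> c * (x \<bullet> x + w \<bullet> w)" if "c' \<le> c" for c c' :: real and x w :: "real vec"
    using that by (intro mult_right_mono add_nonneg_nonneg sqnorm_ge_0)
  have B_mono: "?B i c'" if B: "?B i c" and "c' \<le> c" for i c c'
  proof (intro ballI)
    fix x w :: "real vec" assume "x \<in> carrier_vec n" "w \<in> carrier_vec (p i)"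
    then show "quad (P i) (step i x w) + excess \<gamma> i x w + c' * (x \<bullet> x + w \<bullet> w) \<le> quad (P i) x"
      using B[rule_format, of x w] mono[OF \<open>c' \<le> c\<close>, of x w] by linarith
  qed
  have L_mono: "?L s c'" if L: "?L s c" and "c' \<le> c" for s c c'
  proof (clarsimp split: prod.split)
    fix i j x w assume s: "s = (i, j)" and t: "trajectory i \<tau> x w"
    have "(\<Sum>k<\<tau>. excess \<gamma> i (x k) (w k) + c' * (x k \<bullet> x k + w k \<bullet> w k))
        \<le> (\<Sum>k<\<tau>. excess \<gamma> i (x k) (w k) + c * (x k \<bullet> x k + w k \<bullet> w k))"
      using mono[OF \<open>c' \<le> c\<close>] by (intro sum_mono add_left_mono)
    then show "quad (P i) (x \<tau>) + (\<Sum>k<\<tau>. excess \<gamma> i (x k) (w k) + c' * (x k \<bullet> x k + w k \<bullet> w k)) \<le> quad (P j) (x 0)"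
      using L t unfolding s by force
  qed
  have "\<exists>c>0. \<forall>i\<in>{1..N}. ?B i c"
  proof (rule uniform_constant)
    fix i assume i: "i \<in> {1..N}"
    show "\<exists>c>0. ?B i c"
      using lti_system.bounded_real_margin[OF modes[OF i] pos_def_symmetric[OF pos[OF i]] brl[OF i]] .
  qed (use B_mono in auto)
  then obtain b where b: "b > 0" "\<forall>i\<in>{1..N}. ?B i b" by blast
  have "\<exists>c>0. \<forall>s\<in>{(i, j) \<in> {1..N} \<times> {1..N}. i \<noteq> j}. ?L s c"
  proof (rule uniform_constant)
    show "finite {(i, j) \<in> {1..N} \<times> {1..N}. i \<noteq> j}"
      by (rule finite_subset[of _ "{1..N} \<times> {1..N}"]) auto
    fix s assume "s \<in> {(i, j) \<in> {1..N} \<times> {1..N}. i \<noteq> j}"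
    then obtain i j where s: "s = (i, j)" and ij: "i \<in> {1..N}" "j \<in> {1..N}" "i \<noteq> j" by blast
    show "\<exists>c>0. ?L s c"
      using lti_system.lifted_margin[OF modes[OF ij(1)] pos_def_symmetric[OF pos[OF ij(1)]]
          pos_def_symmetric[OF pos[OF ij(2)]] lifted[OF ij]]
      by (simp add: s)
  qed (use L_mono in blast)
  then obtain l where l: "l > 0" "\<forall>s\<in>{(i, j) \<in> {1..N} \<times> {1..N}. i \<noteq> j}. ?L s l" by blast
  show ?thesis
  proof (intro exI[of _ "min b l"] conjI ballI impI allI)
    show "0 < min b l" using b l by simp
  next
    fix i and x w :: "real vec" assume "i \<in> {1..N}" "x \<in> carrier_vec n" "w \<in> carrier_vec (p i)"
    then show "quad (P i) (step i x w) + excess \<gamma> i x w + min b l * (x \<bullet> x + w \<bullet> w) \<le> quad (P i) x"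
      using B_mono[of i b "min b l"] b(2) by auto
  next
    fix i j x w assume "i \<in> {1..N}" "j \<in> {1..N}" "i \<noteq> j" "trajectory i \<tau> x w"
    then show "quad (P i) (x \<tau>) + (\<Sum>k<\<tau>. excess \<gamma> i (x k) (w k) + min b l * (x k \<bullet> x k + w k \<bullet> w k)) \<le> quad (P j) (x 0)"
      using L_mono[of "(i, j)" l "min b l"] l(2) by auto
  qed
qed

text \<open>
  The margin \<open>c\<close> is split in two halves \<open>\<delta>\<close>: one pays for the reward in the Riccati recursion, the other one
  becomes the gap between \<open>R\<^sub>i(0)\<close> and \<open>R\<^sub>j(\<tau>)\<close>, since the initial state is among the states that the margin
  counts.
\<close>

lemma positive_primal_of_lifted:
  assumes "lifted_condition N \<tau> n p q A E C F \<gamma>"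
  shows "\<exists>R \<epsilon>. \<epsilon> > 0 \<and> (\<forall>i\<in>{1..N}. \<forall>k\<le>\<tau>. pos_def n (R i k)) \<and>
    (\<forall>i\<in>{1..N}. bounded_real \<gamma> i (R i \<tau>)) \<and>
    (\<forall>i\<in>{1..N}. \<forall>k<\<tau>. dissipative \<gamma> i (R i (Suc k)) (R i k)) \<and>
    (\<forall>i\<in>{1..N}. \<forall>j\<in>{1..N}. i \<noteq> j \<longrightarrow>
      (\<forall>v\<in>carrier_vec n. quad (R i 0) v + \<epsilon> * (v \<bullet> v) \<le> quad (R j \<tau>) v))"
proof -
  obtain P where P: "\<forall>i\<in>{1..N}. pos_def n (P i) \<and> bounded_real \<gamma> i (P i)"
    and L: "\<forall>i\<in>{1..N}. \<forall>j\<in>{1..N}. i \<noteq> j \<longrightarrow>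
      lifted_lmi \<gamma> i (P i) (P j) \<prec>\<^bsub>n + \<tau> * p i\<^esub> 0\<^sub>m (n + \<tau> * p i) (n + \<tau> * p i)"
    using assms unfolding lifted_condition_iff by (elim exE conjE)
  obtain c where "c > 0"
    and brl: "\<forall>i\<in>{1..N}. \<forall>x\<in>carrier_vec n. \<forall>w\<in>carrier_vec (p i).
      quad (P i) (step i x w) + excess \<gamma> i x w + c * (x \<bullet> x + w \<bullet> w) \<le> quad (P i) x"
    and lifted: "\<forall>i\<in>{1..N}. \<forall>j\<in>{1..N}. i \<noteq> j \<longrightarrow> (\<forall>x w. trajectory i \<tau> x w \<longrightarrow>
      quad (P i) (x \<tau>) + (\<Sum>k<\<tau>. excess \<gamma> i (x k) (w k) + c * (x k \<bullet> x k + w k \<bullet> w k)) \<le> quad (P j) (x 0))"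
    using uniform_margin[OF P L] by (elim exE conjE)
  define \<delta> where "\<delta> = c / 2"
  have \<delta>: "\<delta> > 0" "c = \<delta> + \<delta>" using \<open>c > 0\<close> by (auto simp: \<delta>_def)
  let ?riccati = "\<lambda>i R. R \<tau> = P i \<and> (\<forall>k\<le>\<tau>. pos_def n (R k)) \<and> (\<forall>k<\<tau>. dissipative \<gamma> i (R (Suc k)) (R k)) \<and>
      (\<forall>x0\<in>carrier_vec n. quad (R 0) x0 \<le> quad (P i) x0 \<and>
        (\<exists>x w. trajectory i \<tau> x w \<and> x 0 = x0 \<and>
          quad (R 0) x0 = quad (P i) (x \<tau>) + (\<Sum>k<\<tau>. excess \<gamma> i (x k) (w k) + \<delta> * (x k \<bullet> x k))))"
  have "\<exists>R. ?riccati i R" if i: "i \<in> {1..N}" for i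
  proof (rule lti_system.riccati_chain[OF modes[OF i] \<delta>(1) conjunct1[OF P[rule_format, OF i]]])
    fix x w :: "real vec" assume xw: "x \<in> carrier_vec n" "w \<in> carrier_vec (p i)"
    have "\<delta> * (x \<bullet> x + w \<bullet> w) \<le> c * (x \<bullet> x + w \<bullet> w)"
      using \<delta> by (intro mult_right_mono add_nonneg_nonneg sqnorm_ge_0) auto
    then show "quad (P i) (step i x w) + excess \<gamma> i x w + \<delta> * (x \<bullet> x + w \<bullet> w) \<le> quad (P i) x"
      using brl[rule_format, OF i xw] by linarith
  qed
  then have "\<forall>i\<in>{1..N}. \<exists>R. ?riccati i R" by (rule ballI)
  from bchoice[OF this] obtain R where R: "\<forall>i\<in>{1..N}. ?riccati i (R i)" by (elim exE)
  note R = R[rule_format]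
  show ?thesis
  proof (intro exI[of _ R] exI[of _ \<delta>] conjI ballI impI)
    fix i j and v :: "real vec"
    assume i: "i \<in> {1..N}" and j: "j \<in> {1..N}" and ij: "i \<noteq> j" and v: "v \<in> carrier_vec n"
    obtain x w where t: "trajectory i \<tau> x w" and x0: "x 0 = v"
      and val: "quad (R i 0) v = quad (P i) (x \<tau>) + (\<Sum>k<\<tau>. excess \<gamma> i (x k) (w k) + \<delta> * (x k \<bullet> x k))"
      using conjunct2[OF bspec[OF conjunct2[OF conjunct2[OF conjunct2[OF R[OF i]]]] v]] by (elim exE conjE)
    have "\<delta> * (v \<bullet> v) \<le> (\<Sum>k<\<tau>. \<delta> * (x k \<bullet> x k + w k \<bullet> w k))"
    proof -
      have "\<delta> * (v \<bullet> v) \<le> \<delta> * (x 0 \<bullet> x 0 + w 0 \<bullet> w 0)"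
        using \<delta>(1) sqnorm_ge_0[of "w 0"] by (simp add: x0)
      also have "\<dots> \<le> (\<Sum>k<\<tau>. \<delta> * (x k \<bullet> x k + w k \<bullet> w k))"
        using \<tau> \<delta>(1) sqnorm_ge_0 by (intro member_le_sum mult_nonneg_nonneg add_nonneg_nonneg) auto
      finally show ?thesis .
    qed
    moreover have "(\<Sum>k<\<tau>. \<delta> * (x k \<bullet> x k)) \<le> (\<Sum>k<\<tau>. \<delta> * (x k \<bullet> x k + w k \<bullet> w k))"
      using \<delta>(1) sqnorm_ge_0 by (intro sum_mono mult_left_mono) auto
    ultimately have "quad (R i 0) v + \<delta> * (v \<bullet> v) \<le> quad (P i) (x \<tau>) +
        (\<Sum>k<\<tau>. excess \<gamma> i (x k) (w k) + c * (x k \<bullet> x k + w k \<bullet> w k))"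
      unfolding val \<delta>(2) sum.distrib distrib_right by linarith
    also have "\<dots> \<le> quad (R j \<tau>) v" using lifted[rule_format, OF i j ij t] R[OF j] by (simp add: x0)
    finally show "quad (R i 0) v + \<delta> * (v \<bullet> v) \<le> quad (R j \<tau>) v" .
  qed (use \<delta> R P in auto)
qed

lemma lifted_imp_primal:
  assumes "lifted_condition N \<tau> n p q A E C F \<gamma>"
  shows "primal_condition N \<tau> n p A E C F \<gamma>"
proof -
  obtain R \<epsilon> where "\<epsilon> > 0"
    and pos: "\<forall>i\<in>{1..N}. \<forall>k\<le>\<tau>. pos_def n (R i k)"
    and brl: "\<forall>i\<in>{1..N}. bounded_real \<gamma> i (R i \<tau>)"
    and diss: "\<forall>i\<in>{1..N}. \<forall>k<\<tau>. dissipative \<gamma> i (R i (Suc k)) (R i k)"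
    and gap: "\<forall>i\<in>{1..N}. \<forall>j\<in>{1..N}. i \<noteq> j \<longrightarrow>
      (\<forall>v\<in>carrier_vec n. quad (R i 0) v + \<epsilon> * (v \<bullet> v) \<le> quad (R j \<tau>) v)"
    using positive_primal_of_lifted[OF assms] by (elim exE conjE)
  note pos = pos[rule_format] and brl = brl[rule_format] and diss = diss[rule_format]
    and gap = gap[rule_format]
  have sym: "R i k \<in> symmetric_mats n" if "i \<in> {1..N}" "k \<le> \<tau>" for i k
    using pos_def_symmetric[OF pos[OF that]] .
  have "primal_lmi (p i) (A i) (E i) (C i) (F i) \<gamma> (R i (k + 1)) (R i k)
      \<preceq>\<^bsub>n + p i\<^esub> 0\<^sub>m (n + p i) (n + p i)" if i: "i \<in> {1..N}" and k: "k \<in> {0..\<tau> - 1}" for i k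
    using k \<tau> diss[OF i, of k]
    by (subst lti_system.primal_lmi_le_iff[OF modes[OF i] sym[OF i] sym[OF i]]) auto
  moreover have "R i 0 - R j \<tau> + \<epsilon> \<cdot>\<^sub>m 1\<^sub>m n \<preceq>\<^bsub>n\<^esub> 0\<^sub>m n n"
    if "i \<in> {1..N}" "j \<in> {1..N}" "i \<noteq> j" for i j
    using gap[OF that] sym that by (subst loewner_gap_iff) auto
  ultimately show ?thesis
    unfolding primal_condition_def using \<open>\<epsilon> > 0\<close> pos sym brl
    by (intro exI[of _ R] exI[of _ \<epsilon>]) (simp del: atLeastAtMost_iff One_nat_def add: ball_atMost_iff)
qed

text \<open>
  Inversion of a primal solution that is positive definite at all times. It reverses the gap between \<open>R\<^sub>i(0)\<close> and
  \<open>R\<^sub>j(\<tau>)\<close>, first without and then, by definiteness, with a margin.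
\<close>

lemma lifted_imp_dual:
  assumes "\<gamma> > 0" "lifted_condition N \<tau> n p q A E C F \<gamma>"
  shows "dual_condition N \<tau> n p q A E C F \<gamma>"
proof -
  obtain R \<epsilon> where "\<epsilon> > 0"
    and pos: "\<forall>i\<in>{1..N}. \<forall>k\<le>\<tau>. pos_def n (R i k)"
    and brl: "\<forall>i\<in>{1..N}. bounded_real \<gamma> i (R i \<tau>)"
    and diss: "\<forall>i\<in>{1..N}. \<forall>k<\<tau>. dissipative \<gamma> i (R i (Suc k)) (R i k)"
    and gap: "\<forall>i\<in>{1..N}. \<forall>j\<in>{1..N}. i \<noteq> j \<longrightarrow>
      (\<forall>v\<in>carrier_vec n. quad (R i 0) v + \<epsilon> * (v \<bullet> v) \<le> quad (R j \<tau>) v)"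
    using positive_primal_of_lifted[OF assms(2)] by (elim exE conjE)
  note pos = pos[rule_format] and brl = brl[rule_format] and diss = diss[rule_format]
    and gap = gap[rule_format]
  define S where "S i k = pd_inverse n (R i k)" for i k
  have S: "pos_def n (S i k)" "R i k * S i k = 1\<^sub>m n" if "i \<in> {1..N}" "k \<le> \<tau>" for i k
    using pd_inverse[OF pos[OF that]] by (auto simp: S_def)
  have sym: "S i k \<in> symmetric_mats n" if "i \<in> {1..N}" "k \<le> \<tau>" for i k
    using pos_def_symmetric[OF S(1)[OF that]] .
  have le: "dual_lmi (p i) (q i) (A i) (E i) (C i) (F i) \<gamma> (S i k) (S i (k + 1))
      \<preceq>\<^bsub>n + p i + q i\<^esub> 0\<^sub>m (n + p i + q i) (n + p i + q i)"
    if i: "i \<in> {1..N}" and k: "k \<in> {0..\<tau> - 1}" for i k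
  proof -
    interpret M: lti_system n "p i" "q i" "A i" "E i" "C i" "F i" using modes[OF i] .
    have k': "k < \<tau>" "Suc k \<le> \<tau>" "k \<le> \<tau>" using k \<tau> by auto
    show ?thesis
      using k' M.dual_of_primal(1)[OF assms(1) pos[OF i k'(2)] pos[OF i k'(3)] S[OF i k'(2)] S[OF i k'(3)] diss[OF i k'(1)]]
      by (subst M.dual_lmi_le_iff[OF assms(1) sym[OF i] sym[OF i]]) (auto simp: M.dual_dissipative_def)
  qed
  have less: "dual_lmi (p i) (q i) (A i) (E i) (C i) (F i) \<gamma> (S i \<tau>) (S i \<tau>)
      \<prec>\<^bsub>n + p i + q i\<^esub> 0\<^sub>m (n + p i + q i) (n + p i + q i)" if i: "i \<in> {1..N}" for i
  proof -
    interpret M: lti_system n "p i" "q i" "A i" "E i" "C i" "F i" using modes[OF i] .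
    note Ri = pos[OF i order_refl] and Si = S[OF i order_refl]
    have strict: "quad (R i \<tau>) (M.step x w) + M.excess \<gamma> x w < quad (R i \<tau>) x"
      if "x \<in> carrier_vec n" "w \<in> carrier_vec (p i)" "x \<noteq> 0\<^sub>v n \<or> w \<noteq> 0\<^sub>v (p i)" for x w
      using brl[OF i] that unfolding M.primal_lmi_less_iff[OF pos_def_symmetric[OF Ri] pos_def_symmetric[OF Ri]] by blast
    have "M.dissipative \<gamma> (R i \<tau>) (R i \<tau>)"
      unfolding M.dissipative_def
    proof (intro ballI)
      fix x w :: "real vec" assume xw: "x \<in> carrier_vec n" "w \<in> carrier_vec (p i)"
      obtain c where "c > 0" and c: "\<forall>x\<in>carrier_vec n. \<forall>w\<in>carrier_vec (p i).
          quad (R i \<tau>) (M.step x w) + M.excess \<gamma> x w + c * (x \<bullet> x + w \<bullet> w) \<le> quad (R i \<tau>) x"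
        using M.bounded_real_margin[OF pos_def_symmetric[OF Ri] brl[OF i]] by blast
      moreover have "0 \<le> c * (x \<bullet> x + w \<bullet> w)" using \<open>c > 0\<close> sqnorm_ge_0[of x] sqnorm_ge_0[of w] by simp
      ultimately show "quad (R i \<tau>) (M.step x w) + M.excess \<gamma> x w \<le> quad (R i \<tau>) x"
        using c[rule_format, OF xw] by linarith
    qed
    from M.dual_of_primal(2)[OF assms(1) Ri Ri Si Si this _ _ _ strict] show ?thesis
      by (subst M.dual_lmi_less_iff[OF assms(1) sym[OF i order_refl] sym[OF i order_refl]]) auto
  qed
  have "\<exists>c>0. \<forall>s\<in>{(i, j) \<in> {1..N} \<times> {1..N}. i \<noteq> j}.
      \<forall>v\<in>carrier_vec n. quad (S (snd s) \<tau>) v + c * (v \<bullet> v) \<le> quad (S (fst s) 0) v"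
  proof (rule uniform_constant)
    show "finite {(i, j) \<in> {1..N} \<times> {1..N}. i \<noteq> j}"
      by (rule finite_subset[of _ "{1..N} \<times> {1..N}"]) auto
  next
    fix s assume "s \<in> {(i, j) \<in> {1..N} \<times> {1..N}. i \<noteq> j}"
    then obtain i j where s: "s = (i, j)" and i: "i \<in> {1..N}" and j: "j \<in> {1..N}" and ij: "i \<noteq> j" by blast
    have z: "0 \<le> \<tau>" by simp
    note sS = sym[OF j order_refl] sym[OF i z]
    have "quad (R i 0) v < quad (R j \<tau>) v" if "v \<in> carrier_vec n" "v \<noteq> 0\<^sub>v n" for v
    proof -
      have "0 < \<epsilon> * (v \<bullet> v)" using sqnorm_pos[OF that] \<open>\<epsilon> > 0\<close> by simp
      then show ?thesis using gap[OF i j ij that(1)] by linarith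
    qed
    then have "quad (S j \<tau>) v < quad (S i 0) v" if "v \<in> carrier_vec n" "v \<noteq> 0\<^sub>v n" for v
      using that by (intro pos_def_inverse_antitone[OF pos[OF i z] pos[OF j order_refl] sS(2) S(2)[OF i z] sS(1) S(2)[OF j order_refl]])
    then have "quad (S j \<tau> - S i 0) v < 0" if "v \<in> carrier_vec n" "v \<noteq> 0\<^sub>v n" for v
      using that sS[THEN symmetric_carrier] by (simp add: quad_minus[of _ n])
    from neg_def_margin[OF symmetric_minus[OF sS] this]
    show "\<exists>c>0. \<forall>v\<in>carrier_vec n. quad (S (snd s) \<tau>) v + c * (v \<bullet> v) \<le> quad (S (fst s) 0) v"
      using sS[THEN symmetric_carrier] by (force simp: s quad_minus[of _ n])
  next
    fix s and c c' :: real
    assume *: "\<forall>v\<in>carrier_vec n. quad (S (snd s) \<tau>) v + c * (v \<bullet> v) \<le> quad (S (fst s) 0) v" and "c' \<le> c"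
    show "\<forall>v\<in>carrier_vec n. quad (S (snd s) \<tau>) v + c' * (v \<bullet> v) \<le> quad (S (fst s) 0) v"
    proof
      fix v :: "real vec" assume v: "v \<in> carrier_vec n"
      have "c' * (v \<bullet> v) \<le> c * (v \<bullet> v)" using \<open>c' \<le> c\<close> by (intro mult_right_mono sqnorm_ge_0)
      then show "quad (S (snd s) \<tau>) v + c' * (v \<bullet> v) \<le> quad (S (fst s) 0) v" using *[rule_format, OF v] by linarith
    qed
  qed
  then obtain c where "c > 0" and c: "\<forall>s\<in>{(i, j) \<in> {1..N} \<times> {1..N}. i \<noteq> j}.
      \<forall>v\<in>carrier_vec n. quad (S (snd s) \<tau>) v + c * (v \<bullet> v) \<le> quad (S (fst s) 0) v"
    by blast
  have "S j \<tau> - S i 0 + c \<cdot>\<^sub>m 1\<^sub>m n \<preceq>\<^bsub>n\<^esub> 0\<^sub>m n n"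
    if "i \<in> {1..N}" "j \<in> {1..N}" "i \<noteq> j" for i j
    using bspec[OF c, of "(i, j)"] that by (subst loewner_gap_iff[OF sym sym]) auto
  then show ?thesis
    unfolding dual_condition_def using \<open>c > 0\<close> S sym le less
    by (intro exI[of _ S] exI[of _ c]) (simp del: atLeastAtMost_iff One_nat_def add: ball_atMost_iff)
qed

lemma dual_imp_lifted:
  assumes "\<gamma> > 0" "dual_condition N \<tau> n p q A E C F \<gamma>"
  shows "lifted_condition N \<tau> n p q A E C F \<gamma>"
proof -
  obtain S \<epsilon> where "0 < \<epsilon>"
    and S: "\<forall>i\<in>{1..N}. (\<forall>k\<in>{0..\<tau>}. S i k \<in> symmetric_mats n) \<and> pos_def n (S i \<tau>)"
    and lmis: "\<forall>i\<in>{1..N}. \<forall>j\<in>{1..N}. i \<noteq> j \<longrightarrow>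
       dual_lmi (p i) (q i) (A i) (E i) (C i) (F i) \<gamma> (S i \<tau>) (S i \<tau>)
         \<prec>\<^bsub>n + p i + q i\<^esub> 0\<^sub>m (n + p i + q i) (n + p i + q i) \<and>
       (\<forall>k\<in>{0..\<tau> - 1}. dual_lmi (p i) (q i) (A i) (E i) (C i) (F i) \<gamma> (S i k) (S i (k + 1))
            \<preceq>\<^bsub>n + p i + q i\<^esub> 0\<^sub>m (n + p i + q i) (n + p i + q i)) \<and>
       S j \<tau> - S i 0 + \<epsilon> \<cdot>\<^sub>m 1\<^sub>m n \<preceq>\<^bsub>n\<^esub> 0\<^sub>m n n"
    using assms(2) unfolding dual_condition_def by blast
  have sym: "S i k \<in> symmetric_mats n" if "i \<in> {1..N}" "k \<le> \<tau>" for i k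
    using S that by simp
  have pos: "pos_def n (S i \<tau>)" if "i \<in> {1..N}" for i using S that by blast
  note lmis = lmis[rule_format]
  define P where "P i = pd_inverse n (S i \<tau>)" for i
  have P: "pos_def n (P i)" "S i \<tau> * P i = 1\<^sub>m n" if "i \<in> {1..N}" for i
    using pd_inverse[OF pos[OF that]] by (auto simp: P_def)
  have brl: "bounded_real \<gamma> i (P i)" if i: "i \<in> {1..N}" for i
  proof -
    obtain j where "j \<in> {1..N}" "i \<noteq> j" using other_mode[OF i] .
    then show ?thesis
      using lti_system.primal_of_dual_less[OF modes[OF i] assms(1) P(1)[OF i] pos[OF i] P(2)[OF i]] lmis[OF i] by blast
  qed
  have "lifted_lmi \<gamma> i (P i) (P j) \<prec>\<^bsub>n + \<tau> * p i\<^esub> 0\<^sub>m (n + \<tau> * p i) (n + \<tau> * p i)"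
    if i: "i \<in> {1..N}" and j: "j \<in> {1..N}" and ij: "i \<noteq> j" for i j
  proof -
    interpret M: lti_system n "p i" "q i" "A i" "E i" "C i" "F i" using modes[OF i] .
    have chain: "M.dual_dissipative \<gamma> (S i k) (S i (Suc k))" if "k < \<tau>" for k
      using lmis[OF i j ij] that M.dual_lmi_le_iff[OF assms(1) sym[OF i] sym[OF i], of k "Suc k"]
      by (auto simp: M.dual_dissipative_def)
    have gap: "quad (S j \<tau>) \<xi> < quad (S i 0) \<xi>" if \<xi>: "\<xi> \<in> carrier_vec n" "\<xi> \<noteq> 0\<^sub>v n" for \<xi>
    proof -
      have "quad (S j \<tau>) \<xi> + \<epsilon> * (\<xi> \<bullet> \<xi>) \<le> quad (S i 0) \<xi>"
        using lmis[OF i j ij] loewner_gap_iff[OF sym[OF j] sym[OF i], of \<tau> 0 \<epsilon>] \<xi> by auto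
      moreover have "0 < \<epsilon> * (\<xi> \<bullet> \<xi>)" using sqnorm_pos[OF \<xi>] \<open>0 < \<epsilon>\<close> by simp
      ultimately show ?thesis by linarith
    qed
    show ?thesis
    proof (rule M.lifted_lmi_lessI[OF pos_def_symmetric[OF P(1)[OF i]] pos_def_symmetric[OF P(1)[OF j]] brl[OF i]])
      fix x w assume t: "M.trajectory \<tau> x w" and x0: "x 0 \<noteq> 0\<^sub>v n"
      show "quad (P i) (x \<tau>) + (\<Sum>k<\<tau>. M.excess \<gamma> (x k) (w k)) < quad (P j) (x 0)"
        by (rule M.dual_chain_less[where S = "S i" and Q' = "S j \<tau>", OF assms(1) P(1)[OF i] _ P(2)[OF i] _ P(1)[OF j] pos[OF j]
              P(2)[OF j] gap chain t x0])
          (use sym[OF i] pos_def_carrier[OF pos[OF i]] in auto)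
    qed
  qed
  then show ?thesis unfolding lifted_condition_iff using P(1) brl by (intro exI[of _ P]) blast
qed

end

section \<open>Stability and gain of the switched system\<close>

lemma sum_lessThan_add:
  fixes f :: "nat \<Rightarrow> 'a :: comm_monoid_add"
  shows "(\<Sum>t<a + b. f t) = (\<Sum>t<a. f t) + (\<Sum>k<b. f (a + k))"
  by (induction b) (auto simp: add.assoc)

lemma norm2_sq: "(norm2 v)\<^sup>2 = v \<bullet> v"
  by (simp add: norm2_def sqnorm_ge_0)

context switched_system
begin

lemma switching_instants:
  assumes "switching_signal N \<tau> \<phi> \<sigma>"
  shows "\<phi> 0 = 0" "\<phi> s + \<tau> \<le> \<phi> (Suc s)" "\<sigma> t \<in> {1..N}"
    "k < \<phi> (Suc s) - \<phi> s \<Longrightarrow> \<sigma> (\<phi> s + k) = \<sigma> (\<phi> s)"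
proof -
  show "\<phi> 0 = 0" "\<phi> s + \<tau> \<le> \<phi> (Suc s)" "\<sigma> t \<in> {1..N}"
    using assms by (simp_all add: switching_signal_def del: atLeastAtMost_iff)
  assume "k < \<phi> (Suc s) - \<phi> s"
  then have "\<phi> s + k \<in> {\<phi> s..<\<phi> (Suc s)}" by auto
  then show "\<sigma> (\<phi> s + k) = \<sigma> (\<phi> s)" using assms unfolding switching_signal_def by blast
qed

lemma switching_instants_unbounded:
  assumes "switching_signal N \<tau> \<phi> \<sigma>"
  shows "m \<le> \<phi> m"
proof (induction m)
  case (Suc m)
  then show ?case using switching_instants(2)[OF assms, of m] \<tau> by linarith
qed simp

lemma sum_dwell_intervals:
  fixes f :: "nat \<Rightarrow> 'a :: comm_monoid_add"
  assumes "switching_signal N \<tau> \<phi> \<sigma>"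
  shows "(\<Sum>s<m. \<Sum>k<\<phi> (Suc s) - \<phi> s. f (\<phi> s + k)) = (\<Sum>t<\<phi> m. f t)"
proof (induction m)
  case 0
  then show ?case using switching_instants(1)[OF assms] by simp
next
  case (Suc m)
  have "\<phi> (Suc m) = \<phi> m + (\<phi> (Suc m) - \<phi> m)" using switching_instants(2)[OF assms, of m] by simp
  then have "(\<Sum>t<\<phi> (Suc m). f t) = (\<Sum>t<\<phi> m. f t) + (\<Sum>k<\<phi> (Suc m) - \<phi> m. f (\<phi> m + k))"
    using sum_lessThan_add[of f "\<phi> m" "\<phi> (Suc m) - \<phi> m"] by simp
  then show ?case using Suc by simp
qed

text \<open>
  At the end of each dwell interval the storage function is that of the mode just left, which is the one from
  which the lifted inequality of the next mode starts. If consecutive intervals have the same mode, the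
  one-step inequality covers the whole second interval. The truncated \<open>m - 1\<close> makes the convention for \<open>m = 0\<close>
  that the mode before time \<open>0\<close> is the initial one.
\<close>

lemma switched_dissipation:
  assumes brl: "\<And>i x w. \<lbrakk>i \<in> {1..N}; x \<in> carrier_vec n; w \<in> carrier_vec (p i)\<rbrakk> \<Longrightarrow>
      quad (P i) (step i x w) + r i x w \<le> quad (P i) x"
    and lifted: "\<And>i j x w. \<lbrakk>i \<in> {1..N}; j \<in> {1..N}; i \<noteq> j; trajectory i \<tau> x w\<rbrakk> \<Longrightarrow>
      quad (P i) (x \<tau>) + (\<Sum>k<\<tau>. r i (x k) (w k)) \<le> quad (P j) (x 0)"
    and sw: "switching_signal N \<tau> \<phi> \<sigma>"
    and x: "\<And>t. x t \<in> carrier_vec n" and w: "\<And>t. w t \<in> carrier_vec (p (\<sigma> t))"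
    and dyn: "\<And>t. x (Suc t) = step (\<sigma> t) (x t) (w t)"
  shows "quad (P (\<sigma> (\<phi> (m - 1)))) (x (\<phi> m)) + (\<Sum>t<\<phi> m. r (\<sigma> t) (x t) (w t)) \<le> quad (P (\<sigma> 0)) (x 0)"
proof (induction m)
  case 0
  then show ?case using switching_instants(1)[OF sw] by simp
next
  case (Suc m)
  define i where "i = \<sigma> (\<phi> m)"
  define j where "j = \<sigma> (\<phi> (m - 1))"
  define T where "T = \<phi> (Suc m) - \<phi> m"
  have T: "\<phi> (Suc m) = \<phi> m + T" "\<tau> \<le> T" using switching_instants(2)[OF sw, of m] by (auto simp: T_def)
  have i: "i \<in> {1..N}" and j: "j \<in> {1..N}" using switching_instants(3)[OF sw] by (auto simp: i_def j_def)
  have \<sigma>: "\<sigma> (\<phi> m + k) = i" if "k < T" for k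
    using switching_instants(4)[OF sw] that by (simp add: i_def T_def)
  have wi: "w (\<phi> m + k) \<in> carrier_vec (p i)" if "k < T" for k using w[of "\<phi> m + k"] \<sigma>[OF that] by simp
  let ?r = "\<lambda>k. r i (x (\<phi> m + k)) (w (\<phi> m + k))"
  have brl_run: "quad (P i) (x (\<phi> m + s + K)) + (\<Sum>k<K. ?r (s + k)) \<le> quad (P i) (x (\<phi> m + s))"
    if "s + K \<le> T" for s K
  proof -
    have "quad (P i) (x (\<phi> m + s + Suc k)) + ?r (s + k) \<le> quad (P i) (x (\<phi> m + s + k))" if "k < K" for k
      using brl[OF i x[of "\<phi> m + s + k"] wi[of "s + k"]] \<sigma>[of "s + k"] dyn[of "\<phi> m + s + k"] that \<open>s + K \<le> T\<close>
      by (simp add: add.assoc)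
    then show ?thesis
      using telescope_le[of K "\<lambda>k. quad (P i) (x (\<phi> m + s + k))" "\<lambda>k. ?r (s + k)"] by simp
  qed
  have "quad (P i) (x (\<phi> m + T)) + (\<Sum>k<T. ?r k) \<le> quad (P j) (x (\<phi> m))"
  proof (cases "i = j")
    case True
    then show ?thesis using brl_run[of 0 T] by simp
  next
    case False
    have "lti_system.trajectory n (p i) (A i) (E i) \<tau> (\<lambda>k. x (\<phi> m + k)) (\<lambda>k. w (\<phi> m + k))"
      unfolding lti_system.trajectory_def[OF modes[OF i]]
    proof (intro conjI allI impI)
      fix k assume "k < \<tau>"
      then have k: "k < T" using T(2) by simp
      show "w (\<phi> m + k) \<in> carrier_vec (p i)" by (rule wi[OF k])
      show "x (\<phi> m + Suc k) = step i (x (\<phi> m + k)) (w (\<phi> m + k))" using dyn[of "\<phi> m + k"] \<sigma>[OF k] by simp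
    qed (rule x)
    from lifted[OF i j False this]
    have "quad (P i) (x (\<phi> m + \<tau>)) + (\<Sum>k<\<tau>. ?r k) \<le> quad (P j) (x (\<phi> m))" by simp
    moreover have "(\<Sum>k<T. ?r k) = (\<Sum>k<\<tau>. ?r k) + (\<Sum>k<T - \<tau>. ?r (\<tau> + k))"
      using sum_lessThan_add[of ?r \<tau> "T - \<tau>"] T(2) by simp
    ultimately show ?thesis using brl_run[of \<tau> "T - \<tau>"] T(2) by (simp add: add.assoc)
  qed
  moreover have "(\<Sum>t<\<phi> (Suc m). r (\<sigma> t) (x t) (w t)) = (\<Sum>t<\<phi> m. r (\<sigma> t) (x t) (w t)) + (\<Sum>k<T. ?r k)"
    unfolding T(1) sum_lessThan_add using \<sigma> by simp
  ultimately show ?case using Suc unfolding j_def[symmetric] by (simp add: i_def[symmetric] T(1))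
qed

lemma state_carrier:
  assumes "\<And>t. \<sigma> t \<in> {1..N}" "\<And>i t. i \<in> {1..N} \<Longrightarrow> w i t \<in> carrier_vec (p i)" "x0 \<in> carrier_vec n"
  shows "state A E \<sigma> w x0 t \<in> carrier_vec n"
proof (induction t)
  case (Suc t)
  then show ?case
    using lti_system.step_carrier[OF modes[OF assms(1)[of t]] Suc assms(2)[OF assms(1)[of t], of t]]
    by (simp add: lti_system.step_def[OF modes[OF assms(1)]])
qed (use assms in simp)

text \<open>
  Stability and the gain bound are the cases \<open>w = 0\<close> and \<open>x0 = 0\<close>. The storage after the last interval is
  nonnegative and has been dropped.
\<close>

lemma dissipation_on_horizon:
  assumes "lifted_condition N \<tau> n p q A E C F \<gamma>"
  shows "\<exists>P c. c > 0 \<and> (\<forall>i\<in>{1..N}. pos_def n (P i)) \<and>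
    (\<forall>\<phi> \<sigma> w x0 m. switching_signal N \<tau> \<phi> \<sigma> \<longrightarrow> (\<forall>i\<in>{1..N}. \<forall>t. w i t \<in> carrier_vec (p i)) \<longrightarrow>
      x0 \<in> carrier_vec n \<longrightarrow>
      (\<Sum>t<\<phi> m. excess \<gamma> (\<sigma> t) (state A E \<sigma> w x0 t) (w (\<sigma> t) t) +
         c * (state A E \<sigma> w x0 t \<bullet> state A E \<sigma> w x0 t + w (\<sigma> t) t \<bullet> w (\<sigma> t) t)) \<le> quad (P (\<sigma> 0)) x0)"
proof -
  obtain P where P: "\<forall>i\<in>{1..N}. pos_def n (P i) \<and> bounded_real \<gamma> i (P i)"
    and L: "\<forall>i\<in>{1..N}. \<forall>j\<in>{1..N}. i \<noteq> j \<longrightarrow>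
      lifted_lmi \<gamma> i (P i) (P j) \<prec>\<^bsub>n + \<tau> * p i\<^esub> 0\<^sub>m (n + \<tau> * p i) (n + \<tau> * p i)"
    using assms unfolding lifted_condition_iff by (elim exE conjE)
  obtain c where "c > 0"
    and brl: "\<forall>i\<in>{1..N}. \<forall>x\<in>carrier_vec n. \<forall>w\<in>carrier_vec (p i).
      quad (P i) (step i x w) + excess \<gamma> i x w + c * (x \<bullet> x + w \<bullet> w) \<le> quad (P i) x"
    and lifted: "\<forall>i\<in>{1..N}. \<forall>j\<in>{1..N}. i \<noteq> j \<longrightarrow> (\<forall>x w. trajectory i \<tau> x w \<longrightarrow>
      quad (P i) (x \<tau>) + (\<Sum>k<\<tau>. excess \<gamma> i (x k) (w k) + c * (x k \<bullet> x k + w k \<bullet> w k)) \<le> quad (P j) (x 0))"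
    using uniform_margin[OF P L] by (elim exE conjE)
  show ?thesis
  proof (intro exI[of _ P] exI[of _ c] conjI allI impI)
    show "c > 0" by fact
    show "\<forall>i\<in>{1..N}. pos_def n (P i)" using P by blast
    fix \<phi> \<sigma> :: "nat \<Rightarrow> nat" and w :: "nat \<Rightarrow> nat \<Rightarrow> real vec" and x0 :: "real vec" and m :: nat
    assume sw: "switching_signal N \<tau> \<phi> \<sigma>" and w: "\<forall>i\<in>{1..N}. \<forall>t. w i t \<in> carrier_vec (p i)"
      and x0: "x0 \<in> carrier_vec n"
    let ?x = "state A E \<sigma> w x0"
    let ?r = "\<lambda>i x w. excess \<gamma> i x w + c * (x \<bullet> x + w \<bullet> w)"
    note mode = switching_instants(3)[OF sw]
    have x: "?x t \<in> carrier_vec n" for t using mode w x0 by (intro state_carrier) auto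
    have "quad (P (\<sigma> (\<phi> (m - 1)))) (?x (\<phi> m)) + (\<Sum>t<\<phi> m. ?r (\<sigma> t) (?x t) (w (\<sigma> t) t)) \<le> quad (P (\<sigma> 0)) (?x 0)"
    proof (rule switched_dissipation[where w = "\<lambda>t. w (\<sigma> t) t" and r = ?r, OF _ _ sw x])
      show "quad (P i) (step i x w) + ?r i x w \<le> quad (P i) x"
        if "i \<in> {1..N}" "x \<in> carrier_vec n" "w \<in> carrier_vec (p i)" for i x w
        using brl[rule_format, OF that] by simp
      show "quad (P i) (x \<tau>) + (\<Sum>k<\<tau>. ?r i (x k) (w k)) \<le> quad (P j) (x 0)"
        if "i \<in> {1..N}" "j \<in> {1..N}" "i \<noteq> j" "trajectory i \<tau> x w" for i j x w
        using lifted[rule_format, OF that] .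
      show "w (\<sigma> t) t \<in> carrier_vec (p (\<sigma> t))" for t using w mode by blast
      show "?x (Suc t) = step (\<sigma> t) (?x t) (w (\<sigma> t) t)" for t
        using lti_system.step_def[OF modes[OF mode]] by simp
    qed
    moreover have "0 \<le> quad (P (\<sigma> (\<phi> (m - 1)))) (?x (\<phi> m))"
      using P mode x by (intro pos_def_quad_nonneg[of n]) auto
    ultimately show "(\<Sum>t<\<phi> m. ?r (\<sigma> t) (?x t) (w (\<sigma> t) t)) \<le> quad (P (\<sigma> 0)) x0" by simp
  qed
qed

text \<open>
  The energy of the unforced trajectory is at most a multiple of \<open>|x\<^sub>0|\<^sup>2\<close>, which bounds each single state and
  forces the states to tend to zero.
\<close>

lemma asymptotically_stable_switched:
  assumes "lifted_condition N \<tau> n p q A E C F \<gamma>" and sw: "switching_signal N \<tau> \<phi> \<sigma>"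
  shows "asymptotically_stable n (state A E \<sigma> (\<lambda>i t. 0\<^sub>v (p i)))"
proof -
  obtain P c where "c > 0" and pos: "\<forall>i\<in>{1..N}. pos_def n (P i)"
    and diss: "\<forall>\<phi> \<sigma> w x0 m. switching_signal N \<tau> \<phi> \<sigma> \<longrightarrow> (\<forall>i\<in>{1..N}. \<forall>t. w i t \<in> carrier_vec (p i)) \<longrightarrow>
      x0 \<in> carrier_vec n \<longrightarrow>
      (\<Sum>t<\<phi> m. excess \<gamma> (\<sigma> t) (state A E \<sigma> w x0 t) (w (\<sigma> t) t) +
         c * (state A E \<sigma> w x0 t \<bullet> state A E \<sigma> w x0 t + w (\<sigma> t) t \<bullet> w (\<sigma> t) t)) \<le> quad (P (\<sigma> 0)) x0"
    using dissipation_on_horizon[OF assms(1)] by (elim exE conjE)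
  note pos = pos[rule_format] and diss = diss[rule_format]
  let ?x = "\<lambda>x0. state A E \<sigma> (\<lambda>i t. 0\<^sub>v (p i)) x0"
  note mode = switching_instants(3)[OF sw]
  obtain K where "K > 0" and K: "\<forall>v\<in>carrier_vec n. quad (P (\<sigma> 0)) v \<le> K * (v \<bullet> v)"
    using quad_bounded[OF pos_def_carrier[OF pos[OF mode[of 0]]]] by blast
  have energy: "(\<Sum>t<T. ?x x0 t \<bullet> ?x x0 t) \<le> K / c * (x0 \<bullet> x0)" if x0: "x0 \<in> carrier_vec n" for x0 T
  proof -
    have "c * (\<Sum>t<T. ?x x0 t \<bullet> ?x x0 t) \<le> c * (\<Sum>t<\<phi> T. ?x x0 t \<bullet> ?x x0 t)"
      using \<open>c > 0\<close> switching_instants_unbounded[OF sw, of T] sqnorm_ge_0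
      by (intro mult_left_mono sum_mono2) auto
    also have "\<dots> \<le> (\<Sum>t<\<phi> T. excess \<gamma> (\<sigma> t) (?x x0 t) (0\<^sub>v (p (\<sigma> t))) +
        c * (?x x0 t \<bullet> ?x x0 t + 0\<^sub>v (p (\<sigma> t)) \<bullet> 0\<^sub>v (p (\<sigma> t))))"
      unfolding sum_distrib_left
      using sqnorm_ge_0 by (intro sum_mono) (simp add: lti_system.excess_def[OF modes[OF mode]])
    also have "\<dots> \<le> quad (P (\<sigma> 0)) x0" using diss[of \<phi> \<sigma> "\<lambda>i t. 0\<^sub>v (p i)" x0 T] sw x0 by simp
    also have "\<dots> \<le> K * (x0 \<bullet> x0)" using K x0 by blast
    finally show ?thesis using \<open>c > 0\<close> by (simp add: field_simps)
  qed
  show ?thesis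
    unfolding asymptotically_stable_def
  proof (intro conjI allI impI ballI)
    fix \<epsilon> :: real assume "\<epsilon> > 0"
    show "\<exists>\<delta>>0. \<forall>x0\<in>carrier_vec n. norm2 x0 < \<delta> \<longrightarrow> (\<forall>t. norm2 (?x x0 t) < \<epsilon>)"
    proof (intro exI conjI ballI impI allI)
      show "0 < \<epsilon> / sqrt (K / c)" using \<open>\<epsilon> > 0\<close> \<open>K > 0\<close> \<open>c > 0\<close> by simp
      fix x0 t assume x0: "x0 \<in> carrier_vec n" and small: "norm2 x0 < \<epsilon> / sqrt (K / c)"
      have "?x x0 t \<bullet> ?x x0 t \<le> (\<Sum>t<Suc t. ?x x0 t \<bullet> ?x x0 t)"
        using sqnorm_ge_0 by (intro member_le_sum) auto
      also have "\<dots> \<le> K / c * (x0 \<bullet> x0)" by (rule energy[OF x0])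
      finally have "norm2 (?x x0 t) \<le> sqrt (K / c) * norm2 x0"
        unfolding norm2_def real_sqrt_mult[symmetric] by (rule real_sqrt_le_mono)
      also have "\<dots> < \<epsilon>" using small \<open>K > 0\<close> \<open>c > 0\<close> by (simp add: field_simps)
      finally show "norm2 (?x x0 t) < \<epsilon>" .
    qed
  next
    fix x0 :: "real vec" assume x0: "x0 \<in> carrier_vec n"
    have "summable (\<lambda>t. ?x x0 t \<bullet> ?x x0 t)"
      using energy[OF x0, of "Suc _"] sqnorm_ge_0
      by (intro bounded_imp_summable[where B = "K / c * (x0 \<bullet> x0)"]) (auto simp: lessThan_Suc_atMost)
    from tendsto_real_sqrt[OF summable_LIMSEQ_zero[OF this]]
    show "(\<lambda>t. norm2 (?x x0 t)) \<longlonglongrightarrow> 0" by (simp add: norm2_def)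
  qed
qed

text \<open>
  The margin in the input lowers \<open>\<gamma>\<^sup>2\<close> by some \<open>d > 0\<close>.
\<close>

lemma l2_gain_less:
  assumes "\<gamma> > 0" and "lifted_condition N \<tau> n p q A E C F \<gamma>"
  shows "l2_gain N \<tau> n p A E C F < ereal \<gamma>"
proof -
  obtain P c where "c > 0" and pos: "\<forall>i\<in>{1..N}. pos_def n (P i)"
    and diss: "\<forall>\<phi> \<sigma> w x0 m. switching_signal N \<tau> \<phi> \<sigma> \<longrightarrow> (\<forall>i\<in>{1..N}. \<forall>t. w i t \<in> carrier_vec (p i)) \<longrightarrow>
      x0 \<in> carrier_vec n \<longrightarrow>
      (\<Sum>t<\<phi> m. excess \<gamma> (\<sigma> t) (state A E \<sigma> w x0 t) (w (\<sigma> t) t) +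
         c * (state A E \<sigma> w x0 t \<bullet> state A E \<sigma> w x0 t + w (\<sigma> t) t \<bullet> w (\<sigma> t) t)) \<le> quad (P (\<sigma> 0)) x0"
    using dissipation_on_horizon[OF assms(2)] by (elim exE conjE)
  note pos = pos[rule_format] and diss = diss[rule_format]
  (* the second bound keeps \<gamma>\<^sup>2 - d positive *)
  define d where "d = min c (\<gamma>\<^sup>2 / 2)"
  have d: "0 < d" "d \<le> c" "d < \<gamma>\<^sup>2" using \<open>c > 0\<close> \<open>\<gamma> > 0\<close> by (auto simp: d_def min_def)
  define g where "g = sqrt (\<gamma>\<^sup>2 - d)"
  have g: "0 < g" "g < \<gamma>" "g\<^sup>2 = \<gamma>\<^sup>2 - d"
    using d \<open>\<gamma> > 0\<close> by (auto simp: g_def intro: real_less_lsqrt)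
  have "l2_gain_bound N \<tau> n p A E C F g"
    unfolding l2_gain_bound_def Let_def
  proof (intro allI impI)
    fix \<phi> \<sigma> :: "nat \<Rightarrow> nat" and w :: "nat \<Rightarrow> nat \<Rightarrow> real vec"
    assume sw: "switching_signal N \<tau> \<phi> \<sigma>" and w: "\<forall>i\<in>{1..N}. \<forall>t. w i t \<in> carrier_vec (p i)"
    let ?x = "state A E \<sigma> w (0\<^sub>v n)"
    let ?z = "controlled_output C F ?x w"
    define a where "a t = ?z (\<sigma> t) t \<bullet> ?z (\<sigma> t) t" for t
    define b where "b t = w (\<sigma> t) t \<bullet> w (\<sigma> t) t" for t
    note mode = switching_instants(3)[OF sw]
    have blocks: "(\<Sum>k<\<phi> (Suc s) - \<phi> s. ennreal ((norm2 (y (\<sigma> (\<phi> s)) (\<phi> s + k)))\<^sup>2))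
        = (\<Sum>k<\<phi> (Suc s) - \<phi> s. ennreal (y (\<sigma> (\<phi> s + k)) (\<phi> s + k) \<bullet> y (\<sigma> (\<phi> s + k)) (\<phi> s + k)))" for y s
      using switching_instants(4)[OF sw] by (intro sum.cong) (auto simp: norm2_sq)
    have finite_horizon: "(\<Sum>t<\<phi> m. a t) \<le> g\<^sup>2 * (\<Sum>t<\<phi> m. b t)" for m
    proof -
      have "(\<Sum>t<\<phi> m. a t - g\<^sup>2 * b t) \<le> (\<Sum>t<\<phi> m. excess \<gamma> (\<sigma> t) (?x t) (w (\<sigma> t) t) +
         c * (?x t \<bullet> ?x t + w (\<sigma> t) t \<bullet> w (\<sigma> t) t))"
      proof (intro sum_mono)
        fix t
        have "excess \<gamma> (\<sigma> t) (?x t) (w (\<sigma> t) t) = a t - \<gamma>\<^sup>2 * b t"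
          by (simp add: a_def b_def controlled_output_def lti_system.excess_def[OF modes[OF mode]]
              lti_system.out_def[OF modes[OF mode]])
        moreover have "d * b t \<le> c * (?x t \<bullet> ?x t + b t)"
          using d sqnorm_ge_0 by (intro mult_mono) (auto simp: b_def)
        ultimately show "a t - g\<^sup>2 * b t \<le> excess \<gamma> (\<sigma> t) (?x t) (w (\<sigma> t) t) +
            c * (?x t \<bullet> ?x t + w (\<sigma> t) t \<bullet> w (\<sigma> t) t)"
          unfolding g(3) b_def[symmetric] by (simp add: algebra_simps)
      qed
      also have "\<dots> \<le> 0"
        using diss[of \<phi> \<sigma> w "0\<^sub>v n" m] sw w quad_zero_vec[OF pos_def_carrier[OF pos[OF mode]]] by simp
      finally show ?thesis by (simp add: sum_subtractf sum_distrib_left)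
    qed
    have nonneg: "0 \<le> a t" "0 \<le> b t" for t by (auto simp: a_def b_def sqnorm_ge_0)
    show "(\<Sum>s. \<Sum>k<\<phi> (Suc s) - \<phi> s. ennreal ((norm2 (?z (\<sigma> (\<phi> s)) (\<phi> s + k)))\<^sup>2))
      \<le> ennreal (g\<^sup>2) * (\<Sum>s. \<Sum>k<\<phi> (Suc s) - \<phi> s. ennreal ((norm2 (w (\<sigma> (\<phi> s)) (\<phi> s + k)))\<^sup>2))"
      unfolding blocks a_def[symmetric] b_def[symmetric]
    proof (rule suminf_le_const[OF summableI])
      fix m
      have "(\<Sum>s<m. \<Sum>k<\<phi> (Suc s) - \<phi> s. ennreal (a (\<phi> s + k))) = (\<Sum>t<\<phi> m. ennreal (a t))"
        by (rule sum_dwell_intervals[OF sw])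
      also have "\<dots> = ennreal (\<Sum>t<\<phi> m. a t)" using nonneg by (intro sum_ennreal) auto
      also have "\<dots> \<le> ennreal (g\<^sup>2 * (\<Sum>t<\<phi> m. b t))" by (rule ennreal_leI[OF finite_horizon])
      also have "\<dots> = ennreal (g\<^sup>2) * (\<Sum>t<\<phi> m. ennreal (b t))"
        using nonneg by (simp add: ennreal_mult sum_nonneg sum_ennreal)
      also have "(\<Sum>t<\<phi> m. ennreal (b t)) = (\<Sum>s<m. \<Sum>k<\<phi> (Suc s) - \<phi> s. ennreal (b (\<phi> s + k)))"
        by (rule sum_dwell_intervals[OF sw, symmetric])
      also have "ennreal (g\<^sup>2) * \<dots> \<le> ennreal (g\<^sup>2) * (\<Sum>s. \<Sum>k<\<phi> (Suc s) - \<phi> s. ennreal (b (\<phi> s + k)))"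
        by (intro mult_left_mono sum_le_suminf) auto
      finally show "(\<Sum>s<m. \<Sum>k<\<phi> (Suc s) - \<phi> s. ennreal (a (\<phi> s + k)))
        \<le> ennreal (g\<^sup>2) * (\<Sum>s. \<Sum>k<\<phi> (Suc s) - \<phi> s. ennreal (b (\<phi> s + k)))" .
    qed
  qed
  then have "l2_gain N \<tau> n p A E C F \<le> ereal g"
    unfolding l2_gain_def using g(1) by (intro Inf_lower imageI) simp
  then show ?thesis using g(2) by (simp add: order_le_less_trans)
qed

end

theorem theorem6p1:
  fixes N \<tau> n :: nat and p q :: "nat \<Rightarrow> nat"
    and A E C F :: "nat \<Rightarrow> real mat"
  assumes "N \<ge> 2" and "\<tau> \<ge> 1"
    and "\<forall>i\<in>{1..N}. A i \<in> carrier_mat n n"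
    and "\<forall>i\<in>{1..N}. E i \<in> carrier_mat n (p i)"
    and "\<forall>i\<in>{1..N}. C i \<in> carrier_mat (q i) n"
    and "\<forall>i\<in>{1..N}. F i \<in> carrier_mat (q i) (p i)"
  shows "((\<exists>\<gamma>>0. lifted_condition N \<tau> n p q A E C F \<gamma>) \<longleftrightarrow>
          (\<exists>\<gamma>>0. primal_condition N \<tau> n p A E C F \<gamma>)) \<and>
         ((\<exists>\<gamma>>0. primal_condition N \<tau> n p A E C F \<gamma>) \<longleftrightarrow>
          (\<exists>\<gamma>>0. dual_condition N \<tau> n p q A E C F \<gamma>)) \<and>
         (\<forall>\<gamma>>0. lifted_condition N \<tau> n p q A E C F \<gamma> \<or>
                primal_condition N \<tau> n p A E C F \<gamma> \<or>
                dual_condition N \<tau> n p q A E C F \<gamma> \<longrightarrow>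
            (\<forall>\<phi> \<sigma>. switching_signal N \<tau> \<phi> \<sigma> \<longrightarrow>
               asymptotically_stable n (state A E \<sigma> (\<lambda>i t. 0\<^sub>v (p i)))) \<and>
            l2_gain N \<tau> n p A E C F < ereal \<gamma>)"
proof -
  interpret switched_system N \<tau> n p q A E C F
  proof (rule switched_system.intro)
    fix i assume "i \<in> {1..N}"
    then show "lti_system n (p i) (q i) (A i) (E i) (C i) (F i)"
      by (intro lti_system.intro bspec[OF assms(3)] bspec[OF assms(4)] bspec[OF assms(5)] bspec[OF assms(6)])
  qed (use assms(1,2) in simp_all)
  have primal: "primal_condition N \<tau> n p A E C F \<gamma> \<longleftrightarrow> lifted_condition N \<tau> n p q A E C F \<gamma>" for \<gamma>
    by (rule iffI[OF primal_imp_lifted lifted_imp_primal])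
  have dual: "dual_condition N \<tau> n p q A E C F \<gamma> \<longleftrightarrow> lifted_condition N \<tau> n p q A E C F \<gamma>" if "\<gamma> > 0" for \<gamma>
    by (rule iffI[OF dual_imp_lifted[OF that] lifted_imp_dual[OF that]])
  show ?thesis
  proof (intro conjI allI impI)
    fix \<gamma> :: real
    assume \<gamma>: "\<gamma> > 0" and "lifted_condition N \<tau> n p q A E C F \<gamma> \<or>
      primal_condition N \<tau> n p A E C F \<gamma> \<or> dual_condition N \<tau> n p q A E C F \<gamma>"
    then have lifted: "lifted_condition N \<tau> n p q A E C F \<gamma>" using primal dual[OF \<gamma>] by blast
    show "asymptotically_stable n (state A E \<sigma> (\<lambda>i t. 0\<^sub>v (p i)))" if "switching_signal N \<tau> \<phi> \<sigma>" for \<phi> \<sigma>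
      by (rule asymptotically_stable_switched[OF lifted that])
    show "l2_gain N \<tau> n p A E C F < ereal \<gamma>" by (rule l2_gain_less[OF \<gamma> lifted])
  qed (simp_all only: primal dual cong: conj_cong)
qed

end
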